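(* Let $\lambda$ be a partition of $n\ge 1$ and let $\Lambda$ be a standard tableau of shape $\lambda$. Then the restriction to the subspace $\mathcal{H}_\Lambda\subset\mathbb{C}^n$ of the $\mathbb{C}S_n$-valued rational function $F_\Lambda(z_1,\dots,z_n)$ is regular at $z_1=z_2=\dots=z_n$. The value of this restriction at $z_1=z_2=\dots=z_n$ coincides with the diagonal matrix element $F_\Lambda\in\mathbb{C}S_n$.
   Context: The Young diagram of $\lambda$ is the set of boxes $(i,j)\in\mathbb{Z}^2$ with $i\geq 1$, $1\le j\le\lambda_i$ ($i$ is the row index increasing downwards, $j$ the column index increasing to the right). The $i$-th principal hook of $\lambda$ is the set of boxes $\{(i,j')\in\lambda: j'\ge i\}\cup\{(i',i)\in\lambda: i'\ge i\}$. A standard tableau $\Lambda$ of shape $\lambda$ is a filling of the boxes of $\lambda$ with the numbers $1,\dots,n$, each occurring once, with entries increasing along rows and down columns. For $p=1,\dots,n$ put $c_p=j-i$ if $p$ occupies the box $(i,j)$ of $\Lambda$ (the content of that box). For distinct $p,q\in\{1,\dots,n\}$ let $(pq)\in S_n$ be the transposition and set $$f_{pq}(u,v)=1-\frac{(pq)}{u-v},$$ a rational function of complex variables $u,v$ with values in the group ring $\mathbb{C}S_n$. Define $$F_\Lambda(z_1,\dots,z_n)=\prod_{(p,q)}^{\rightarrow} f_{pq}(z_p+c_p,\,z_q+c_q),$$ the product over all pairs $(p,q)$ with $1\le p<q\le n$, taken from left to right in lexicographic order of the pairs. $\mathcal{H}_\Lambda$ is the vector subspace of $\mathbb{C}^n$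 of all tuples $(z_1,\dots,z_n)$ such that $z_p=z_q$ whenever $p$ and $q$ appear in the same principal hook of $\Lambda$. "Regular at $z_1=\dots=z_n$" means that the restriction, as a rational function on $\mathcal{H}_\Lambda$ with values in $\mathbb{C}S_n$, has no pole at any point of the line $z_1=z_2=\dots=z_n$. Let $V_\lambda$ be the irreducible $\mathbb{C}S_n$-module corresponding to $\lambda$ (with $V_{(n)}$ the trivial representation), equipped with an $S_n$-invariant inner product $(\cdot,\cdot)$. The Young basis of $V_\lambda$ is the orthonormal basis of vectors $v_\Lambda$ labelled by the standard tableaux $\Lambda$ of shape $\lambda$, where $v_\Lambda$ is a simultaneous eigenvector of the Jucys–Murphy elements $\sum_{q<p}(qp)$, $p=1,\dots,n$, with eigenvalues $c_p$ (the contents for $\Lambda$). The diagonal matrix element is $$F_\Lambda=\sum_{g\in S_n}(v_\Lambda,\,g\,v_\Lambda)\,g\in\mathbb{C}S_n.$$ *)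

theory Defs
  imports Complex_Main "HOL-Combinatorics.Permutations" "HOL-Computational_Algebra.Polynomial"
begin

section \<open>Partitions and standard tableaux\<close>

definition partition_of :: "nat \<Rightarrow> nat list \<Rightarrow> bool" where
  "partition_of n lam \<longleftrightarrow>
     sorted_wrt (\<ge>) lam \<and> (\<forall>k\<in>set lam. 0 < k) \<and> sum_list lam = n"

definition diagram :: "nat list \<Rightarrow> (nat \<times> nat) set" where
  "diagram lam = {(i, j). 1 \<le> i \<and> i \<le> length lam \<and> 1 \<le> j \<and> j \<le> lam ! (i - 1)}"

definition principal_hook :: "nat list \<Rightarrow> nat \<Rightarrow> (nat \<times> nat) set" where
  "principal_hook lam i =
     {(i, j') | j'. (i, j') \<in> diagram lam \<and> i \<le> j'} \<union>
     {(i', i) | i'. (i', i) \<in> diagram lam \<and> i \<le> i'}"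

type_synonym tableau = "nat \<times> nat \<Rightarrow> nat"

text \<open>Tableaux are normalised to be \<open>0\<close> off the diagram, so that two standard
  tableaux are equal as functions iff they are equal as fillings.\<close>

definition standard_tableau :: "nat list \<Rightarrow> tableau \<Rightarrow> bool" where
  "standard_tableau lam T \<longleftrightarrow>
     bij_betw T (diagram lam) {1..sum_list lam} \<and>
     (\<forall>b. b \<notin> diagram lam \<longrightarrow> T b = 0) \<and>
     (\<forall>i j j'. (i, j) \<in> diagram lam \<and> (i, j') \<in> diagram lam \<and> j < j' \<longrightarrow> T (i, j) < T (i, j')) \<and>
     (\<forall>i i' j. (i, j) \<in> diagram lam \<and> (i', j) \<in> diagram lam \<and> i < i' \<longrightarrow> T (i, j) < T (i', j))"

definition box_of :: "nat list \<Rightarrow> tableau \<Rightarrow> nat \<Rightarrow> nat \<times> nat" where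
  "box_of lam T p = inv_into (diagram lam) T p"

definition content :: "nat list \<Rightarrow> tableau \<Rightarrow> nat \<Rightarrow> int" where
  "content lam T p = int (snd (box_of lam T p)) - int (fst (box_of lam T p))"

section \<open>The group ring of the symmetric group\<close>

text \<open>Elements of \<open>S\<^sub>n\<close> are the functions permuting \<open>{1..n}\<close>, multiplied by composition.
  An element of the group ring is its coefficient function, which is \<open>0\<close> off \<open>S\<^sub>n\<close>.\<close>

type_synonym gring = "(nat \<Rightarrow> nat) \<Rightarrow> complex"

definition Sym :: "nat \<Rightarrow> (nat \<Rightarrow> nat) set" where
  "Sym n = {g. g permutes {1..n}}"

definition gring_carrier :: "nat \<Rightarrow> gring set" where
  "gring_carrier n = {a. \<forall>g. g \<notin> Sym n \<longrightarrow> a g = 0}"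

definition gsingle :: "(nat \<Rightarrow> nat) \<Rightarrow> gring" where
  "gsingle h = (\<lambda>g. if g = h then 1 else 0)"

definition gmult :: "nat \<Rightarrow> gring \<Rightarrow> gring \<Rightarrow> gring" where
  "gmult n a b = (\<lambda>g. if g \<in> Sym n then \<Sum>h\<in>Sym n. a h * b (inv h \<circ> g) else 0)"

section \<open>The fusion product\<close>

text \<open>At \<open>u = v\<close> the quotient has the default value \<open>0\<close>; such points are excluded from
  \<open>fusion_domain\<close> below.\<close>

definition fusion_factor :: "nat \<Rightarrow> nat \<Rightarrow> complex \<Rightarrow> complex \<Rightarrow> gring" where
  "fusion_factor p q u v =
     (\<lambda>g. gsingle id g - gsingle (Transposition.transpose p q) g / (u - v))"

definition lex_pairs :: "nat \<Rightarrow> (nat \<times> nat) list" where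
  "lex_pairs n = concat (map (\<lambda>p. map (\<lambda>q. (p, q)) [Suc p..<Suc n]) [1..<Suc n])"

definition fusion_product :: "nat list \<Rightarrow> tableau \<Rightarrow> (nat \<Rightarrow> complex) \<Rightarrow> gring" where
  "fusion_product lam T z =
     (let n = sum_list lam in
      foldr (gmult n)
        (map (\<lambda>(p, q). fusion_factor p q (z p + of_int (content lam T p))
                                         (z q + of_int (content lam T q)))
             (lex_pairs n))
        (gsingle id))"

section \<open>The subspace attached to a tableau and rational functions on it\<close>

text \<open>\<open>\<complex>\<^sup>n\<close> is the space of functions on \<open>nat\<close> vanishing off \<open>{1..n}\<close>.\<close>

definition Cspace :: "nat \<Rightarrow> (nat \<Rightarrow> complex) set" where
  "Cspace n = {z. \<forall>p. p \<notin> {1..n} \<longrightarrow> z p = 0}"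

definition diag_point :: "nat \<Rightarrow> complex \<Rightarrow> nat \<Rightarrow> complex" where
  "diag_point n t = (\<lambda>p. if p \<in> {1..n} then t else 0)"

definition hook_subspace :: "nat list \<Rightarrow> tableau \<Rightarrow> (nat \<Rightarrow> complex) set" where
  "hook_subspace lam T =
     {z \<in> Cspace (sum_list lam).
        \<forall>p\<in>{1..sum_list lam}. \<forall>q\<in>{1..sum_list lam}.
          (\<exists>i. box_of lam T p \<in> principal_hook lam i \<and> box_of lam T q \<in> principal_hook lam i)
          \<longrightarrow> z p = z q}"

text \<open>The points of the subspace where no denominator of the fusion product vanishes.\<close>

definition fusion_domain :: "nat list \<Rightarrow> tableau \<Rightarrow> (nat \<Rightarrow> complex) set" where
  "fusion_domain lam T =
     {z \<in> hook_subspace lam T.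
        \<forall>p q. 1 \<le> p \<and> p < q \<and> q \<le> sum_list lam \<longrightarrow>
          z p + of_int (content lam T p) \<noteq> z q + of_int (content lam T q)}"

inductive_set poly_fun :: "nat \<Rightarrow> ((nat \<Rightarrow> complex) \<Rightarrow> complex) set" for n :: nat where
  const: "(\<lambda>z. c) \<in> poly_fun n"
| coord: "p \<in> {1..n} \<Longrightarrow> (\<lambda>z. z p) \<in> poly_fun n"
| add: "P \<in> poly_fun n \<Longrightarrow> Q \<in> poly_fun n \<Longrightarrow> (\<lambda>z. P z + Q z) \<in> poly_fun n"
| mult: "P \<in> poly_fun n \<Longrightarrow> Q \<in> poly_fun n \<Longrightarrow> (\<lambda>z. P z * Q z) \<in> poly_fun n"

text \<open>A rational function on a linear subspace of \<open>\<complex>\<^sup>n\<close> is given by its values \<open>f\<close> on a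
  nonempty subset \<open>U\<close> of the subspace, the complement of the zeros of a polynomial.
  It has no pole at \<open>a\<close>, and takes the value \<open>w\<close> there, if it can be
  written as a quotient of polynomials with denominator nonzero at \<open>a\<close>; the point \<open>a\<close>
  need not lie in \<open>U\<close>. Nonemptiness of \<open>U\<close> says that the rational function is defined at all,
  i.e. that no denominator vanishes identically on the subspace.\<close>

definition has_rational_value ::
  "nat \<Rightarrow> (nat \<Rightarrow> complex) set \<Rightarrow> ((nat \<Rightarrow> complex) \<Rightarrow> complex) \<Rightarrow> (nat \<Rightarrow> complex) \<Rightarrow> complex \<Rightarrow> bool"
  where
  "has_rational_value n U f a w \<longleftrightarrow>
     U \<noteq> {} \<and>
     (\<exists>P\<in>poly_fun n. \<exists>Q\<in>poly_fun n. Q a \<noteq> 0 \<and> (\<forall>z\<in>U. f z * Q z = P z) \<and> w = P a / Q a)"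

definition gring_regular_at ::
  "nat \<Rightarrow> (nat \<Rightarrow> complex) set \<Rightarrow> ((nat \<Rightarrow> complex) \<Rightarrow> gring) \<Rightarrow> (nat \<Rightarrow> complex) \<Rightarrow> bool" where
  "gring_regular_at n U f a \<longleftrightarrow> (\<forall>g. \<exists>w. has_rational_value n U (\<lambda>z. f z g) a w)"

definition gring_value_at ::
  "nat \<Rightarrow> (nat \<Rightarrow> complex) set \<Rightarrow> ((nat \<Rightarrow> complex) \<Rightarrow> gring) \<Rightarrow> (nat \<Rightarrow> complex) \<Rightarrow> gring" where
  "gring_value_at n U f a = (\<lambda>g. THE w. has_rational_value n U (\<lambda>z. f z g) a w)"

text \<open>The value of a regular function is unique, so the description operator above is justified.\<close>

lemma poly_fun_line:
  assumes "P \<in> poly_fun n"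
  shows "\<exists>p. \<forall>t. P (\<lambda>i. a i + t * b i) = poly p t"
  using assms
proof induction
  case (const c)
  show ?case by (rule exI[of _ "[:c:]"]) simp
next
  case (coord i)
  show ?case by (rule exI[of _ "[:a i, b i:]"]) simp
next
  case (add P Q)
  then obtain p q where "\<forall>t. P (\<lambda>i. a i + t * b i) = poly p t"
    "\<forall>t. Q (\<lambda>i. a i + t * b i) = poly q t" by blast
  then show ?case by (intro exI[of _ "p + q"]) simp
next
  case (mult P Q)
  then obtain p q where "\<forall>t. P (\<lambda>i. a i + t * b i) = poly p t"
    "\<forall>t. Q (\<lambda>i. a i + t * b i) = poly q t" by blast
  then show ?case by (intro exI[of _ "p * q"]) simp
qed

lemma poly_fun_prod:
  assumes "finite A" "\<And>x. x \<in> A \<Longrightarrow> P x \<in> poly_fun n"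
  shows "(\<lambda>z. \<Prod>x\<in>A. P x z) \<in> poly_fun n"
  using assms by (induction A rule: finite_induct) (auto intro: poly_fun.intros)

lemma has_rational_value_unique:
  assumes D: "D \<in> poly_fun n" and U: "U = {z \<in> H. D z \<noteq> 0}"
    and line: "\<And>z t. z \<in> H \<Longrightarrow> (\<lambda>i. a i + t * (z i - a i)) \<in> H"
    and 1: "has_rational_value n U f a w1" and 2: "has_rational_value n U f a w2"
  shows "w1 = w2"
proof -
  obtain z0 where z0: "z0 \<in> H" "D z0 \<noteq> 0"
    using 1 U by (auto simp: has_rational_value_def)
  obtain P1 Q1 where f1: "P1 \<in> poly_fun n" "Q1 \<in> poly_fun n" "Q1 a \<noteq> 0"
    "\<forall>z\<in>U. f z * Q1 z = P1 z" "w1 = P1 a / Q1 a"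
    using 1 by (auto simp: has_rational_value_def)
  obtain P2 Q2 where f2: "P2 \<in> poly_fun n" "Q2 \<in> poly_fun n" "Q2 a \<noteq> 0"
    "\<forall>z\<in>U. f z * Q2 z = P2 z" "w2 = P2 a / Q2 a"
    using 2 by (auto simp: has_rational_value_def)
  define L where "L t = (\<lambda>i. a i + t * (z0 i - a i))" for t
  have L0: "L 0 = a" and L1: "L 1 = z0" and LH: "L t \<in> H" for t
    using line[OF z0(1)] by (auto simp: L_def)
  obtain d where d: "\<And>t. D (L t) = poly d t" using poly_fun_line[OF D, of a "\<lambda>i. z0 i - a i"] unfolding L_def by blast
  obtain p1 where p1: "\<And>t. P1 (L t) = poly p1 t" using poly_fun_line[OF f1(1), of a "\<lambda>i. z0 i - a i"] unfolding L_def by blast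
  obtain q1 where q1: "\<And>t. Q1 (L t) = poly q1 t" using poly_fun_line[OF f1(2), of a "\<lambda>i. z0 i - a i"] unfolding L_def by blast
  obtain p2 where p2: "\<And>t. P2 (L t) = poly p2 t" using poly_fun_line[OF f2(1), of a "\<lambda>i. z0 i - a i"] unfolding L_def by blast
  obtain q2 where q2: "\<And>t. Q2 (L t) = poly q2 t" using poly_fun_line[OF f2(2), of a "\<lambda>i. z0 i - a i"] unfolding L_def by blast
  have "poly ((p1 * q2 - p2 * q1) * d) t = 0" for t
  proof (cases "D (L t) = 0")
    case True
    then show ?thesis by (simp add: d)
  next
    case False
    then have "L t \<in> U" using LH U by simp
    then have "P1 (L t) = f (L t) * Q1 (L t)" "P2 (L t) = f (L t) * Q2 (L t)"
      using f1(4) f2(4) by auto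
    then show ?thesis by (simp add: p1[symmetric] p2[symmetric] q1[symmetric] q2[symmetric])
  qed
  then have "(p1 * q2 - p2 * q1) * d = 0" by (simp add: poly_all_0_iff_0[symmetric])
  moreover have "d \<noteq> 0" using d[of 1] L1 z0 by auto
  ultimately have "p1 * q2 = p2 * q1" by simp
  then have "P1 a * Q2 a = P2 a * Q1 a"
    using p1[of 0] p2[of 0] q1[of 0] q2[of 0] by (simp add: L0 flip: poly_mult)
  then show ?thesis unfolding f1(5) f2(5) by (simp add: frac_eq_eq f1(3) f2(3))
qed

lemma fusion_value_unique:
  assumes "has_rational_value (sum_list lam) (fusion_domain lam T) f (diag_point (sum_list lam) t) w1"
    and "has_rational_value (sum_list lam) (fusion_domain lam T) f (diag_point (sum_list lam) t) w2"
  shows "w1 = w2"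
proof -
  define n where "n = sum_list lam"
  define A where "A = {(p, q). 1 \<le> p \<and> p < q \<and> q \<le> n}"
  define D where "D = (\<lambda>z. \<Prod>x\<in>A. z (fst x) + (- 1) * z (snd x) +
    (of_int (content lam T (fst x)) - of_int (content lam T (snd x)) :: complex))"
  have "A \<subseteq> {..n} \<times> {..n}" by (auto simp: A_def)
  then have fin: "finite A" by (rule finite_subset) simp
  have "D \<in> poly_fun n"
    unfolding D_def
    by (rule poly_fun_prod[OF fin], intro poly_fun.intros) (auto simp: A_def)
  moreover have "fusion_domain lam T = {z \<in> hook_subspace lam T. D z \<noteq> 0}"
    using fin by (force simp: fusion_domain_def D_def A_def n_def algebra_simps)
  moreover have "(\<lambda>i. diag_point n t i + s * (z i - diag_point n t i)) \<in> hook_subspace lam T"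
    if "z \<in> hook_subspace lam T" for z s
    using that by (fastforce simp: hook_subspace_def Cspace_def diag_point_def n_def)
  ultimately show ?thesis
    using has_rational_value_unique assms unfolding n_def by blast
qed

section \<open>Representations of the symmetric group\<close>

text \<open>The representation space is the whole type \<open>'v\<close>, a complex vector space under \<open>scale\<close>.\<close>

definition representation ::
  "nat \<Rightarrow> (complex \<Rightarrow> 'v::ab_group_add \<Rightarrow> 'v) \<Rightarrow> ((nat \<Rightarrow> nat) \<Rightarrow> 'v \<Rightarrow> 'v) \<Rightarrow> bool" where
  "representation n scale \<rho> \<longleftrightarrow>
     vector_space scale \<and>
     (\<forall>g\<in>Sym n. Vector_Spaces.linear scale scale (\<rho> g)) \<and>
     \<rho> id = id \<and>
     (\<forall>g\<in>Sym n. \<forall>h\<in>Sym n. \<rho> (g \<circ> h) = \<rho> g \<circ> \<rho> h)"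

definition irreducible_representation ::
  "nat \<Rightarrow> (complex \<Rightarrow> 'v::ab_group_add \<Rightarrow> 'v) \<Rightarrow> ((nat \<Rightarrow> nat) \<Rightarrow> 'v \<Rightarrow> 'v) \<Rightarrow> bool" where
  "irreducible_representation n scale \<rho> \<longleftrightarrow>
     representation n scale \<rho> \<and>
     (\<exists>x::'v. x \<noteq> 0) \<and>
     (\<forall>W. module.subspace scale W \<and> (\<forall>g\<in>Sym n. \<rho> g ` W \<subseteq> W) \<longrightarrow> W = {0} \<or> W = UNIV)"

text \<open>The irreducible module attached to \<open>lam\<close> is the left ideal generated by the Young
  symmetrizer (sum over the row group times signed sum over the column group) of the tableau
  filled row by row. For \<open>lam = [n]\<close> this is the trivial module.\<close>

definition row_tableau :: "nat list \<Rightarrow> tableau" where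
  "row_tableau lam =
     (\<lambda>(i, j). if (i, j) \<in> diagram lam then sum_list (take (i - 1) lam) + j else 0)"

definition row_group :: "nat list \<Rightarrow> tableau \<Rightarrow> (nat \<Rightarrow> nat) set" where
  "row_group lam T =
     {g \<in> Sym (sum_list lam).
        \<forall>p\<in>{1..sum_list lam}. fst (box_of lam T (g p)) = fst (box_of lam T p)}"

definition column_group :: "nat list \<Rightarrow> tableau \<Rightarrow> (nat \<Rightarrow> nat) set" where
  "column_group lam T =
     {g \<in> Sym (sum_list lam).
        \<forall>p\<in>{1..sum_list lam}. snd (box_of lam T (g p)) = snd (box_of lam T p)}"

definition young_symmetrizer :: "nat list \<Rightarrow> gring" where
  "young_symmetrizer lam =
     gmult (sum_list lam)
       (\<lambda>g. if g \<in> row_group lam (row_tableau lam) then 1 else 0)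
       (\<lambda>g. if g \<in> column_group lam (row_tableau lam) then of_int (sign g) else 0)"

definition young_ideal :: "nat list \<Rightarrow> gring set" where
  "young_ideal lam =
     (\<lambda>a. gmult (sum_list lam) a (young_symmetrizer lam)) ` gring_carrier (sum_list lam)"

definition irreducible_module_of ::
  "nat list \<Rightarrow> (complex \<Rightarrow> 'v::ab_group_add \<Rightarrow> 'v) \<Rightarrow> ((nat \<Rightarrow> nat) \<Rightarrow> 'v \<Rightarrow> 'v) \<Rightarrow> bool" where
  "irreducible_module_of lam scale \<rho> \<longleftrightarrow>
     irreducible_representation (sum_list lam) scale \<rho> \<and>
     (\<exists>\<phi>. bij_betw \<phi> (UNIV :: 'v set) (young_ideal lam) \<and>
          (\<forall>x y. \<phi> (x + y) = (\<lambda>g. \<phi> x g + \<phi> y g)) \<and>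
          (\<forall>c x. \<phi> (scale c x) = (\<lambda>g. c * \<phi> x g)) \<and>
          (\<forall>h\<in>Sym (sum_list lam). \<forall>x. \<phi> (\<rho> h x) = gmult (sum_list lam) (gsingle h) (\<phi> x)))"

text \<open>Hermitian inner products are linear in the second argument. (For the matrix
  elements below, which are real, the choice of argument makes no difference.)\<close>

definition invariant_inner_product ::
  "nat \<Rightarrow> (complex \<Rightarrow> 'v::ab_group_add \<Rightarrow> 'v) \<Rightarrow> ((nat \<Rightarrow> nat) \<Rightarrow> 'v \<Rightarrow> 'v) \<Rightarrow>
   ('v \<Rightarrow> 'v \<Rightarrow> complex) \<Rightarrow> bool" where
  "invariant_inner_product n scale \<rho> ip \<longleftrightarrow>
     (\<forall>x y z. ip x (y + z) = ip x y + ip x z) \<and>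
     (\<forall>c x y. ip x (scale c y) = c * ip x y) \<and>
     (\<forall>x y. ip y x = cnj (ip x y)) \<and>
     (\<forall>x. x \<noteq> 0 \<longrightarrow> Re (ip x x) > 0) \<and>
     (\<forall>g\<in>Sym n. \<forall>x y. ip (\<rho> g x) (\<rho> g y) = ip x y)"

definition jucys_murphy :: "((nat \<Rightarrow> nat) \<Rightarrow> 'v::ab_group_add \<Rightarrow> 'v) \<Rightarrow> nat \<Rightarrow> 'v \<Rightarrow> 'v" where
  "jucys_murphy \<rho> p x = (\<Sum>q\<in>{1..<p}. \<rho> (Transposition.transpose q p) x)"

definition young_basis ::
  "nat list \<Rightarrow> (complex \<Rightarrow> 'v::ab_group_add \<Rightarrow> 'v) \<Rightarrow> ((nat \<Rightarrow> nat) \<Rightarrow> 'v \<Rightarrow> 'v) \<Rightarrow>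
   ('v \<Rightarrow> 'v \<Rightarrow> complex) \<Rightarrow> (tableau \<Rightarrow> 'v) \<Rightarrow> bool" where
  "young_basis lam scale \<rho> ip v \<longleftrightarrow>
     (\<forall>T T'. standard_tableau lam T \<and> standard_tableau lam T' \<longrightarrow>
        ip (v T) (v T') = (if T = T' then 1 else 0)) \<and>
     module.span scale (v ` Collect (standard_tableau lam)) = UNIV \<and>
     (\<forall>T. standard_tableau lam T \<longrightarrow>
        (\<forall>p\<in>{1..sum_list lam}.
           jucys_murphy \<rho> p (v T) = scale (of_int (content lam T p)) (v T)))"

definition matrix_element ::
  "nat \<Rightarrow> ((nat \<Rightarrow> nat) \<Rightarrow> 'v \<Rightarrow> 'v) \<Rightarrow> ('v \<Rightarrow> 'v \<Rightarrow> complex) \<Rightarrow> 'v \<Rightarrow> gring" where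
  "matrix_element n \<rho> ip x = (\<lambda>g. if g \<in> Sym n then ip x (\<rho> g x) else 0)"

end

theory Submission
  imports Defs "HOL-Combinatorics.Perm" "HOL-Library.Poly_Mapping"
begin

text \<open>
  Write \<open>F(z)\<close> for the fusion product and \<open>x\<^sub>p = z\<^sub>p + c\<^sub>p\<close>. By the Yang-Baxter equation \<open>F\<close> is divisible by
  \<open>f\<^sub>k\<^sub>,\<^sub>k\<^sub>+\<^sub>1\<close> on both sides, is fixed by the anti-involution \<open>g \<mapsto> g\<^sup>-\<^sup>1\<close>, and the products of two standard tableaux that differ
  by an adjacent transposition are related by multiplication with regular factors. So it suffices to treat one
  tableau of each shape: the one which lists the principal hooks one after another. For it, each factor \<open>f\<^sub>p\<^sub>N\<close>
  that is singular on the diagonal is followed by \<open>f\<^sub>p\<^sub>+\<^sub>1\<^sub>,\<^sub>N\<close>, where \<open>p\<close> and \<open>p + 1\<close> are neighbours in one hook, and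
  after multiplication by the preceding factors (which absorb \<open>f\<^sub>p\<^sub>,\<^sub>p\<^sub>+\<^sub>1\<close>) the product of these two is regular.

  The value \<open>E\<close> is an eigenvector of the Jucys-Murphy elements for left multiplication, with the contents of \<open>\<Lambda>\<close> as
  eigenvalues: if \<open>E'\<close> is the value for the first \<open>N - 1\<close> entries, then
  \<open>(u - X\<^sub>N) E' \<Prod>\<^sub>p f\<^sub>p\<^sub>N(c\<^sub>p, u) = u \<Prod>\<^sub>p (1 - (u - c\<^sub>p)\<^sup>-\<^sup>2) E'\<close>, and the right hand side vanishes at \<open>u = c\<^sub>N\<close> because the box of
  \<open>N\<close> can be added to the preceding ones. The coefficient of \<open>E\<close> at the identity is \<open>1\<close>.

  In a unitary representation a vector \<open>w\<close> with these eigenvalues determines, by intertwining operators, a family of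
  eigenvectors \<open>w\<^sub>\<sigma>\<close>, one for each standard tableau, which does not depend on the order in which the intertwiners are
  applied, and \<open>g w = \<Sum>\<^sub>\<sigma> m\<^sub>g(\<sigma>) w\<^sub>\<sigma>\<close> with real coefficients \<open>m\<^sub>g(\<sigma>)\<close> that depend on \<open>\<Lambda>\<close> and \<open>g\<close> only. For the Young basis this
  gives \<open>(v\<^sub>\<Lambda>, g v\<^sub>\<Lambda>) = m\<^sub>g(id)\<close>, and for \<open>E\<close> in the regular representation it gives \<open>E(g\<^sup>-\<^sup>1) = m\<^sub>g(id)\<close>.
\<close>

section \<open>The group algebra of finitely supported permutations\<close>

text \<open>\<open>Poly_Mapping\<close> defines the convolution product for additively written index monoids, so composition of
  permutations has to be available as an addition.\<close>

instantiation Perm.perm :: (type) group_add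
begin

definition zero_perm :: "'a perm" where "zero_perm = 1"
definition plus_perm :: "'a perm \<Rightarrow> 'a perm \<Rightarrow> 'a perm" where "plus_perm g h = g * h"
definition uminus_perm :: "'a perm \<Rightarrow> 'a perm" where "uminus_perm g = inverse g"
definition minus_perm :: "'a perm \<Rightarrow> 'a perm \<Rightarrow> 'a perm" where "minus_perm g h = g * inverse h"

instance
  by standard (simp_all add: zero_perm_def plus_perm_def uminus_perm_def minus_perm_def mult.assoc
      perm.left_inverse)

end

type_synonym galg = "nat perm \<Rightarrow>\<^sub>0 complex"

abbreviation lookup :: "galg \<Rightarrow> nat perm \<Rightarrow> complex" where
  "lookup \<equiv> Poly_Mapping.lookup"

text \<open>\<open>Perm\<close> is specified only on bijections of finite support, so
  \<open>sg g\<close> is the basis element of g only for such g.\<close>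

definition sg :: "(nat \<Rightarrow> nat) \<Rightarrow> galg" where
  "sg g = Poly_Mapping.single (Perm g) 1"

definition scl :: "complex \<Rightarrow> galg" where
  "scl c = Poly_Mapping.single 0 c"

abbreviation tr :: "nat \<Rightarrow> nat \<Rightarrow> galg" where
  "tr p q \<equiv> sg (Transposition.transpose p q)"

lemma apply_plus: "Perm.apply (g + h) = Perm.apply g \<circ> Perm.apply h"
  by (simp add: plus_perm_def apply_times)

lemma apply_zero: "Perm.apply 0 = id"
  by (simp add: zero_perm_def)

lemma apply_uminus: "Perm.apply (- g) = inv (Perm.apply g)"
  by (simp add: uminus_perm_def apply_inverse)

lemma apply_Perm:
  assumes "g permutes S" "finite S"
  shows "Perm.apply (Perm g) = g"
proof -
  have "finite {a. g a \<noteq> a}"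
    by (rule finite_subset[OF _ assms(2)]) (use assms(1) in \<open>auto simp: permutes_def\<close>)
  then show ?thesis
    using assms(1) by (intro Perm_inverse) (simp add: permutes_bij)
qed

lemma sg_comp:
  assumes "g permutes S" "finite S" "h permutes T" "finite T"
  shows "sg (g \<circ> h) = sg g * sg h"
proof -
  have "g permutes S \<union> T" "h permutes S \<union> T" "finite (S \<union> T)"
    using assms by (auto intro: permutes_subset)
  then have "Perm (g \<circ> h) = Perm g + Perm h"
    by (intro perm_eqI) (metis apply_Perm apply_plus permutes_compose)
  then show ?thesis by (simp add: sg_def mult_single)
qed

lemma sg_id: "sg id = 1"
proof -
  have "Perm id = (0 :: nat perm)"
    by (intro perm_eqI) (simp add: apply_Perm[OF permutes_id, of "{}"] apply_zero)
  then show ?thesis by (simp add: sg_def)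
qed

lemma transpose_permutes: "Transposition.transpose p q permutes {p, q}"
  by (simp add: permutes_swap_id)

lemma tr_comp:
  "sg (Transposition.transpose p q \<circ> Transposition.transpose a b) = tr p q * tr a b"
  by (rule sg_comp[OF transpose_permutes _ transpose_permutes]) auto

lemma tr_sym: "tr p q = tr q p"
  by (simp add: transpose_commute)

lemma tr_sq [simp]: "tr p q * tr p q = 1"
  by (simp flip: tr_comp add: sg_id)

lemma tr_sq_left [simp]: "tr p q * (tr p q * x) = x"
  by (simp flip: mult.assoc)

text \<open>Conjugation by a transposition relabels the entries of the other one. All relations
  between transpositions used later are instances of this.\<close>

lemma tr_conj:
  "tr p q * tr a b = tr a b * tr (Transposition.transpose a b p) (Transposition.transpose a b q)"
  by (simp flip: tr_comp) (rule arg_cong[of _ _ sg], auto simp: fun_eq_iff transpose_def)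

lemma tr_commute:
  assumes "{p, q} \<inter> {a, b} = {}"
  shows "tr p q * tr a b = tr a b * tr p q"
  using assms by (subst tr_conj) (auto simp: transpose_def)

lemma lookup_single_mult:
  "lookup (Poly_Mapping.single k c * x) g = c * lookup x (- k + g)"
proof -
  have eq: "g = k + q \<longleftrightarrow> q = - k + g" for q by (metis add.assoc add.left_inverse add.right_inverse add_0)
  show ?thesis
    by (simp add: lookup_mult lookup_single when_mult eq)
qed

lemma lookup_mult_single:
  "lookup (x * Poly_Mapping.single k c) g = lookup x (g - k) * c"
proof -
  have eq: "g = l + k \<longleftrightarrow> l = g - k" for l by (metis add_diff_cancel diff_add_cancel)
  have "Sum_any (\<lambda>q. (c when k = q) when g = l + q) = (c when g = l + k)" for l
  proof -
    have *: "(\<lambda>q. (c when k = q) when g = l + q) = (\<lambda>q. (c when g = l + k) when q = k)"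
      by (auto simp: fun_eq_iff when_def)
    then show ?thesis unfolding * by simp
  qed
  then show ?thesis by (simp add: lookup_mult lookup_single mult_when eq)
qed

lemma lookup_scl_mult [simp]: "lookup (scl c * x) g = c * lookup x g"
  by (simp add: scl_def lookup_single_mult)

lemma scl_central: "x * scl c = scl c * x"
  by (rule poly_mapping_eqI) (simp add: scl_def lookup_single_mult lookup_mult_single mult.commute)

lemma scl_0 [simp]: "scl 0 = 0" by (simp add: scl_def)
lemma scl_1 [simp]: "scl 1 = 1" by (simp add: scl_def)
lemma scl_add: "scl (a + b) = scl a + scl b" by (simp add: scl_def single_add)
lemma scl_diff: "scl (a - b) = scl a - scl b" by (simp add: scl_def single_diff)
lemma scl_uminus: "scl (- a) = - scl a" by (simp add: scl_def single_uminus)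
lemma scl_scl [simp]: "scl a * scl b = scl (a * b)" by (simp add: scl_def mult_single)
lemma scl_scl_left [simp]: "scl a * (scl b * x) = scl (a * b) * x" by (simp flip: mult.assoc)

text \<open>The guard keeps the rewriting from exchanging two scalars forever; scalars are collected
  on the left of other elements.\<close>

lemma scl_move: "NO_MATCH (scl d) x \<Longrightarrow> x * scl c = scl c * x"
  by (rule scl_central)

lemma scl_move_left: "NO_MATCH (scl d) x \<Longrightarrow> x * (scl c * y) = scl c * (x * y)"
  by (metis mult.assoc scl_central)

lemmas galg_simps = algebra_simps scl_move scl_move_left

section \<open>The factors of the product and the Yang-Baxter equation\<close>

text \<open>The rational R-matrix f_pq(u,v). At u = v it equals 1, since division by zero yields
  0.\<close>

definition rmat :: "nat \<Rightarrow> nat \<Rightarrow> complex \<Rightarrow> complex \<Rightarrow> galg" where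
  "rmat p q u v = 1 - scl (1 / (u - v)) * tr p q"

lemma rmat_sym: "rmat p q u v = rmat q p u v"
  by (simp add: rmat_def tr_sym)

lemma rmat_commute:
  assumes "{p, q} \<inter> {a, b} = {}"
  shows "rmat p q u v * rmat a b u' v' = rmat a b u' v' * rmat p q u v"
  using tr_commute[OF assms] by (simp add: rmat_def galg_simps)

lemma rmat_tr_commute:
  assumes "{p, q} \<inter> {a, b} = {}"
  shows "rmat p q u v * tr a b = tr a b * rmat p q u v"
  using tr_commute[OF assms] by (simp add: rmat_def galg_simps)

lemma rmat_tr_conj:
  "rmat p q u v * tr a b = tr a b * rmat (Transposition.transpose a b p) (Transposition.transpose a b q) u v"
  using tr_conj[of p q a b] by (simp add: rmat_def galg_simps)

text \<open>(1 - a t)(1 + a t) = 1 - a^2 for an involution t, so exchanging the parameters inverts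
  the R-matrix up to a scalar.\<close>

lemma rmat_inverse:
  assumes "u \<noteq> v"
  shows "rmat p q u v * rmat p q v u = scl (1 - 1 / (u - v)^2)"
proof -
  have "scl (1 / (v - u)) = - scl (1 / (u - v))"
    by (metis minus_diff_eq minus_divide_right scl_uminus)
  then show ?thesis
    by (simp add: rmat_def galg_simps power2_eq_square scl_diff scl_uminus)
qed

text \<open>Expanding both sides, the constant, linear and cubic terms agree. The quadratic terms
  are multiples of the two 3-cycles on p, q, r, with coefficients a b + b c and a c on one side and
  the opposite assignment on the other; the two coefficients are equal.\<close>

lemma yang_baxter:
  assumes "distinct [p, q, r]" "distinct [u, v, w]"
  shows "rmat p q u v * rmat p r u w * rmat q r v w = rmat q r v w * rmat p r u w * rmat p q u v"
proof -
  define a b c where "a = 1 / (u - v)" and "b = 1 / (u - w)" and "c = 1 / (v - w)"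
  \<comment> \<open>Partial fractions: u - w is the sum of u - v and v - w.\<close>
  have e: "a * c = b * a + b * c"
  proof -
    have "1 / x * (1 / y) = 1 / (x + y) * (1 / x) + 1 / (x + y) * (1 / y)"
      if "x \<noteq> 0" "y \<noteq> 0" "x + y \<noteq> 0" for x y :: complex
    proof -
      have "1 / (x + y) * (1 / x) + 1 / (x + y) * (1 / y) = 1 / (x + y) * ((x + y) / (x * y))"
        using that by (simp add: add_divide_distrib distrib_left)
      then show ?thesis using that by simp
    qed
    from this[of "u - v" "v - w"] show ?thesis
      using assms(2) by (simp add: a_def b_def c_def)
  qed
  have s1: "tr p r * tr q r = tr p q * tr p r" "tr q r * tr p q = tr p q * tr p r"
    and s2: "tr p q * tr q r = tr p r * tr p q" "tr q r * tr p r = tr p r * tr p q"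
    using assms(1) tr_conj[of p r q r] tr_conj[of q r p q] tr_conj[of p q q r] tr_conj[of q r p r]
      tr_conj[of p q p r] tr_conj[of p r p q]
    by (auto simp: transpose_def tr_sym)
  have t: "tr p q * tr p r * tr q r = tr p r" "tr q r * tr p r * tr p q = tr p r"
    using s1 s2 by (metis mult.assoc mult.right_neutral tr_sq)+
  have t': "tr p q * (tr p r * tr q r) = tr p r" "tr q r * (tr p r * tr p q) = tr p r"
    using t by (simp_all add: mult.assoc)
  have m1: "rmat p q u v * rmat p r u w * rmat q r v w =
     1 - scl a * tr p q - scl b * tr p r - scl c * tr q r + scl (a * b) * (tr p q * tr p r)
     + scl (a * c) * (tr p q * tr q r) + scl (b * c) * (tr p r * tr q r)
     - scl (a * b * c) * (tr p q * (tr p r * tr q r))"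
    by (simp add: rmat_def a_def[symmetric] b_def[symmetric] c_def[symmetric] galg_simps)
  have m2: "rmat q r v w * rmat p r u w * rmat p q u v =
     1 - scl a * tr p q - scl b * tr p r - scl c * tr q r + scl (b * c) * (tr q r * tr p r)
     + scl (a * c) * (tr q r * tr p q) + scl (a * b) * (tr p r * tr p q)
     - scl (a * b * c) * (tr q r * (tr p r * tr p q))"
    by (simp add: rmat_def a_def[symmetric] b_def[symmetric] c_def[symmetric] galg_simps)
  show ?thesis
    unfolding m1 m2 e t' s1 s2 scl_add by (simp add: galg_simps)
qed

section \<open>Symmetries of the fusion product\<close>

lemma rmat_commuteI: "y * tr a b = tr a b * y \<Longrightarrow> y * rmat a b u v = rmat a b u v * y"
  by (simp add: rmat_def galg_simps)

text \<open>The factors are grouped by their second index, unlike in the lexicographic order of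
  \<open>fusion_product\<close>; both orders give the same product since the factors that change places commute.\<close>

fun col :: "(nat \<Rightarrow> complex) \<Rightarrow> nat \<Rightarrow> nat \<Rightarrow> complex \<Rightarrow> galg" where
  "col x 0 N u = 1"
| "col x (Suc m) N u = col x m N u * rmat (Suc m) N (x (Suc m)) u"

fun rcol :: "(nat \<Rightarrow> complex) \<Rightarrow> nat \<Rightarrow> nat \<Rightarrow> complex \<Rightarrow> galg" where
  "rcol x 0 N u = 1"
| "rcol x (Suc m) N u = rmat (Suc m) N (x (Suc m)) u * rcol x m N u"

fun fus :: "(nat \<Rightarrow> complex) \<Rightarrow> nat \<Rightarrow> galg" where
  "fus x 0 = 1"
| "fus x (Suc m) = fus x m * col x m (Suc m) (x (Suc m))"

lemma mult_commute_tr: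
  assumes "y * t = t * y" "z * t = t * z"
  shows "(y * z) * t = t * (y * (z :: galg))"
  by (metis assms mult.assoc)

lemma col_tr_commute:
  assumes "m < a" "m < b" "N \<noteq> a" "N \<noteq> b"
  shows "col x m N u * tr a b = tr a b * col x m N u"
  using assms by (induction m) (auto intro!: mult_commute_tr rmat_tr_commute)

lemma fus_tr_commute:
  assumes "m < a" "m < b"
  shows "fus x m * tr a b = tr a b * fus x m"
  using assms by (induction m) (auto intro!: mult_commute_tr col_tr_commute)

text \<open>Iterated Yang-Baxter equation: the factor f_ab(u,v) is carried from right to left
  through the pairs f_pa, f_pb for p = m, ..., 1 and reverses each of them.\<close>

lemma col_col:
  assumes "m < a" "m < b" "a \<noteq> b" "u \<noteq> v" "\<And>p. p \<in> {1..m} \<Longrightarrow> x p \<noteq> u \<and> x p \<noteq> v"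
  shows "col x m a u * col x m b v * rmat a b u v = rmat a b u v * col x m b v * col x m a u"
  using assms
proof (induction m)
  case (Suc m)
  let ?A = "rmat (Suc m) a (x (Suc m)) u" and ?B = "rmat (Suc m) b (x (Suc m)) v" and ?S = "rmat a b u v"
  let ?a = "col x m a u" and ?b = "col x m b v"
  have yb: "?A * ?B * ?S = ?S * ?B * ?A"
    using Suc.prems by (intro yang_baxter) auto
  have c1: "?A * ?b = ?b * ?A" and c2: "?a * ?B = ?B * ?a"
    using Suc.prems by (auto intro!: rmat_commuteI[symmetric] rmat_commuteI col_tr_commute)
  have IH: "?a * ?b * ?S = ?S * ?b * ?a"
    using Suc by auto
  have "col x (Suc m) a u * col x (Suc m) b v * ?S = ?a * (?A * ?b) * ?B * ?S"
    by (simp add: mult.assoc)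
  also have "\<dots> = ?a * ?b * (?A * ?B * ?S)" by (simp only: c1 mult.assoc)
  also have "\<dots> = (?a * ?b * ?S) * ?B * ?A" by (simp only: yb) (simp only: mult.assoc)
  also have "\<dots> = ?S * ?b * (?a * ?B) * ?A" by (simp only: IH) (simp only: mult.assoc)
  also have "\<dots> = ?S * col x (Suc m) b v * col x (Suc m) a u"
    by (simp only: c2) (simp only: mult.assoc col.simps)
  finally show ?case .
qed simp

text \<open>The new column is exchanged with each column inside \<open>fus x m\<close> by
  \<open>col_col\<close>. Every exchange sends one factor to the far left, so that in the end the
  new column stands on the left with its factors reversed.\<close>

lemma fus_col:
  assumes "inj_on x {1..m}" "u \<notin> x ` {1..m}" "m < N"
  shows "fus x m * col x m N u = rcol x m N u * fus x m"
  using assms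
proof (induction m arbitrary: N u)
  case (Suc m)
  let ?y = "x (Suc m)"
  let ?R = "rmat (Suc m) N ?y u"
  have inj: "inj_on x {1..m}" using Suc.prems(1) by (rule inj_on_subset) auto
  have ne: "x p \<noteq> ?y \<and> x p \<noteq> u" if "p \<in> {1..m}" for p
    using Suc.prems(1,2) that by (auto dest: inj_onD)
  have yu: "?y \<noteq> u" using Suc.prems by auto
  have "fus x (Suc m) * col x (Suc m) N u = fus x m * (col x m (Suc m) ?y * col x m N u * ?R)"
    by (simp add: mult.assoc)
  also have "\<dots> = fus x m * ?R * col x m N u * col x m (Suc m) ?y"
    using col_col[of m "Suc m" N ?y u x] Suc.prems ne yu by (simp add: mult.assoc)
  also have "\<dots> = ?R * (fus x m * col x m N u) * col x m (Suc m) ?y"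
    using rmat_commuteI[OF fus_tr_commute, of m "Suc m" N x ?y u] Suc.prems by (simp add: mult.assoc)
  also have "fus x m * col x m N u = rcol x m N u * fus x m"
    using Suc.IH[OF inj] Suc.prems by (auto simp: image_iff)
  finally show ?case by (simp add: mult.assoc)
qed simp

section \<open>The anti-involution inverting permutations\<close>

text \<open>Linear over the complex numbers: the coefficients are not conjugated.\<close>

definition star :: "galg \<Rightarrow> galg" where
  "star = Poly_Mapping.map_key uminus"

lemma lookup_star: "lookup (star a) g = lookup a (- g)"
  by (simp add: star_def map_key.rep_eq inj_on_def)

lemma star_diff: "star (a - b) = star a - star b"
  by (rule poly_mapping_eqI) (simp add: lookup_star lookup_minus)

lemma star_sum: "star (sum f A) = (\<Sum>i\<in>A. star (f i))"
  by (rule poly_mapping_eqI) (simp add: lookup_star lookup_sum)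

lemma star_single: "star (Poly_Mapping.single g c) = Poly_Mapping.single (- g) c"
  by (rule poly_mapping_eqI) (auto simp: lookup_star lookup_single when_def)

lemma galg_decomp: "a = (\<Sum>g\<in>Poly_Mapping.keys a. Poly_Mapping.single g (lookup a g))" for a :: galg
  by (rule poly_mapping_eqI) (auto simp: lookup_sum lookup_single when_def in_keys_iff)

lemma star_mult: "star (a * b) = star b * star a"
proof -
  have 1: "star (Poly_Mapping.single g c * b) = star b * star (Poly_Mapping.single g c)" for g c
    by (rule poly_mapping_eqI)
      (simp add: lookup_star star_single lookup_single_mult lookup_mult_single minus_add mult.commute)
  show ?thesis
    by (subst (1 2) galg_decomp[of a]) (simp only: sum_distrib_right sum_distrib_left star_sum 1)
qed

lemma star_scl [simp]: "star (scl c) = scl c"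
  by (simp add: scl_def star_single)

lemma star_1 [simp]: "star 1 = 1"
  using star_scl[of 1] by simp

lemma star_tr [simp]: "star (tr p q) = tr p q"
proof -
  have "- Perm (Transposition.transpose p q) = Perm (Transposition.transpose p q)"
    by (rule perm_eqI) (simp add: apply_uminus apply_Perm[OF transpose_permutes])
  then show ?thesis
    by (simp add: sg_def star_single)
qed

lemma star_rmat [simp]: "star (rmat p q u v) = rmat p q u v"
  by (simp add: rmat_def star_diff star_mult scl_move)

lemma star_col: "star (col x m N u) = rcol x m N u"
  by (induction m) (simp_all add: star_mult)

text \<open>\<open>star\<close> reverses the order of the factors, and \<open>fus_col\<close>
  restores it one column at a time.\<close>

lemma star_fus:
  assumes "inj_on x {1..m}"
  shows "star (fus x m) = fus x m"
  using assms
proof (induction m)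
  case (Suc m)
  have "inj_on x {1..m}" using Suc.prems by (rule inj_on_subset) auto
  moreover have "x (Suc m) \<notin> x ` {1..m}" using Suc.prems by (auto dest: inj_onD)
  ultimately show ?case
    using Suc.IH fus_col[of x m "x (Suc m)" "Suc m", symmetric] by (simp add: star_mult star_col)
qed simp

lemma fus_mono_factor: "k \<le> n \<Longrightarrow> \<exists>H. fus x n = fus x k * H"
proof (induction n rule: dec_induct)
  case base
  show ?case by (rule exI[of _ 1]) simp
next
  case (step n)
  then show ?case by (auto simp: mult.assoc)
qed

text \<open>The last factor moves to the left through the last two columns by
  \<open>col_col\<close>, and then past \<open>fus x m\<close>, whose indices are disjoint from its
  own.\<close>

lemma fus_Suc_Suc:
  assumes "inj_on x {1..Suc (Suc m)}"
  shows "fus x (Suc (Suc m)) = rmat (Suc m) (Suc (Suc m)) (x (Suc m)) (x (Suc (Suc m))) *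
    (fus x m * col x m (Suc (Suc m)) (x (Suc (Suc m))) * col x m (Suc m) (x (Suc m)))"
proof -
  let ?k = "Suc m" let ?l = "Suc ?k"
  have ne: "x p \<noteq> x q" if "p \<noteq> q" "p \<in> {1..?l}" "q \<in> {1..?l}" for p q
    using assms that by (auto dest: inj_onD)
  have "fus x ?l = fus x m * (col x m ?k (x ?k) * col x m ?l (x ?l) * rmat ?k ?l (x ?k) (x ?l))"
    by (simp add: mult.assoc)
  also have "col x m ?k (x ?k) * col x m ?l (x ?l) * rmat ?k ?l (x ?k) (x ?l)
    = rmat ?k ?l (x ?k) (x ?l) * col x m ?l (x ?l) * col x m ?k (x ?k)"
    by (intro col_col) (use ne in auto)
  finally show ?thesis
    using rmat_commuteI[OF fus_tr_commute, of m ?k ?l x "x ?k" "x ?l"]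
    by (simp del: fus.simps flip: mult.assoc)
qed

text \<open>When the parameters differ by 1 or -1, the factor at (k, k+1) is 1 - \<delta> (k k+1)
  and absorbs the transposition; \<open>fus_Suc_Suc\<close> allows splitting it off on the left. The
  right-hand version follows by \<open>star\<close>.\<close>

lemma fus_eigen:
  assumes "inj_on x {1..n}" "1 \<le> k" "k < n" "x k - x (Suc k) = \<delta>" "\<delta> * \<delta> = 1"
  shows "tr k (Suc k) * fus x n = scl (- \<delta>) * fus x n" "fus x n * tr k (Suc k) = scl (- \<delta>) * fus x n"
proof -
  obtain m where k: "k = Suc m" using assms(2) by (cases k) auto
  have inj: "inj_on x {1..Suc (Suc m)}" using assms(1,3) k by (auto intro: inj_on_subset)
  obtain H where "fus x n = fus x (Suc k) * H"
    using fus_mono_factor[of "Suc k" n x] assms(3) by auto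
  then obtain G where G: "fus x n = rmat k (Suc k) (x k) (x (Suc k)) * G"
    unfolding k fus_Suc_Suc[OF inj] by (metis mult.assoc)
  have "\<delta> \<noteq> 0" using assms(5) by auto
  then have d: "1 / \<delta> = \<delta>" using assms(5) by (simp add: divide_eq_eq)
  have "tr k (Suc k) * rmat k (Suc k) (x k) (x (Suc k)) = scl (- \<delta>) * rmat k (Suc k) (x k) (x (Suc k))"
    unfolding rmat_def assms(4) d using assms(5) by (simp add: right_diff_distrib scl_uminus scl_move_left)
  then show 1: "tr k (Suc k) * fus x n = scl (- \<delta>) * fus x n"
    by (simp only: G flip: mult.assoc)
  from arg_cong[OF this, of star] star_fus[OF assms(1)]
  show "fus x n * tr k (Suc k) = scl (- \<delta>) * fus x n"
    by (simp add: star_mult scl_move)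
qed

section \<open>Exchanging two neighbouring parameters\<close>

lemma col_cong: "(\<And>p. p \<in> {1..m} \<Longrightarrow> x p = y p) \<Longrightarrow> col x m N u = col y m N u"
  by (induction m) auto

lemma fus_cong: "(\<And>p. p \<in> {1..m} \<Longrightarrow> x p = y p) \<Longrightarrow> fus x m = fus y m"
  by (induction m) (auto intro!: arg_cong2[of _ _ _ _ "(*)"] col_cong)

lemma col_tr_conj:
  assumes "m < a" "m < b"
  shows "col x m a u * tr a b = tr a b * col x m b u"
  using assms
proof (induction m)
  case (Suc m)
  have "rmat (Suc m) a (x (Suc m)) u * tr a b = tr a b * rmat (Suc m) b (x (Suc m)) u"
    using Suc.prems by (subst rmat_tr_conj) (auto simp: transpose_def)
  then show ?case
    using Suc by (simp add: mult.assoc) (simp flip: mult.assoc)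
qed simp

lemma rmat_swap_conj: "tr k l * rmat k l u v * tr k l = rmat k l u v"
  by (simp add: mult.assoc rmat_tr_conj transpose_def rmat_sym)

text \<open>Conjugation by (k l) puts the parameters back at their indices but leaves the factors of
  k and l in the wrong order. The Yang-Baxter equation for k, l, r restores it, and all other
  factors commute with what is moved.\<close>

lemma col_swap:
  assumes "inj_on x {1..m}" "w \<notin> x ` {1..m}" "l = Suc k" "1 \<le> k" "l \<le> m" "m < r"
  defines "x' \<equiv> x \<circ> Transposition.transpose k l"
  shows "rmat k l (x l) (x k) * (tr k l * col x' m r w * tr k l) = col x m r w * rmat k l (x l) (x k)"
  using assms(5,1,2,6)
proof (induction m rule: dec_induct)
  case base
  let ?t = "tr k l" and ?S = "rmat k l (x l) (x k)"
  obtain j where k: "k = Suc j" using assms(4) by (cases k) auto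
  have ne: "x k \<noteq> x l" "x k \<noteq> w" "x l \<noteq> w"
    using base assms(3,4) by (auto dest!: inj_onD)
  have "col x' j r w = col x j r w"
    by (rule col_cong) (auto simp: x'_def k assms(3) transpose_def)
  then have c: "col x' l r w = col x j r w * rmat k r (x l) w * rmat l r (x k) w"
    unfolding assms(3) k by (simp add: x'_def k assms(3))
  have tc: "?t * col x j r w = col x j r w * ?t"
    using base assms(3) k by (intro col_tr_commute[symmetric]) auto
  have t1: "?t * rmat k r (x l) w = rmat l r (x l) w * ?t"
    using base assms(3) by (subst rmat_tr_conj) (auto simp: transpose_def)
  have t2: "?t * rmat l r (x k) w = rmat k r (x k) w * ?t"
    using base assms(3) by (subst rmat_tr_conj) (auto simp: transpose_def)
  have "?t * col x' l r w * ?t = (?t * col x j r w) * rmat k r (x l) w * rmat l r (x k) w * ?t"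
    by (simp only: c mult.assoc)
  also have "\<dots> = col x j r w * (?t * rmat k r (x l) w) * rmat l r (x k) w * ?t"
    by (simp only: tc mult.assoc)
  also have "\<dots> = col x j r w * rmat l r (x l) w * (?t * rmat l r (x k) w) * ?t"
    by (simp only: t1 mult.assoc)
  also have "\<dots> = col x j r w * rmat l r (x l) w * rmat k r (x k) w"
    by (simp only: t2 mult.assoc tr_sq mult.right_neutral)
  finally have "?S * (?t * col x' l r w * ?t) = (?S * col x j r w) * rmat l r (x l) w * rmat k r (x k) w"
    by (simp only: mult.assoc)
  also have "?S * col x j r w = col x j r w * ?S"
    using base assms(3) k by (intro rmat_commuteI[symmetric] col_tr_commute) auto
  also have "col x j r w * ?S * rmat l r (x l) w * rmat k r (x k) w
    = col x j r w * (rmat l k (x l) (x k) * rmat l r (x l) w * rmat k r (x k) w)"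
    by (simp only: mult.assoc rmat_sym)
  also have "rmat l k (x l) (x k) * rmat l r (x l) w * rmat k r (x k) w
    = rmat k r (x k) w * rmat l r (x l) w * rmat l k (x l) (x k)"
    using ne base assms(3) by (intro yang_baxter) auto
  finally show ?case
    unfolding assms(3) k by (simp only: mult.assoc col.simps rmat_sym)
next
  case (step m)
  let ?t = "tr k l" and ?S = "rmat k l (x l) (x k)" and ?B = "rmat (Suc m) r (x (Suc m)) w"
  have x': "x' (Suc m) = x (Suc m)"
    using step assms(3) by (auto simp: x'_def transpose_def)
  have B: "?B * ?t = ?t * ?B"
    using step assms(3) by (intro rmat_tr_commute) auto
  have IH: "?S * (?t * col x' m r w * ?t) = col x m r w * ?S"
    using step.IH inj_on_subset[OF step.prems(1), of "{1..m}"] step.prems(2,3) by (auto simp: image_iff)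
  have "?S * (?t * col x' (Suc m) r w * ?t) = ?S * ?t * col x' m r w * (?B * ?t)"
    by (simp only: x' mult.assoc col.simps)
  also have "\<dots> = (?S * (?t * col x' m r w * ?t)) * ?B"
    by (simp only: B mult.assoc)
  also have "\<dots> = col x m r w * (?S * ?B)"
    by (simp only: IH) (simp only: mult.assoc)
  also have "?S * ?B = ?B * ?S"
    using step assms(3) by (intro rmat_commute) auto
  finally show ?case by (simp only: mult.assoc col.simps)
qed

text \<open>Relates the products of two tableaux that differ by exchanging k and k + 1. After the
  columns k and l have been treated directly, every further column is handled by
  \<open>col_swap\<close>.\<close>

lemma fus_swap:
  assumes "inj_on x {1..n}" "l = Suc k" "1 \<le> k" "l \<le> n"
  defines "x' \<equiv> x \<circ> Transposition.transpose k l"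
  shows "rmat k l (x k) (x l) * (tr k l * fus x' n * tr k l) = fus x n * rmat k l (x l) (x k)"
  using assms(4,1)
proof (induction n rule: dec_induct)
  case base
  obtain m where k: "k = Suc m" using assms(3) by (cases k) auto
  let ?t = "tr k l"
  have f: "fus x l = rmat k l (x k) (x l) * (fus x m * col x m l (x l) * col x m k (x k))"
    using base fus_Suc_Suc[of x m] by (simp add: assms(2) k)
  have x': "x' k = x l" "x' l = x k" by (auto simp: x'_def)
  have c: "col x' m N u = col x m N u" "fus x' m = fus x m" for N u
    by (auto intro!: col_cong fus_cong simp: x'_def k assms(2) transpose_def)
  have f': "fus x' l = fus x m * col x m k (x l) * (col x m l (x k) * rmat k l (x l) (x k))"
    unfolding assms(2) k fus.simps(2)[of x' "Suc m"] 
    using x' c by (simp add: assms(2) k mult.assoc)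
  have t: "?t * fus x m = fus x m * ?t" "?t * col x m k (x l) = col x m l (x l) * ?t"
      "?t * col x m l (x k) = col x m k (x k) * ?t"
    using fus_tr_commute[of m k l x] col_tr_conj[of m k l x "x k"] col_tr_conj[of m l k x "x l"]
    by (simp_all add: k assms(2) tr_sym)
  have "?t * fus x' l * ?t = (?t * fus x m) * col x m k (x l) * col x m l (x k) * rmat k l (x l) (x k) * ?t"
    by (simp only: f' mult.assoc)
  also have "\<dots> = fus x m * (?t * col x m k (x l)) * col x m l (x k) * rmat k l (x l) (x k) * ?t"
    by (simp only: t(1) mult.assoc)
  also have "\<dots> = fus x m * col x m l (x l) * (?t * col x m l (x k)) * rmat k l (x l) (x k) * ?t"
    by (simp only: t(2) mult.assoc)
  also have "\<dots> = fus x m * col x m l (x l) * col x m k (x k) * (?t * rmat k l (x l) (x k) * ?t)"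
    by (simp only: t(3) mult.assoc)
  finally show ?case
    by (simp only: f mult.assoc rmat_swap_conj[unfolded mult.assoc])
next
  case (step n)
  let ?t = "tr k l" and ?S = "rmat k l (x k) (x l)" and ?r = "Suc n"
  have x': "x' ?r = x ?r"
    using step assms(2) by (auto simp: x'_def transpose_def)
  have IH: "?S * (?t * fus x' n * ?t) = fus x n * rmat k l (x l) (x k)"
    using step.IH inj_on_subset[OF step.prems(1), of "{1..n}"] by auto
  have cs: "rmat k l (x l) (x k) * (?t * col x' n ?r (x ?r) * ?t) = col x n ?r (x ?r) * rmat k l (x l) (x k)"
    unfolding x'_def using step assms(2,3)
    by (intro col_swap) (auto intro: inj_on_subset dest: inj_onD)
  have "?S * (?t * fus x' ?r * ?t) = ?S * (?t * fus x' n * (?t * ?t) * col x' n ?r (x ?r) * ?t)"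
    by (simp add: x' mult.assoc)
  also have "\<dots> = (?S * (?t * fus x' n * ?t)) * (?t * col x' n ?r (x ?r) * ?t)"
    by (simp only: mult.assoc)
  also have "\<dots> = fus x n * (rmat k l (x l) (x k) * (?t * col x' n ?r (x ?r) * ?t))"
    by (simp only: IH) (simp only: mult.assoc)
  finally show ?case by (simp only: cs) (simp only: mult.assoc fus.simps)
qed

text \<open>The column with every factor \<open>f\<^sub>p\<^sub>N\<close>, \<open>p \<in> S\<close>, merged with its successor into
  \<open>1 - ((p N) + (p+1 N)) / (x\<^sub>p\<^sub>+\<^sub>1 - u)\<close>. The factor at \<open>p\<close> itself becomes \<open>1\<close>.\<close>

fun bcol :: "(nat \<Rightarrow> complex) \<Rightarrow> nat set \<Rightarrow> nat \<Rightarrow> nat \<Rightarrow> complex \<Rightarrow> galg" where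
  "bcol x S 0 N u = 1"
| "bcol x S (Suc m) N u = bcol x S m N u *
    (if Suc m \<in> S then 1
     else if m \<in> S then 1 - scl (1 / (x (Suc m) - u)) * (tr m N + tr (Suc m) N)
     else rmat (Suc m) N (x (Suc m)) u)"

lemma bcol_tr_commute:
  assumes "m < a" "m < b" "N \<noteq> a" "N \<noteq> b" "0 \<notin> S"
  shows "bcol x S m N u * tr a b = tr a b * bcol x S m N u"
  using assms
proof (induction m)
  case (Suc m)
  have "m \<in> S \<Longrightarrow> tr m N * tr a b = tr a b * tr m N" "tr (Suc m) N * tr a b = tr a b * tr (Suc m) N"
    using Suc.prems by (intro tr_commute; force)+
  then have "m \<in> S \<Longrightarrow> (1 - scl c * (tr m N + tr (Suc m) N)) * tr a b =
      tr a b * (1 - scl c * (tr m N + tr (Suc m) N))" for c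
    by (simp add: galg_simps)
  then show ?case
    using Suc by (auto intro!: mult_commute_tr rmat_tr_commute)
qed simp

text \<open>Since (p N)(q N) = (p q)(p N), the quadratic term is absorbed by H into the term of (p
  N), whose coefficient a becomes a + a c \<delta> = c. This removes the pole at u = x p.\<close>

lemma merge_pair:
  assumes "H * tr p q = scl (- \<delta>) * H" "x p - x q = \<delta>" "\<delta> * \<delta> = 1"
    and "distinct [p, q, N]" "x p \<noteq> u" "x q \<noteq> u"
  shows "H * rmat p N (x p) u * rmat q N (x q) u = H * (1 - scl (1 / (x q - u)) * (tr p N + tr q N))"
proof -
  define a c where "a = 1 / (x p - u)" and "c = 1 / (x q - u)"
  define b where "b = x q - u"
  have b: "b \<noteq> 0" "b + \<delta> \<noteq> 0" "a = 1 / (b + \<delta>)" "c = 1 / b"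
    using assms(2,5,6) by (auto simp: a_def b_def c_def algebra_simps)
  have "1 / (b + \<delta>) + 1 / (b + \<delta>) * (1 / b) * \<delta> = 1 / (b + \<delta>) * ((b + \<delta>) / b)"
    using b by (simp add: add_divide_distrib distrib_left)
  then have c: "c = a + a * c * \<delta>"
    using b by simp
  have tt: "tr p N * tr q N = tr p q * tr p N"
    using assms(4) tr_conj[of p q p N] by (simp add: transpose_def tr_sym)
  have "H * (tr p N * tr q N) = scl (- \<delta>) * (H * tr p N)"
    using assms(1) unfolding tt by (simp flip: mult.assoc)
  then have "H * rmat p N (x p) u * rmat q N (x q) u
    = H - (scl a * (H * tr p N) + scl (a * c * \<delta>) * (H * tr p N)) - scl c * (H * tr q N)"
    by (simp add: rmat_def a_def[symmetric] c_def[symmetric] galg_simps scl_uminus)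
  also have "scl a * (H * tr p N) + scl (a * c * \<delta>) * (H * tr p N) = scl c * (H * tr p N)"
    using c by (metis scl_add distrib_right)
  finally show ?thesis
    by (simp add: c_def[symmetric] galg_simps)
qed

text \<open>The conditional factor accounts for an open pair: if m is in S, its factor is still
  waiting for the one of m + 1.\<close>

lemma col_merge:
  assumes S: "\<And>p. p \<in> S \<Longrightarrow> 1 \<le> p \<and> Suc p \<notin> S \<and> (\<exists>\<delta>. \<delta> * \<delta> = 1 \<and> x p - x (Suc p) = \<delta> \<and>
      G * tr p (Suc p) = scl (- \<delta>) * G)"
    and "m < N" "\<And>p. p \<in> {1..m} \<Longrightarrow> x p \<noteq> u"
  shows "G * col x m N u = G * bcol x S m N u * (if m \<in> S then rmat m N (x m) u else 1)"
  using assms(2,3)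
proof (induction m)
  case 0
  then show ?case using S by force
next
  case (Suc m)
  have IH: "G * col x m N u = G * bcol x S m N u * (if m \<in> S then rmat m N (x m) u else 1)"
    using Suc by simp
  show ?case
  proof (cases "m \<in> S")
    case True
    then obtain \<delta> where d: "\<delta> * \<delta> = 1" "x m - x (Suc m) = \<delta>" "G * tr m (Suc m) = scl (- \<delta>) * G"
      "1 \<le> m" "Suc m \<notin> S"
      using S by blast
    obtain j where m: "m = Suc j" using d(4) by (cases m) auto
    have b: "bcol x S m N u = bcol x S j N u" using True m by simp
    have "0 \<notin> S" using S by force
    then have "bcol x S m N u * tr m (Suc m) = tr m (Suc m) * bcol x S m N u"
      unfolding b using Suc.prems m by (intro bcol_tr_commute) auto
    then have "(G * bcol x S m N u) * tr m (Suc m) = scl (- \<delta>) * (G * bcol x S m N u)"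
      using d(3) by (metis mult.assoc)
    from merge_pair[OF this d(2,1), of N u] show ?thesis
      using True d Suc.prems IH by (simp flip: mult.assoc)
  next
    case False
    then show ?thesis
      using IH by (simp flip: mult.assoc)
  qed
qed

section \<open>Jucys-Murphy elements and columns\<close>

text \<open>For N = m + 1 this is the Jucys-Murphy element of N. The two indices are independent
  because inductions on m keep N arbitrary.\<close>

definition jm :: "nat \<Rightarrow> nat \<Rightarrow> galg" where
  "jm m N = (\<Sum>q\<in>{1..m}. tr q N)"

text \<open>Up to a scalar this is the inverse of \<open>col\<close>.\<close>

fun icol :: "(nat \<Rightarrow> complex) \<Rightarrow> nat \<Rightarrow> nat \<Rightarrow> complex \<Rightarrow> galg" where
  "icol x 0 N u = 1"
| "icol x (Suc m) N u = rmat (Suc m) N u (x (Suc m)) * icol x m N u"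

lemma icol_tr_conj:
  assumes "m < a" "m < b"
  shows "tr a b * icol x m b u = icol x m a u * tr a b"
  using assms
proof (induction m)
  case (Suc m)
  have "tr a b * rmat (Suc m) b u (x (Suc m)) = rmat (Suc m) a u (x (Suc m)) * tr a b"
    using Suc.prems by (subst rmat_tr_conj) (auto simp: transpose_def)
  then have "tr a b * icol x (Suc m) b u = rmat (Suc m) a u (x (Suc m)) * (tr a b * icol x m b u)"
    by (simp flip: mult.assoc)
  then show ?case
    using Suc by (simp add: mult.assoc)
qed simp

lemma icol_col:
  assumes "\<And>p. p \<in> {1..m} \<Longrightarrow> x p \<noteq> u"
  shows "icol x m N u * col x m N u = scl (\<Prod>p\<in>{1..m}. 1 - 1 / (u - x p)^2)"
  using assms
proof (induction m)
  case (Suc m)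
  let ?c = "\<Prod>p\<in>{1..m}. 1 - 1 / (u - x p)^2"
  have "icol x (Suc m) N u * col x (Suc m) N u
    = rmat (Suc m) N u (x (Suc m)) * (icol x m N u * col x m N u) * rmat (Suc m) N (x (Suc m)) u"
    by (simp only: mult.assoc icol.simps col.simps)
  also have "icol x m N u * col x m N u = scl ?c"
    using Suc by simp
  also have "rmat (Suc m) N u (x (Suc m)) * scl ?c * rmat (Suc m) N (x (Suc m)) u
    = scl ?c * (rmat (Suc m) N u (x (Suc m)) * rmat (Suc m) N (x (Suc m)) u)"
    by (simp only: scl_central mult.assoc)
  finally show ?case
    using Suc.prems[of "Suc m"] by (simp add: rmat_inverse mult.commute)
qed simp

text \<open>Moving (m+1 N) through the partial product for N turns it into the one for m + 1, where
  the induction hypothesis and the eigenvalue equation at m + 1 evaluate it on G. The coefficient of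
  the transposition then becomes 1/u.\<close>

lemma jucys_icol:
  assumes "\<And>p. p \<in> {1..m} \<Longrightarrow> G * jm (p - 1) p = scl (c p) * G"
    and "u \<noteq> 0" "\<And>p. p \<in> {1..m} \<Longrightarrow> c p \<noteq> u" "m < N"
  shows "G * icol c m N u = G * (1 - scl (1 / u) * jm m N)"
  using assms(1,3,4)
proof (induction m arbitrary: N)
  case 0
  then show ?case by (simp add: jm_def)
next
  case (Suc m)
  let ?t = "tr (Suc m) N" and ?\<gamma> = "1 / (u - c (Suc m))"
  have IH: "G * icol c m N' u = G - scl (1 / u) * (G * jm m N')" if "m < N'" for N'
    using Suc that by (simp add: galg_simps)
  have w: "G * jm m (Suc m) = scl (c (Suc m)) * G"
    using Suc.prems(1)[of "Suc m"] by simp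
  have "?t * icol c m N u = icol c m (Suc m) u * ?t"
    using Suc.prems by (intro icol_tr_conj) auto
  then have "G * icol c (Suc m) N u = G * icol c m N u - scl ?\<gamma> * (G * icol c m (Suc m) u) * ?t"
    by (simp add: rmat_def galg_simps)
  also have "scl ?\<gamma> * (G * icol c m (Suc m) u) * ?t = scl (?\<gamma> * (1 - c (Suc m) / u)) * (G * ?t)"
    by (simp add: IH w right_diff_distrib left_diff_distrib mult.assoc scl_diff)
  also have "?\<gamma> * (1 - c (Suc m) / u) = 1 / u"
  proof -
    have "1 - c (Suc m) / u = (u - c (Suc m)) / u" using assms(2) by (simp add: diff_divide_distrib)
    then show ?thesis using Suc.prems(2)[of "Suc m"] by simp
  qed
  finally show ?case
    using Suc.prems by (simp add: IH jm_def galg_simps)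
qed

text \<open>Multiplying \<open>jucys_icol\<close> by the column cancels the inverse column by
  \<open>icol_col\<close>. The scalar on the right is the one that has to vanish at the content of
  the new box.\<close>

lemma jucys_col:
  assumes "\<And>p. p \<in> {1..m} \<Longrightarrow> G * jm (p - 1) p = scl (c p) * G"
    and "u \<noteq> 0" "\<And>p. p \<in> {1..m} \<Longrightarrow> c p \<noteq> u" "m < N" "G * jm m N = jm m N * G"
  shows "(scl u - jm m N) * G * col c m N u = scl (u * (\<Prod>p\<in>{1..m}. 1 - 1 / (u - c p)^2)) * G"
proof -
  have "G * icol c m N u = scl (1 / u) * ((scl u - jm m N) * G)"
    using jucys_icol[of m G c u N] assms
    by (simp add: right_diff_distrib left_diff_distrib scl_move_left mult.assoc)
  then have "scl u * (G * icol c m N u) * col c m N u = (scl u - jm m N) * G * col c m N u"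
    using assms(2) by simp
  moreover have "scl u * (G * icol c m N u) * col c m N u
    = scl (u * (\<Prod>p\<in>{1..m}. 1 - 1 / (u - c p)^2)) * G"
    using icol_col[of m c u N] assms(3) by (simp add: mult.assoc scl_move)
  ultimately show ?thesis by simp
qed

lemma jm_tr_commute:
  assumes "a \<in> {1..m}" "b \<in> {1..m}" "m < N"
  shows "jm m N * tr a b = tr a b * jm m N"
proof -
  have p: "Transposition.transpose a b permutes {1..m}"
    using assms by (intro permutes_swap_id) auto
  have "jm m N * tr a b = (\<Sum>q\<in>{1..m}. tr a b * tr (Transposition.transpose a b q) N)"
    unfolding jm_def sum_distrib_right
    using assms by (intro sum.cong refl, subst tr_conj) (auto simp: transpose_def)
  also have "\<dots> = tr a b * (\<Sum>q\<in>{1..m}. tr q N)"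
    unfolding sum_distrib_left
    using sum.permute[OF p, of "\<lambda>q. tr a b * tr q N"] by (simp add: o_def)
  finally show ?thesis by (simp add: jm_def)
qed

lemma jm_col_commute:
  assumes "k < M" "M \<le> m" "m < N"
  shows "jm m N * col x k M u = col x k M u * jm m N"
  using assms(1)
proof (induction k)
  case (Suc k)
  have "jm m N * rmat (Suc k) M v w = rmat (Suc k) M v w * jm m N" for v w
    using assms Suc by (intro rmat_commuteI jm_tr_commute) auto
  then show ?case
    using Suc by (simp flip: mult.assoc) (simp add: mult.assoc)
qed simp

lemma jm_fus_commute:
  assumes "k \<le> m" "m < N"
  shows "jm m N * fus x k = fus x k * jm m N"
  using assms(1)
proof (induction k)
  case (Suc k)
  then show ?case
    using assms jm_col_commute[of k "Suc k" m N x] by (simp flip: mult.assoc) (simp add: mult.assoc)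
qed simp

section \<open>Support and coefficient at the identity\<close>

lemma keys_tr: "Poly_Mapping.keys (tr p q) = {Perm (Transposition.transpose p q)}"
  by (simp add: sg_def)

lemma keys_scl_mult: "Poly_Mapping.keys (scl c * a) \<subseteq> Poly_Mapping.keys a"
  by (auto simp: in_keys_iff)

lemma keys_mult_rmat:
  "Poly_Mapping.keys (a * rmat p q u v) \<subseteq> Poly_Mapping.keys a \<union>
     (\<lambda>g. g + Perm (Transposition.transpose p q)) ` Poly_Mapping.keys a"
proof -
  have "Poly_Mapping.keys (a * rmat p q u v) \<subseteq> Poly_Mapping.keys a \<union> Poly_Mapping.keys (a * tr p q)"
    by (auto simp: rmat_def galg_simps in_keys_iff lookup_minus)
  moreover have "Poly_Mapping.keys (a * tr p q) \<subseteq> (\<lambda>g. g + Perm (Transposition.transpose p q)) ` Poly_Mapping.keys a"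
    using keys_mult[of a "tr p q"] by (auto simp: keys_tr)
  ultimately show ?thesis by blast
qed

lemma apply_plus_transpose:
  "Perm.apply (g + Perm (Transposition.transpose p q)) j = Perm.apply g (Transposition.transpose p q j)"
  by (simp add: apply_plus apply_Perm[OF transpose_permutes])

text \<open>A product (p1 N)(p2 N)...(pr N) with p1 < p2 < ... < pr sends N to pr, so every term
  other than the empty one moves N.\<close>

lemma keys_col:
  assumes "m < N"
  shows "g \<in> Poly_Mapping.keys (col x m N u - 1) \<Longrightarrow>
    Perm.apply g N \<in> {1..m} \<and> (\<forall>j. j \<notin> insert N {1..m} \<longrightarrow> Perm.apply g j = j)"
  using assms
proof (induction m arbitrary: g)
  case (Suc m)
  let ?R = "rmat (Suc m) N (x (Suc m)) u" and ?t = "Perm (Transposition.transpose (Suc m) N)"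
  have "col x (Suc m) N u - 1 = (col x m N u - 1) * ?R - scl (1 / (x (Suc m) - u)) * tr (Suc m) N"
    by (simp add: algebra_simps) (simp add: rmat_def)
  then have "g \<in> Poly_Mapping.keys ((col x m N u - 1) * ?R) \<union> {?t}"
    using Suc.prems(1) keys_scl_mult[of "1 / (x (Suc m) - u)" "tr (Suc m) N"]
    by (auto simp: in_keys_iff lookup_minus keys_tr subset_iff)
  then consider "g = ?t" | "g \<in> Poly_Mapping.keys (col x m N u - 1)"
    | h where "h \<in> Poly_Mapping.keys (col x m N u - 1)" "g = h + ?t"
    using keys_mult_rmat[of "col x m N u - 1"] by blast
  then show ?case
  proof cases
    case 1
    then show ?thesis by (simp add: apply_Perm[OF transpose_permutes] transpose_def)
  next
    case 2
    from Suc.IH[OF this] Suc.prems(2) show ?thesis by auto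
  next
    case 3
    from Suc.IH[OF this(1)] Suc.prems(2) show ?thesis
      unfolding 3(2) apply_plus_transpose by (auto simp: transpose_def)
  qed
qed simp

lemma keys_fus:
  "g \<in> Poly_Mapping.keys (fus x m) \<Longrightarrow> j \<notin> {1..m} \<Longrightarrow> Perm.apply g j = j"
proof (induction m arbitrary: g j)
  case 0
  then show ?case by (simp add: apply_zero)
next
  case (Suc m)
  let ?b = "col x m (Suc m) (x (Suc m))"
  from Suc.prems(1) keys_mult[of "fus x m" ?b] obtain h k where
    gh: "g = h + k" "h \<in> Poly_Mapping.keys (fus x m)" "k \<in> Poly_Mapping.keys ?b"
    by auto
  have "k = 0 \<or> k \<in> Poly_Mapping.keys (?b - 1)"
    using gh(3) by (auto simp: in_keys_iff lookup_minus lookup_one when_def)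
  then have "Perm.apply k j = j"
    using keys_col[of m "Suc m" k] Suc.prems(2) by (auto simp: apply_zero)
  then show ?case
    using gh(1) Suc.IH[OF gh(2), of j] Suc.prems(2) by (auto simp: apply_plus)
qed

text \<open>The terms of \<open>fus x m\<close> fix m + 1 and all terms of the next column except 1
  move it, so the identity arises only from choosing 1 in every factor.\<close>

lemma lookup_fus_0: "lookup (fus x m) 0 = 1"
proof (induction m)
  case (Suc m)
  let ?b = "col x m (Suc m) (x (Suc m))"
  have "0 \<notin> Poly_Mapping.keys (fus x m * (?b - 1))"
  proof
    assume "0 \<in> Poly_Mapping.keys (fus x m * (?b - 1))"
    with keys_mult[of "fus x m" "?b - 1"] obtain h k where
      hk: "0 = h + k" "h \<in> Poly_Mapping.keys (fus x m)" "k \<in> Poly_Mapping.keys (?b - 1)"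
      by auto
    have "Perm.apply h (Perm.apply k (Suc m)) = Suc m"
      using hk(1) apply_plus[of h k] by (metis apply_zero comp_apply id_apply)
    moreover have "Perm.apply h (Suc m) = Suc m"
      using keys_fus[OF hk(2)] by simp
    ultimately have "Perm.apply k (Suc m) = Suc m"
      by (metis apply_inj)
    then show False using keys_col[OF _ hk(3)] by simp
  qed
  moreover have "fus x (Suc m) = fus x m + fus x m * (?b - 1)"
    by (simp add: algebra_simps)
  ultimately show ?case
    using Suc by (simp add: lookup_add in_keys_iff)
qed (simp add: lookup_one)

section \<open>Standard tableaux as growth sequences of boxes\<close>

text \<open>b p is the box of p in a standard tableau; the last clause says that the first p boxes
  always form a Young diagram. No shape is mentioned, so that sequences can be shortened and
  rearranged.\<close>

definition growth :: "(nat \<Rightarrow> nat \<times> nat) \<Rightarrow> nat \<Rightarrow> bool" where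
  "growth b n \<longleftrightarrow> inj_on b {1..n} \<and> (\<forall>p\<in>{1..n}. 1 \<le> fst (b p) \<and> 1 \<le> snd (b p)) \<and>
     (\<forall>p\<in>{1..n}. \<forall>i j. 1 \<le> i \<and> i \<le> fst (b p) \<and> 1 \<le> j \<and> j \<le> snd (b p) \<longrightarrow> (\<exists>q\<in>{1..p}. b q = (i, j)))"

definition ct :: "(nat \<Rightarrow> nat \<times> nat) \<Rightarrow> nat \<Rightarrow> int" where
  "ct b p = int (snd (b p)) - int (fst (b p))"

text \<open>The index of the principal hook through the box, whose corner is the diagonal box with
  both coordinates equal to this number.\<close>

definition hook :: "nat \<times> nat \<Rightarrow> nat" where
  "hook \<beta> = min (fst \<beta>) (snd \<beta>)"

abbreviation adj :: "nat \<Rightarrow> nat \<Rightarrow> nat" where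
  "adj k \<equiv> Transposition.transpose k (Suc k)"

lemma growthD:
  assumes "growth b n" "p \<in> {1..n}" "1 \<le> i" "i \<le> fst (b p)" "1 \<le> j" "j \<le> snd (b p)"
  shows "\<exists>q\<in>{1..p}. b q = (i, j)"
  using assms unfolding growth_def by blast

lemma growth_pos: "growth b n \<Longrightarrow> p \<in> {1..n} \<Longrightarrow> 1 \<le> fst (b p) \<and> 1 \<le> snd (b p)"
  unfolding growth_def by blast

lemma growth_inj: "growth b n \<Longrightarrow> b p = b q \<Longrightarrow> p \<in> {1..n} \<Longrightarrow> q \<in> {1..n} \<Longrightarrow> p = q"
  unfolding growth_def by (meson inj_onD)

lemma growth_le:
  assumes "growth b n" "p \<in> {1..n}" "q \<in> {1..n}" "fst (b p) \<le> fst (b q)" "snd (b p) \<le> snd (b q)"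
  shows "p \<le> q"
proof -
  obtain r where "r \<in> {1..q}" "b r = b p"
    using growthD[OF assms(1,3), of "fst (b p)" "snd (b p)"] growth_pos[OF assms(1,2)] assms(4,5) by auto
  then show ?thesis using growth_inj[OF assms(1), of r p] assms(2,3) by auto
qed

lemma adj_permutes: "1 \<le> k \<Longrightarrow> k < n \<Longrightarrow> adj k permutes {1..n}"
  by (intro permutes_swap_id) auto

lemma growth_adj:
  assumes "growth b n" "1 \<le> k" "k < n" "\<not> (fst (b k) \<le> fst (b (Suc k)) \<and> snd (b k) \<le> snd (b (Suc k)))"
  shows "growth (b \<circ> adj k) n"
  unfolding growth_def
proof (intro conjI ballI allI impI)
  have p: "adj k permutes {1..n}" using assms(2,3) by (rule adj_permutes)
  show "inj_on (b \<circ> adj k) {1..n}"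
    using assms(1) permutes_image[OF p] permutes_inj_on[OF p] unfolding growth_def by (simp add: comp_inj_on)
  fix q assume q: "q \<in> {1..n}"
  then have aq: "adj k q \<in> {1..n}" using permutes_in_image[OF p] by blast
  show "1 \<le> fst ((b \<circ> adj k) q)" "1 \<le> snd ((b \<circ> adj k) q)"
    using growth_pos[OF assms(1) aq] by auto
  fix i j assume ij: "1 \<le> i \<and> i \<le> fst ((b \<circ> adj k) q) \<and> 1 \<le> j \<and> j \<le> snd ((b \<circ> adj k) q)"
  then obtain r where r: "r \<in> {1..adj k q}" "b r = (i, j)"
    using growthD[OF assms(1) aq, of i j] by auto
  \<comment> \<open>The position could exceed q only for q = r = k; then the box of k would lie
    weakly northwest of the box of k + 1, which is excluded.\<close>
  have "adj k r \<in> {1..q}"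
  proof (cases "q = k \<and> r = k")
    case True
    then show ?thesis using ij r assms(4) by auto
  next
    case False
    then show ?thesis using r(1) assms(2) by (auto simp: transpose_def split: if_splits)
  qed
  then show "\<exists>q'\<in>{1..q}. (b \<circ> adj k) q' = (i, j)"
    using r(2) by (intro bexI[of _ "adj k r"]) auto
qed

text \<open>Every box of the rectangle spanned by the two boxes carries k or k + 1, so the rectangle
  consists of two neighbouring boxes.\<close>

lemma growth_le_Suc:
  assumes "growth b n" "1 \<le> k" "k < n" "fst (b k) \<le> fst (b (Suc k))" "snd (b k) \<le> snd (b (Suc k))"
  shows "\<bar>ct b (Suc k) - ct b k\<bar> = 1"
proof -
  obtain i j where k: "b k = (i, j)" by (cases "b k")
  obtain i' j' where s: "b (Suc k) = (i', j')" by (cases "b (Suc k)")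
  have le: "i \<le> i'" "j \<le> j'" using assms k s by auto
  have pos: "1 \<le> i" "1 \<le> j" using growth_pos[OF assms(1), of k] assms k by auto
  have *: "(x, y) = (i, j) \<or> (x, y) = (i', j')" if xy: "i \<le> x" "x \<le> i'" "j \<le> y" "y \<le> j'" for x y
  proof -
    have "1 \<le> x" "1 \<le> y" using xy pos by linarith+
    then obtain q where q: "q \<in> {1..Suc k}" "b q = (x, y)"
      using growthD[OF assms(1), of "Suc k" x y] assms(3) s xy by auto
    have "k \<le> q"
      using growth_le[OF assms(1), of k q] q k xy assms(2,3) by auto
    then have "q = k \<or> q = Suc k" using q(1) by auto
    then show ?thesis using q(2) k s by auto
  qed
  have ne: "(i, j) \<noteq> (i', j')" using growth_inj[OF assms(1), of k "Suc k"] k s assms(2,3) by auto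
  show ?thesis
  proof (cases "i = i'")
    case True
    then have "j < j'" using ne le by auto
    then show ?thesis using *[of i "Suc j"] True by (auto simp: ct_def k s)
  next
    case False
    then have "i < i'" using le by auto
    then have "i' = Suc i" "j = j'" using *[of "Suc i" j] le by auto
    then show ?thesis by (auto simp: ct_def k s)
  qed
qed

lemma growth_adj_or:
  assumes "growth b n" "1 \<le> k" "k < n"
  shows "growth (b \<circ> adj k) n \<or> \<bar>ct b (Suc k) - ct b k\<bar> = 1"
  using growth_adj[OF assms] growth_le_Suc[OF assms] by blast

lemma ct_comp: "ct (b \<circ> s) p = ct b (s p)"
  by (simp add: ct_def)

text \<open>Neither box lies weakly northwest of the other, so one is strictly northeast of the
  other and both coordinates contribute to the difference of the contents.\<close>

lemma growth_adj_far:
  assumes "growth b n" "growth (b \<circ> adj k) n" "1 \<le> k" "k < n"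
  shows "\<bar>ct b (Suc k) - ct b k\<bar> \<ge> 2"
proof -
  let ?c = "b \<circ> adj k"
  have k: "k \<in> {1..n}" "Suc k \<in> {1..n}" using assms(3,4) by auto
  have 1: "\<not> (fst (b (Suc k)) \<le> fst (b k) \<and> snd (b (Suc k)) \<le> snd (b k))"
    using growth_le[OF assms(1) k(2,1)] by auto
  have 2: "\<not> (fst (b k) \<le> fst (b (Suc k)) \<and> snd (b k) \<le> snd (b (Suc k)))"
    using growth_le[OF assms(2) k(2,1)] by auto
  show ?thesis using 1 2 unfolding ct_def de_Morgan_conj not_le by (elim disjE) linarith+
qed

text \<open>A descent can always be undone: b lists \<sigma> (k+1) before \<sigma> k, so the box of
  \<sigma> k is not weakly northwest of that of \<sigma> (k+1).\<close>

lemma growth_descent: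
  assumes "growth b n" "\<sigma> permutes {1..n}" "growth (b \<circ> \<sigma>) n" "1 \<le> k" "k < n" "\<sigma> (Suc k) < \<sigma> k"
  shows "growth (b \<circ> (\<sigma> \<circ> adj k)) n"
proof -
  have "\<sigma> k \<in> {1..n}" "\<sigma> (Suc k) \<in> {1..n}"
    using permutes_in_image[OF assms(2)] assms(4,5) by auto
  then have "\<not> (fst (b (\<sigma> k)) \<le> fst (b (\<sigma> (Suc k))) \<and> snd (b (\<sigma> k)) \<le> snd (b (\<sigma> (Suc k))))"
    using growth_le[OF assms(1), of "\<sigma> k" "\<sigma> (Suc k)"] assms(6) by auto
  then show ?thesis
    using growth_adj[OF assms(3-5)] by (simp add: o_assoc)
qed

section \<open>Sorting by adjacent exchanges\<close>

lemma descent_exists: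
  assumes "\<sigma> permutes {1..n}" "\<sigma> \<noteq> id"
  shows "\<exists>k. 1 \<le> k \<and> k < n \<and> \<sigma> (Suc k) < \<sigma> k"
proof (rule ccontr)
  assume "\<not> ?thesis"
  then have no: "\<not> \<sigma> (Suc k) < \<sigma> k" if "1 \<le> k" "k < n" for k
    using that by blast
  have up: "\<sigma> k < \<sigma> (Suc k)" if "1 \<le> k" "k < n" for k
  proof -
    have "\<sigma> k \<noteq> \<sigma> (Suc k)" using injD[OF permutes_inj[OF assms(1)], of k "Suc k"] by auto
    then show ?thesis using no[OF that] by linarith
  qed
  have "p \<le> n \<longrightarrow> p \<le> \<sigma> p" if "1 \<le> p" for p
    using that
  proof (induction p rule: dec_induct)
    case base
    then show ?case using permutes_in_image[OF assms(1), of 1] by auto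
  next
    case (step p)
    then show ?case using up[of p] by auto
  qed
  then have "\<sigma> = id" by (intro permutes_natset_ge[OF assms(1)]) auto
  then show False using assms(2) by simp
qed

text \<open>Termination measure for sorting: removing a descent at k lowers it by \<sigma> k -
  \<sigma> (k+1).\<close>

definition disorder :: "nat \<Rightarrow> (nat \<Rightarrow> nat) \<Rightarrow> nat" where
  "disorder n \<sigma> = (\<Sum>p\<in>{1..n}. (n - p) * \<sigma> p)"

lemma disorder_adj:
  assumes "1 \<le> k" "k < n"
  shows "disorder n (\<sigma> \<circ> adj k) + \<sigma> k = disorder n \<sigma> + \<sigma> (Suc k)"
proof -
  have s: "{1..n} = insert k (insert (Suc k) ({1..n} - {k, Suc k}))" using assms by auto
  have "(\<Sum>p\<in>{1..n} - {k, Suc k}. (n - p) * (\<sigma> \<circ> adj k) p) = (\<Sum>p\<in>{1..n} - {k, Suc k}. (n - p) * \<sigma> p)"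
    by (intro sum.cong) (auto simp: transpose_def)
  moreover have "n - k = Suc (n - Suc k)" using assms by simp
  ultimately show ?thesis
    unfolding disorder_def by (subst (1 2) s) simp
qed

lemma disorder_descent:
  assumes "1 \<le> k" "k < n" "\<sigma> (Suc k) < \<sigma> k"
  shows "disorder n (\<sigma> \<circ> adj k) < disorder n \<sigma>"
  using disorder_adj[OF assms(1,2), of \<sigma>] assms(3) by linarith

text \<open>Suppose the sequences agree before p and have boxes of equal content at p. If these
  differ, one is strictly northwest of the other, hence occurs earlier in the other sequence, and so
  also earlier in its own, against injectivity.\<close>

lemma growth_content_unique:
  assumes "growth b n" "growth b' n" "\<And>p. p \<in> {1..n} \<Longrightarrow> ct b p = ct b' p"
  shows "p \<in> {1..n} \<Longrightarrow> b p = b' p"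
proof (induction p rule: less_induct)
  case (less p)
  have *: False if g: "growth c n" "growth c' n" and e: "\<And>q. q < p \<Longrightarrow> q \<in> {1..n} \<Longrightarrow> c q = c' q"
    and lt: "fst (c p) < fst (c' p)" "snd (c p) < snd (c' p)" for c c'
  proof -
    obtain q where q: "q \<in> {1..p}" "c' q = c p"
      using growthD[OF g(2) less.prems, of "fst (c p)" "snd (c p)"] growth_pos[OF g(1) less.prems] lt by auto
    have "q \<noteq> p" using q(2) lt(1) by auto
    then have "q < p" using q(1) by auto
    then have "c q = c p" using e q less.prems by auto
    then show False using growth_inj[OF g(1), of q p] less.prems q(1) \<open>q < p\<close> by auto
  qed
  have e: "b q = b' q" if "q < p" "q \<in> {1..n}" for q using less.IH that by blast
  have "ct b p = ct b' p" using assms(3) less.prems by blast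
  moreover have "\<not> (fst (b p) < fst (b' p) \<and> snd (b p) < snd (b' p))"
    using *[OF assms(1,2) e] by blast
  moreover have "\<not> (fst (b' p) < fst (b p) \<and> snd (b' p) < snd (b p))"
    using *[OF assms(2,1) e[symmetric]] by blast
  ultimately show ?case unfolding ct_def by (intro prod_eqI; linarith)
qed

section \<open>The enumeration by principal hooks\<close>

lemma enumerate_by_key:
  fixes \<kappa> :: "nat \<Rightarrow> nat"
  assumes "inj_on \<kappa> {1..n}"
  shows "\<exists>\<sigma>. \<sigma> permutes {1..n} \<and> (\<forall>p\<in>{1..n}. \<forall>q\<in>{1..n}. p < q \<longrightarrow> \<kappa> (\<sigma> p) < \<kappa> (\<sigma> q))"
proof -
  obtain h where h: "bij_betw h {..<card (\<kappa> ` {1..n})} (\<kappa> ` {1..n})" "strict_mono_on {..<card (\<kappa> ` {1..n})} h"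
    using ex_bij_betw_strict_mono_card[of "\<kappa> ` {1..n}"] by blast
  have c: "card (\<kappa> ` {1..n}) = n" using card_image[OF assms] by simp
  \<comment> \<open>h counts from 0 and positions count from 1.\<close>
  define \<sigma> where "\<sigma> p = (if p \<in> {1..n} then inv_into {1..n} \<kappa> (h (p - 1)) else p)" for p
  have hm: "h (p - 1) \<in> \<kappa> ` {1..n}" if "p \<in> {1..n}" for p
  proof (rule bij_betw_apply[OF h(1)])
    show "p - 1 \<in> {..<card (\<kappa> ` {1..n})}" unfolding c using that by auto
  qed
  have k: "\<kappa> (\<sigma> p) = h (p - 1)" if "p \<in> {1..n}" for p
    unfolding \<sigma>_def using f_inv_into_f[OF hm[OF that]] that by simp
  have mono: "\<kappa> (\<sigma> p) < \<kappa> (\<sigma> q)" if "p \<in> {1..n}" "q \<in> {1..n}" "p < q" for p q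
    unfolding k[OF that(1)] k[OF that(2)]
    by (rule strict_mono_onD[OF h(2)[unfolded c]]) (use that in auto)
  have into: "\<sigma> ` {1..n} \<subseteq> {1..n}"
  proof (rule image_subsetI)
    fix p assume p: "p \<in> {1..n}"
    show "\<sigma> p \<in> {1..n}" unfolding \<sigma>_def using inv_into_into[OF hm[OF p]] p by simp
  qed
  have inj: "inj_on \<sigma> {1..n}"
  proof (rule inj_onI)
    fix p q assume pq: "p \<in> {1..n}" "q \<in> {1..n}" "\<sigma> p = \<sigma> q"
    then show "p = q" using mono[of p q] mono[of q p] by (cases p q rule: linorder_cases) auto
  qed
  have "\<sigma> permutes {1..n}"
  proof (rule bij_imp_permutes)
    show "bij_betw \<sigma> {1..n} {1..n}"
      using endo_inj_surj[OF _ into inj] inj by (simp add: bij_betw_def)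
    show "\<sigma> p = p" if "p \<notin> {1..n}" for p unfolding \<sigma>_def using that by auto
  qed
  then show ?thesis using mono by blast
qed

text \<open>Enumerating the boxes by increasing key lists the principal hooks one after another, each
  as its corner, then its leg, then its arm.\<close>

definition hook_key :: "nat \<Rightarrow> nat \<times> nat \<Rightarrow> nat" where
  "hook_key M \<beta> = (case \<beta> of (i, j) \<Rightarrow>
     min i j * (2 * M) + (if j < i then i - j else if i < j then M + (j - i) else 0))"

text \<open>The summand after the multiple of 2 M is below 2 M, so the hook index dominates; on one
  hook the key increases along the leg and along the arm. Hence ordering by key yields a growth
  sequence.\<close>

lemma hook_key_less:
  assumes "i' \<le> i" "j' \<le> j" "(i', j') \<noteq> (i, j)" "i < M" "j < M"
  shows "hook_key M (i', j') < hook_key M (i, j)"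
proof (cases "min i' j' < min i j")
  case True
  have "hook_key M (i', j') < (min i' j' + 1) * (2 * M)"
    using assms by (auto simp: hook_key_def)
  also have "\<dots> \<le> min i j * (2 * M)" using True by (intro mult_le_mono1) simp
  also have "\<dots> \<le> hook_key M (i, j)" by (simp add: hook_key_def)
  finally show ?thesis .
next
  case False
  then have "min i' j' = min i j" using assms(1,2) by (simp add: min_def split: if_splits)
  then show ?thesis using assms by (auto simp: hook_key_def min_def split: if_splits)
qed

lemma hook_key_inj:
  assumes "hook_key M (i', j') = hook_key M (i, j)" "i < M" "j < M" "i' < M" "j' < M"
  shows "(i', j') = (i, j)"
proof -
  define r where "r i j = (if j < i then i - j else if i < j then M + (j - i) else 0)" for i j :: nat
  have r: "r i j < 2 * M" if "i < M" "j < M" for i j using that by (auto simp: r_def)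
  have k: "hook_key M (i, j) = min i j * (2 * M) + r i j" for i j
    by (simp add: hook_key_def r_def)
  have d: "(a * (2 * M) + c) div (2 * M) = a" "(a * (2 * M) + c) mod (2 * M) = c"
    if "c < 2 * M" for a c
    using that by (simp_all add: div_add1_eq mod_add_eq)
  have e: "min i' j' * (2 * M) + r i' j' = min i j * (2 * M) + r i j"
    using assms(1) unfolding k .
  have "min i' j' = min i j" "r i' j' = r i j"
    using arg_cong[OF e, of "\<lambda>x. x div (2 * M)"] arg_cong[OF e, of "\<lambda>x. x mod (2 * M)"]
    by (simp_all only: d r assms(2-))
  then show ?thesis using assms(2-) by (auto simp: r_def min_def split: if_splits)
qed

text \<open>If p < N have equal contents, the box of N is strictly southeast of that of p. Then the
  next box on the hook of p is also among the first N boxes, its key is one larger, and so it must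
  be the box of p + 1.\<close>

lemma hook_order:
  assumes "growth b n"
  shows "\<exists>\<sigma>. \<sigma> permutes {1..n} \<and> growth (b \<circ> \<sigma>) n \<and>
    (\<forall>p N. 1 \<le> p \<and> p < N \<and> N \<le> n \<and> ct (b \<circ> \<sigma>) p = ct (b \<circ> \<sigma>) N \<longrightarrow>
       Suc p < N \<and> \<bar>ct (b \<circ> \<sigma>) (Suc p) - ct (b \<circ> \<sigma>) p\<bar> = 1 \<and>
       hook ((b \<circ> \<sigma>) (Suc p)) = hook ((b \<circ> \<sigma>) p))"
proof -
  define M where "M = Suc (\<Sum>p\<in>{1..n}. fst (b p) + snd (b p))"
  have M: "fst (b p) < M" "snd (b p) < M" if "p \<in> {1..n}" for p
    using member_le_sum[of p "{1..n}" "\<lambda>p. fst (b p) + snd (b p)"] that by (auto simp: M_def)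
  have "inj_on (\<lambda>p. hook_key M (b p)) {1..n}"
  proof (rule inj_onI)
    fix p q assume "p \<in> {1..n}" "q \<in> {1..n}" "hook_key M (b p) = hook_key M (b q)"
    then show "p = q"
      using hook_key_inj[of M "fst (b p)" "snd (b p)" "fst (b q)" "snd (b q)"] M growth_inj[OF assms, of p q]
      by (simp add: prod_eq_iff)
  qed
  from enumerate_by_key[OF this] obtain \<sigma> where p\<sigma>: "\<sigma> permutes {1..n}"
    and mono: "\<And>p q. p \<in> {1..n} \<Longrightarrow> q \<in> {1..n} \<Longrightarrow> p < q \<Longrightarrow> hook_key M (b (\<sigma> p)) < hook_key M (b (\<sigma> q))"
    by blast
  define h where "h = b \<circ> \<sigma>"
  have in\<sigma>: "\<sigma> p \<in> {1..n}" if "p \<in> {1..n}" for p using permutes_in_image[OF p\<sigma>] that by blast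
  have Mh: "fst (h p) < M" "snd (h p) < M" if "p \<in> {1..n}" for p
    using M in\<sigma>[OF that] by (auto simp: h_def)
  have g: "growth h n"
    unfolding growth_def
  proof (intro conjI ballI allI impI)
    show "inj_on h {1..n}"
      using assms permutes_image[OF p\<sigma>] permutes_inj_on[OF p\<sigma>]
      unfolding growth_def h_def by (simp add: comp_inj_on)
    fix p assume p: "p \<in> {1..n}"
    show "1 \<le> fst (h p)" "1 \<le> snd (h p)" using growth_pos[OF assms in\<sigma>[OF p]] by (auto simp: h_def)
    fix i j assume ij: "1 \<le> i \<and> i \<le> fst (h p) \<and> 1 \<le> j \<and> j \<le> snd (h p)"
    then obtain r where r: "r \<in> {1..\<sigma> p}" "b r = (i, j)"
      using growthD[OF assms in\<sigma>[OF p], of i j] by (auto simp: h_def)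
    have "r \<in> \<sigma> ` {1..n}" using r(1) in\<sigma>[OF p] permutes_image[OF p\<sigma>] by auto
    then obtain q where q: "q \<in> {1..n}" "\<sigma> q = r" by auto
    have "\<not> p < q"
    proof
      assume "p < q"
      then have "hook_key M (h p) < hook_key M (i, j)" using mono[OF p q(1)] q r by (simp add: h_def)
      moreover have "hook_key M (i, j) \<le> hook_key M (h p)"
      proof (cases "(i, j) = h p")
        case False
        then show ?thesis
          using hook_key_less[of i "fst (h p)" j "snd (h p)" M] ij Mh[OF p] by simp
      qed simp
      ultimately show False by simp
    qed
    then show "\<exists>q\<in>{1..p}. h q = (i, j)" using q r(2) by (intro bexI[of _ q]) (auto simp: h_def)
  qed
  have "Suc p < N \<and> \<bar>ct h (Suc p) - ct h p\<bar> = 1 \<and> hook (h (Suc p)) = hook (h p)"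
    if pN: "1 \<le> p" "p < N" "N \<le> n" "ct h p = ct h N" for p N
  proof -
    obtain i j where p: "h p = (i, j)" by (cases "h p")
    have pn: "p \<in> {1..n}" "N \<in> {1..n}" using pN by auto
    have "\<not> (fst (h N) \<le> i \<and> snd (h N) \<le> j)"
      using growth_le[OF g pn(2,1)] pN(2) p by auto
    then have lt: "i < fst (h N)" "j < snd (h N)" using pN(4) p by (auto simp: ct_def)
    \<comment> \<open>The next box on the hook of p: below it on the leg or at the corner, to its
      right on the arm.\<close>
    define \<beta> where "\<beta> = (if j \<le> i then (Suc i, j) else (i, Suc j))"
    have "1 \<le> i" "1 \<le> j" using growth_pos[OF g pn(1)] p by auto
    then have "1 \<le> fst \<beta>" "fst \<beta> \<le> fst (h N)" "1 \<le> snd \<beta>" "snd \<beta> \<le> snd (h N)"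
      using lt by (auto simp: \<beta>_def)
    then obtain q where q: "q \<in> {1..N}" "h q = \<beta>"
      using growthD[OF g pn(2), of "fst \<beta>" "snd \<beta>"] by auto
    then have qn: "q \<in> {1..n}" using pn by auto
    have key: "hook_key M (h q) = Suc (hook_key M (h p))"
      using q(2) p by (auto simp: \<beta>_def hook_key_def min_def)
    have mono': "hook_key M (h p) < hook_key M (h q)" if "p \<in> {1..n}" "q \<in> {1..n}" "p < q" for p q
      using mono[OF that] by (simp add: h_def)
    have "\<not> q < p" "q \<noteq> p" using mono'[OF qn pn(1)] key by auto
    moreover have "\<not> Suc p < q"
    proof
      assume "Suc p < q"
      then have "Suc p \<in> {1..n}" using qn by auto
      then show False
        using mono'[OF pn(1), of "Suc p"] mono'[of "Suc p", OF _ qn] \<open>Suc p < q\<close> key by simp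
    qed
    ultimately have qp: "q = Suc p" by simp
    have c: "\<bar>ct h q - ct h p\<bar> = 1" "hook (h q) = hook (h p)"
      using q(2) p by (auto simp: ct_def \<beta>_def hook_def)
    moreover have "q \<noteq> N" using c pN(4) by auto
    ultimately show ?thesis using qp q(1) by auto
  qed
  then show ?thesis using p\<sigma> g unfolding h_def by blast
qed

section \<open>Counting boxes by content\<close>

lemma card_content_ge:
  assumes "growth b n" "N \<in> {1..n}" "inj_on f {1..K}"
    and "\<And>k. k \<in> {1..K} \<Longrightarrow> f k \<noteq> b N \<and> 1 \<le> fst (f k) \<and> 1 \<le> snd (f k) \<and>
      fst (f k) \<le> fst (b N) \<and> snd (f k) \<le> snd (b N) \<and> int (snd (f k)) - int (fst (f k)) = c"
  shows "K \<le> card {p \<in> {1..<N}. ct b p = c}"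
proof -
  have "\<exists>q. q \<in> {1..<N} \<and> b q = f k" if k: "k \<in> {1..K}" for k
  proof -
    obtain q where q: "q \<in> {1..N}" "b q = f k"
      using growthD[OF assms(1,2), of "fst (f k)" "snd (f k)"] assms(4)[OF k] by auto
    moreover have "q \<noteq> N" using q assms(4)[OF k] by auto
    ultimately show ?thesis by (intro exI[of _ q]) auto
  qed
  then obtain g where g: "\<And>k. k \<in> {1..K} \<Longrightarrow> g k \<in> {1..<N} \<and> b (g k) = f k" by metis
  have "inj_on g {1..K}"
  proof (rule inj_onI)
    fix k l assume kl: "k \<in> {1..K}" "l \<in> {1..K}" "g k = g l"
    then have "f k = f l" using g[OF kl(1)] g[OF kl(2)] by simp
    then show "k = l" using inj_onD[OF assms(3)] kl by blast
  qed
  moreover have "g ` {1..K} \<subseteq> {p \<in> {1..<N}. ct b p = c}"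
    using g assms(4) by (auto simp: ct_def)
  ultimately show ?thesis
    using card_inj_on_le[of g "{1..K}" "{p \<in> {1..<N}. ct b p = c}"] by simp
qed

text \<open>For N at (i, j), earlier boxes on its diagonal are strictly northwest, so there are at
  most min i j - 1. The neighbouring diagonals contain at least min (i-1) j and min i (j-1) earlier
  boxes. The inequality compares orders of poles and zeros in \<open>tendsto_kappa\<close>.\<close>

lemma card_content:
  assumes "growth b n" "N \<in> {1..n}"
  defines "A \<equiv> \<lambda>d. {p \<in> {1..<N}. ct b p = ct b N + d}"
  shows "2 * card (A 0) + 1 \<le> card (A 1) + card (A (- 1)) + (if ct b N = 0 then 1 else 0)"
proof -
  obtain i j where N: "b N = (i, j)" by (cases "b N")
  have pos: "1 \<le> i" "1 \<le> j" using growth_pos[OF assms(1,2)] N by auto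
  have lt: "fst (b p) < i \<and> snd (b p) < j" if "p \<in> A 0" for p
  proof -
    have p: "p \<in> {1..n}" "p < N" "ct b p = ct b N" using that assms(2) by (auto simp: A_def)
    then have "\<not> (i \<le> fst (b p) \<and> j \<le> snd (b p))"
      using growth_le[OF assms(1,2) p(1)] N by auto
    then show ?thesis using p(3) N by (auto simp: ct_def)
  qed
  have inj: "inj_on (\<lambda>p. i - fst (b p)) (A 0)"
  proof (rule inj_onI)
    fix p q assume pq: "p \<in> A 0" "q \<in> A 0" "i - fst (b p) = i - fst (b q)"
    then have "fst (b p) = fst (b q)" using lt[of p] lt[of q] by auto
    moreover have "ct b p = ct b q" using pq by (auto simp: A_def)
    ultimately have "b p = b q" by (auto simp: ct_def prod_eq_iff)
    then show "p = q" using growth_inj[OF assms(1), of p q] pq assms(2) by (auto simp: A_def)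
  qed
  have im: "(\<lambda>p. i - fst (b p)) ` A 0 \<subseteq> {1..<min i j}"
  proof (rule image_subsetI)
    fix p assume p: "p \<in> A 0"
    then have "1 \<le> fst (b p)" "1 \<le> snd (b p)" "ct b p = ct b N"
      using growth_pos[OF assms(1), of p] assms(2) by (auto simp: A_def)
    then show "i - fst (b p) \<in> {1..<min i j}" using lt[OF p] N by (auto simp: ct_def)
  qed
  have 0: "card (A 0) \<le> min i j - 1"
    using card_inj_on_le[OF inj im] by simp
  have 1: "min (i - 1) j \<le> card (A 1)"
    unfolding A_def by (rule card_content_ge[OF assms(1,2), of "\<lambda>k. (i - k, Suc j - k)"])
      (use N pos in \<open>auto simp: inj_on_def ct_def\<close>)
  have 2: "min i (j - 1) \<le> card (A (- 1))"
    unfolding A_def by (rule card_content_ge[OF assms(1,2), of "\<lambda>k. (Suc i - k, j - k)"])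
      (use N pos in \<open>auto simp: inj_on_def ct_def\<close>)
  have "ct b N = 0 \<longleftrightarrow> i = j" using N by (auto simp: ct_def)
  then show ?thesis using 0 1 2 pos by (auto simp: min_def split: if_splits)
qed

section \<open>From standard tableaux to growth sequences\<close>

lemma in_diagram_mono:
  assumes "partition_of n lam" "(i, j) \<in> diagram lam" "1 \<le> i'" "i' \<le> i" "1 \<le> j'" "j' \<le> j"
  shows "(i', j') \<in> diagram lam"
proof -
  have "lam ! (i - 1) \<le> lam ! (i' - 1)"
  proof (cases "i' = i")
    case False
    then show ?thesis
      using assms sorted_wrt_nth_less[of "(\<ge>)" lam "i' - 1" "i - 1"]
      by (auto simp: partition_of_def diagram_def)
  qed simp
  then show ?thesis using assms by (auto simp: diagram_def)
qed

lemma box_of_bij: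
  assumes "standard_tableau lam T"
  shows "bij_betw (box_of lam T) {1..sum_list lam} (diagram lam)"
  using assms bij_betw_inv_into[of T "diagram lam"] unfolding standard_tableau_def box_of_def[abs_def]
  by auto

lemma T_box_of:
  assumes "standard_tableau lam T" "p \<in> {1..sum_list lam}"
  shows "T (box_of lam T p) = p"
  using assms unfolding standard_tableau_def box_of_def
  by (metis bij_betw_imp_surj_on f_inv_into_f)

lemma growth_box_of:
  assumes "partition_of n lam" "standard_tableau lam T"
  shows "growth (box_of lam T) n"
proof -
  let ?b = "box_of lam T"
  have n: "n = sum_list lam" using assms(1) by (simp add: partition_of_def)
  have bij: "bij_betw ?b {1..n} (diagram lam)" unfolding n by (rule box_of_bij[OF assms(2)])
  have T: "T (?b p) = p" if "p \<in> {1..n}" for p using T_box_of[OF assms(2)] that n by blast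
  have inD: "?b p \<in> diagram lam" if "p \<in> {1..n}" for p using bij_betwE[OF bij] that by blast
  show ?thesis
    unfolding growth_def
  proof (intro conjI ballI allI impI)
    show "inj_on ?b {1..n}" using bij by (rule bij_betw_imp_inj_on)
    fix p assume p: "p \<in> {1..n}"
    obtain i j where b: "?b p = (i, j)" by (cases "?b p")
    show "1 \<le> fst (?b p)" "1 \<le> snd (?b p)" using inD[OF p] by (auto simp: diagram_def b)
    fix i' j' assume ij: "1 \<le> i' \<and> i' \<le> fst (?b p) \<and> 1 \<le> j' \<and> j' \<le> snd (?b p)"
    have d: "(i, j) \<in> diagram lam" "(i', j) \<in> diagram lam" "(i', j') \<in> diagram lam"
      using inD[OF p] ij in_diagram_mono[OF assms(1), of i j] by (auto simp: b diagram_def)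
    \<comment> \<open>The entries are compared along row i' and then down column j.\<close>
    have "T (i', j') \<le> T (i', j)"
      using assms(2) d ij unfolding standard_tableau_def b
      by (cases "j' = j") (auto intro!: less_imp_le)
    also have "\<dots> \<le> T (i, j)"
      using assms(2) d ij unfolding standard_tableau_def b
      by (cases "i' = i") (auto intro!: less_imp_le)
    also have "\<dots> = p" using T[OF p] b by simp
    finally have le: "T (i', j') \<le> p" .
    obtain q where q: "q \<in> {1..n}" "?b q = (i', j')"
      using d(3) bij unfolding bij_betw_def by (metis imageE)
    then show "\<exists>q\<in>{1..p}. ?b q = (i', j')"
      using T[OF q(1)] le by (intro bexI[of _ q]) auto
  qed
qed

section \<open>Values of functions with coefficients in the group algebra\<close>

text \<open>With a fixed finite K the range of summation no longer depends on a, as needed when a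
  varies with the point.\<close>

lemma lookup_mult_sum:
  assumes "Poly_Mapping.keys a \<subseteq> K" "finite K"
  shows "lookup (a * b) g = (\<Sum>h\<in>K. lookup a h * lookup b (- h + g))"
proof -
  have "a * b = (\<Sum>h\<in>Poly_Mapping.keys a. Poly_Mapping.single h (lookup a h) * b)"
    by (subst galg_decomp[of a]) (simp add: sum_distrib_right)
  then have "lookup (a * b) g = (\<Sum>h\<in>Poly_Mapping.keys a. lookup a h * lookup b (- h + g))"
    by (simp add: lookup_sum lookup_single_mult)
  also have "\<dots> = (\<Sum>h\<in>K. lookup a h * lookup b (- h + g))"
    using assms by (intro sum.mono_neutral_left) (auto simp: in_keys_iff)
  finally show ?thesis .
qed

text \<open>\<open>sv f w\<close> says that the scalar function \<open>f\<close>, of which only the restriction to \<open>U\<close> matters, has the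
  value \<open>w\<close> at a fixed point. It is used for values of rational functions in the sense of \<open>has_rational_value\<close> and
  for limits. \<open>U\<close> may contain zeros of \<open>k\<close> in \<open>sv_divide\<close>; only the value of \<open>k\<close> has to be nonzero.\<close>

locale regval =
  fixes U :: "'z set" and sv :: "('z \<Rightarrow> complex) \<Rightarrow> complex \<Rightarrow> bool"
  assumes sv_const: "sv (\<lambda>z. c) c"
    and sv_add: "sv f a \<Longrightarrow> sv g b \<Longrightarrow> sv (\<lambda>z. f z + g z) (a + b)"
    and sv_mult: "sv f a \<Longrightarrow> sv g b \<Longrightarrow> sv (\<lambda>z. f z * g z) (a * b)"
    and sv_divide: "sv g b \<Longrightarrow> sv k c \<Longrightarrow> c \<noteq> 0 \<Longrightarrow> (\<And>z. z \<in> U \<Longrightarrow> f z * k z = g z) \<Longrightarrow> sv f (b / c)"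
    and sv_unique: "sv f a \<Longrightarrow> sv f b \<Longrightarrow> a = b"
begin

lemma sv_cong: "sv g b \<Longrightarrow> (\<And>z. z \<in> U \<Longrightarrow> f z = g z) \<Longrightarrow> sv f b"
  using sv_divide[of g b "\<lambda>z. 1" 1 f] sv_const[of 1] by simp

lemma sv_uminus: "sv f a \<Longrightarrow> sv (\<lambda>z. - f z) (- a)"
  using sv_mult[OF sv_const[of "- 1"]] by simp

lemma sv_diff: "sv f a \<Longrightarrow> sv g b \<Longrightarrow> sv (\<lambda>z. f z - g z) (a - b)"
  using sv_add[OF _ sv_uminus, of f a g b] by simp

lemma sv_sum: "(\<And>i. i \<in> I \<Longrightarrow> sv (f i) (a i)) \<Longrightarrow> sv (\<lambda>z. \<Sum>i\<in>I. f i z) (\<Sum>i\<in>I. a i)"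
  by (induction I rule: infinite_finite_induct) (auto intro: sv_const sv_add)

text \<open>The value is taken coefficientwise. The common finite bound on the supports makes the
  coefficients of a product finite sums over a fixed set.\<close>

definition gv :: "('z \<Rightarrow> galg) \<Rightarrow> galg \<Rightarrow> bool" where
  "gv F A \<longleftrightarrow> (\<exists>K. finite K \<and> (\<forall>z\<in>U. Poly_Mapping.keys (F z) \<subseteq> K)) \<and>
     (\<forall>g. sv (\<lambda>z. lookup (F z) g) (lookup A g))"

lemma gv_const: "gv (\<lambda>z. A) A"
  unfolding gv_def by (auto intro!: sv_const exI[of _ "Poly_Mapping.keys A"])

lemma gv_cong:
  assumes "gv F A" "\<And>z. z \<in> U \<Longrightarrow> G z = F z"
  shows "gv G A"
proof -
  have "sv (\<lambda>z. lookup (G z) g) (lookup A g)" for g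
    by (rule sv_cong[of "\<lambda>z. lookup (F z) g"]) (use assms gv_def in auto)
  then show ?thesis using assms unfolding gv_def by simp
qed

lemma gv_unique: "gv F A \<Longrightarrow> gv F B \<Longrightarrow> A = B"
  unfolding gv_def by (intro poly_mapping_eqI) (blast intro: sv_unique)

lemma gv_add:
  assumes "gv F A" "gv G B"
  shows "gv (\<lambda>z. F z + G z) (A + B)"
proof -
  obtain K L where K: "finite K" "\<forall>z\<in>U. Poly_Mapping.keys (F z) \<subseteq> K" "finite L"
    "\<forall>z\<in>U. Poly_Mapping.keys (G z) \<subseteq> L" using assms unfolding gv_def by blast
  then have "finite (K \<union> L)" "\<forall>z\<in>U. Poly_Mapping.keys (F z + G z) \<subseteq> K \<union> L"
    using Poly_Mapping.keys_add[of "F _" "G _"] by blast+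
  then show ?thesis
    using assms unfolding gv_def by (auto simp: lookup_add intro!: sv_add)
qed

lemma gv_mult:
  assumes "gv F A" "gv G B"
  shows "gv (\<lambda>z. F z * G z) (A * B)"
proof -
  obtain K L where K: "finite K" "\<forall>z\<in>U. Poly_Mapping.keys (F z) \<subseteq> K" and L: "finite L"
    "\<forall>z\<in>U. Poly_Mapping.keys (G z) \<subseteq> L" using assms unfolding gv_def by blast
  let ?K = "K \<union> Poly_Mapping.keys A"
  have fin: "finite ?K" using K by simp
  have A: "\<And>g. sv (\<lambda>z. lookup (F z) g) (lookup A g)" and B: "\<And>g. sv (\<lambda>z. lookup (G z) g) (lookup B g)"
    using assms unfolding gv_def by auto
  have "sv (\<lambda>z. lookup (F z * G z) g) (lookup (A * B) g)" for g
  proof (rule sv_cong)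
    show "sv (\<lambda>z. \<Sum>h\<in>?K. lookup (F z) h * lookup (G z) (- h + g)) (lookup (A * B) g)"
      unfolding lookup_mult_sum[OF Un_upper2[of "Poly_Mapping.keys A" K] fin]
      by (intro sv_sum sv_mult A B)
    show "lookup (F z * G z) g = (\<Sum>h\<in>?K. lookup (F z) h * lookup (G z) (- h + g))" if "z \<in> U" for z
      by (rule lookup_mult_sum[OF _ fin]) (use K(2) that in auto)
  qed
  moreover have "Poly_Mapping.keys (F z * G z) \<subseteq> (\<lambda>(g, h). g + h) ` (K \<times> L)" if z: "z \<in> U" for z
  proof
    fix g assume "g \<in> Poly_Mapping.keys (F z * G z)"
    then obtain a b where "g = a + b" "a \<in> Poly_Mapping.keys (F z)" "b \<in> Poly_Mapping.keys (G z)"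
      using keys_mult[of "F z" "G z"] by auto
    then show "g \<in> (\<lambda>(g, h). g + h) ` (K \<times> L)"
      using K(2) L(2) z by (intro image_eqI[of _ _ "(a, b)"]) auto
  qed
  moreover have "finite ((\<lambda>(g, h). g + h) ` (K \<times> L))" using K(1) L(1) by simp
  ultimately show ?thesis unfolding gv_def by blast
qed

lemma gv_scl: "sv f a \<Longrightarrow> gv (\<lambda>z. scl (f z)) (scl a)"
  unfolding gv_def scl_def lookup_single
  by (auto simp: when_def intro!: exI[of _ "{0}"] sv_const)

lemma gv_diff: "gv F A \<Longrightarrow> gv G B \<Longrightarrow> gv (\<lambda>z. F z - G z) (A - B)"
  using gv_add[OF _ gv_mult[OF gv_const[of "- 1"]], of F A G B] by simp

lemma gv_star:
  assumes "gv F A"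
  shows "gv (\<lambda>z. star (F z)) (star A)"
proof -
  obtain K where K: "finite K" "\<forall>z\<in>U. Poly_Mapping.keys (F z) \<subseteq> K"
    using assms unfolding gv_def by blast
  have "Poly_Mapping.keys (star (F z)) \<subseteq> uminus ` K" if z: "z \<in> U" for z
  proof
    fix g assume "g \<in> Poly_Mapping.keys (star (F z))"
    then have "- g \<in> K" using K(2) z by (auto simp: in_keys_iff lookup_star subset_iff)
    then show "g \<in> uminus ` K" by (intro image_eqI[of _ _ "- g"]) simp_all
  qed
  then have "\<exists>K. finite K \<and> (\<forall>z\<in>U. Poly_Mapping.keys (star (F z)) \<subseteq> K)"
    using K(1) by blast
  then show ?thesis
    using assms unfolding gv_def lookup_star by blast
qed

text \<open>k may vanish at points of U, where G says nothing about F; the bound on the supports of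
  F is therefore a hypothesis of its own.\<close>

lemma gv_divide:
  assumes "gv G B" "sv k c" "c \<noteq> 0" "\<And>z. z \<in> U \<Longrightarrow> scl (k z) * F z = G z"
    and "finite K" "\<And>z. z \<in> U \<Longrightarrow> Poly_Mapping.keys (F z) \<subseteq> K"
  shows "gv F (scl (1 / c) * B)"
proof -
  have "sv (\<lambda>z. lookup (F z) g) (lookup B g / c)" for g
  proof (rule sv_divide[OF _ assms(2,3)])
    show "sv (\<lambda>z. lookup (G z) g) (lookup B g)" using assms(1) unfolding gv_def by blast
    show "lookup (F z) g * k z = lookup (G z) g" if "z \<in> U" for z
      using assms(4)[OF that] by (metis lookup_scl_mult mult.commute)
  qed
  then show ?thesis using assms(5,6) unfolding gv_def by auto
qed

lemma sv_inverse_diff: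
  assumes "sv u a" "sv v b" "a \<noteq> b" "\<And>z. z \<in> U \<Longrightarrow> u z \<noteq> v z"
  shows "sv (\<lambda>z. 1 / (u z - v z)) (1 / (a - b))"
  by (rule sv_divide[OF sv_const sv_diff[OF assms(1,2)]]) (use assms(3,4) in auto)

lemma gv_rmat:
  assumes "sv u a" "sv v b" "a \<noteq> b" "\<And>z. z \<in> U \<Longrightarrow> u z \<noteq> v z"
  shows "gv (\<lambda>z. rmat p q (u z) (v z)) (rmat p q a b)"
  unfolding rmat_def
  by (intro gv_diff gv_const gv_mult gv_scl sv_inverse_diff assms)

text \<open>The denominators of the indices in S do not occur in the merged column, and these are
  the only ones allowed to vanish in the limit.\<close>

lemma gv_bcol:
  assumes "\<And>p. p \<in> {1..m} \<Longrightarrow> sv (\<lambda>z. x z p) (c p)" "sv u a"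
    and "\<And>p. p \<in> {1..m} \<Longrightarrow> p \<notin> S \<Longrightarrow> c p \<noteq> a" "\<And>z p. z \<in> U \<Longrightarrow> p \<in> {1..m} \<Longrightarrow> x z p \<noteq> u z"
  shows "gv (\<lambda>z. bcol (x z) S m N (u z)) (bcol c S m N a)"
  using assms(1,3,4)
proof (induction m)
  case 0
  show ?case by (simp add: gv_const)
next
  case (Suc m)
  have IH: "gv (\<lambda>z. bcol (x z) S m N (u z)) (bcol c S m N a)"
    using Suc by auto
  have x: "sv (\<lambda>z. x z (Suc m)) (c (Suc m))" using Suc.prems(1) by simp
  have ne: "x z (Suc m) \<noteq> u z" if "z \<in> U" for z using Suc.prems(3)[OF that] by simp
  show ?case
  proof (cases "Suc m \<in> S")
    case True
    then show ?thesis using IH by simp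
  next
    case False
    then have c: "c (Suc m) \<noteq> a" using Suc.prems(2) by simp
    show ?thesis
      using False gv_mult[OF IH gv_rmat[OF x assms(2) c ne]]
        gv_mult[OF IH gv_diff[OF gv_const gv_mult[OF gv_scl[OF sv_inverse_diff[OF x assms(2) c ne]] gv_const]]]
      by (cases "m \<in> S") simp_all
  qed
qed

end

section \<open>Vanishing at the content of an addable box\<close>

text \<open>Only differences of parameters enter, so the value is the same along the whole diagonal
  line.\<close>

lemma bcol_shift: "bcol (\<lambda>p. t + c p) S m N (t + u) = bcol c S m N u"
  by (induction m) (simp_all add: rmat_def)

text \<open>A factor with c p = c N has a double pole, one with c p = c N + 1 or c N - 1 a simple
  zero, and u itself a simple zero if c N = 0. By \<open>card_content\<close> the zeros outnumber
  the poles.\<close>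

lemma tendsto_kappa:
  assumes "growth h n" "N \<in> {1..n}"
  defines "c \<equiv> \<lambda>p. of_int (ct h p) :: complex"
  shows "((\<lambda>u. u * (\<Prod>p\<in>{1..<N}. 1 - 1 / (u - c p)^2)) \<longlongrightarrow> 0) (at (c N))"
proof -
  define A where "A d = {p \<in> {1..<N}. ct h p = ct h N + d}" for d
  define e where "e = (if ct h N = 0 then 1 else 0 :: nat)"
  have cA: "c p = c N + of_int d" if "p \<in> A d" for p d
    using that by (simp add: A_def c_def)
  have sq: "1 - 1 / y\<^sup>2 = (y\<^sup>2 - 1) / y\<^sup>2" if "y \<noteq> 0" for y :: complex
    using that by (simp add: diff_divide_distrib)
  have disj: "A 0 \<inter> A 1 = {}" "A 0 \<inter> A (- 1) = {}" "A 1 \<inter> A (- 1) = {}" by (auto simp: A_def)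
  have fin: "finite (A d)" for d by (simp add: A_def)
  have sub: "A d \<subseteq> {1..<N}" for d by (auto simp: A_def)
  \<comment> \<open>r + 1 is the number of zeros minus the number of poles at c N.\<close>
  obtain r where r: "card (A 1 \<union> A (- 1)) + e = 2 * card (A 0) + 1 + r"
    using le_Suc_ex[OF card_content[OF assms(1,2)]] card_Un_disjoint[OF fin fin disj(3)]
    unfolding A_def[symmetric] e_def by auto
  \<comment> \<open>What remains of the factor of p after the powers of u - c N are removed;
    \<open>v\<close> does the same for the factor u.\<close>
  define G where "G p u = (if p \<in> A 0 then (u - c N)^2 - 1
     else if p \<in> A 1 then (u - c N - 2) / (u - c N - 1)^2
     else if p \<in> A (- 1) then (u - c N + 2) / (u - c N + 1)^2 else 1 - 1 / (u - c p)^2)" for p u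
  define v where "v u = (if ct h N = 0 then 1 else u)" for u :: complex
  have G: "(G p \<longlongrightarrow> G p (c N)) (at (c N))" if "p \<in> {1..<N}" for p
  proof -
    consider "p \<in> A 0" | "p \<in> A 1" "p \<notin> A 0" | "p \<in> A (- 1)" "p \<notin> A 0" "p \<notin> A 1"
      | "p \<notin> A 0" "p \<notin> A 1" "p \<notin> A (- 1)" by blast
    then show ?thesis
    proof cases
      case 4
      then have "ct h p \<noteq> ct h N" using that by (auto simp: A_def)
      then have "c N - c p \<noteq> 0" by (simp add: c_def)
      then show ?thesis using 4 unfolding G_def by (auto intro!: tendsto_eq_intros)
    qed (unfold G_def, auto intro!: tendsto_eq_intros)
  qed
  have V: "(v \<longlongrightarrow> v (c N)) (at (c N))"
    unfolding v_def by (cases "ct h N = 0") (auto intro: tendsto_const)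
  have lim: "((\<lambda>u. v u * (\<Prod>p\<in>{1..<N}. G p u) * (u - c N) ^ Suc r) \<longlongrightarrow>
      v (c N) * (\<Prod>p\<in>{1..<N}. G p (c N)) * (c N - c N) ^ Suc r) (at (c N))"
    by (intro tendsto_mult V tendsto_prod G tendsto_power tendsto_diff tendsto_ident_at tendsto_const)
  have ev: "\<forall>\<^sub>F u in at (c N). \<forall>p\<in>insert (c N) (c ` {1..<N}). u \<noteq> p"
    by (intro eventually_ball_finite) (auto intro: eventually_neq_at_within)
  have "\<forall>\<^sub>F u in at (c N). u * (\<Prod>p\<in>{1..<N}. 1 - 1 / (u - c p)^2)
      = v u * (\<Prod>p\<in>{1..<N}. G p u) * (u - c N) ^ Suc r"
    using ev
  proof eventually_elim
    case (elim u)
    define w where "w = u - c N"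
    have w: "w \<noteq> 0" using elim by (simp add: w_def)
    have ne: "u - c p \<noteq> 0" if "p \<in> {1..<N}" for p using elim that by auto
    let ?K = "\<Prod>p\<in>{1..<N}. 1 - 1 / (u - c p)^2"
    have "(1 - 1 / (u - c p)^2) * (if p \<in> A 0 then w^2 else 1)
      = G p u * (if p \<in> A 1 \<union> A (- 1) then w else 1)" if p: "p \<in> {1..<N}" for p
    proof -
      consider "p \<in> A 0" | "p \<in> A 1" | "p \<in> A (- 1)" | "p \<notin> A 0" "p \<notin> A 1" "p \<notin> A (- 1)" by blast
      then show ?thesis
      proof cases
        case 1
        then show ?thesis using disj cA[OF 1] w by (auto simp: G_def w_def field_simps)
      next
        case 2
        then have e: "u - c p = w - 1" using cA[OF 2] by (simp add: w_def)
        then have "w - 1 \<noteq> 0" using ne[OF p] by simp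
        then have "1 - 1 / (w - 1)^2 = (w - 2) / (w - 1)^2 * w"
          by (simp add: sq) (simp add: power2_eq_square algebra_simps)
        then show ?thesis unfolding e using disj 2 by (auto simp: G_def w_def)
      next
        case 3
        then have e: "u - c p = w + 1" using cA[OF 3] by (simp add: w_def)
        then have "w + 1 \<noteq> 0" using ne[OF p] by simp
        then have "1 - 1 / (w + 1)^2 = (w + 2) / (w + 1)^2 * w"
          by (simp add: sq) (simp add: power2_eq_square algebra_simps)
        then show ?thesis unfolding e using disj 3 by (auto simp: G_def w_def)
      next
        case 4
        then show ?thesis by (simp add: G_def)
      qed
    qed
    then have "(\<Prod>p\<in>{1..<N}. (1 - 1 / (u - c p)^2) * (if p \<in> A 0 then w^2 else 1))
      = (\<Prod>p\<in>{1..<N}. G p u * (if p \<in> A 1 \<union> A (- 1) then w else 1))"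
      by (rule prod.cong[OF refl])
    then have K: "?K * (\<Prod>p\<in>{1..<N}. if p \<in> A 0 then w^2 else 1)
      = (\<Prod>p\<in>{1..<N}. G p u) * (\<Prod>p\<in>{1..<N}. if p \<in> A 1 \<union> A (- 1) then w else 1)"
      by (simp only: prod.distrib)
    have pw: "(\<Prod>p\<in>{1..<N}. if p \<in> B then y else 1) = y ^ card B" if "B \<subseteq> {1..<N}" for B and y :: complex
      using that prod.inter_restrict[of "{1..<N}" "\<lambda>_. y" B] by (simp add: Int_absorb1)
    \<comment> \<open>Powers of w are kept as multipliers on both sides: those on the left count the
      poles, those on the right the zeros.\<close>
    have K: "?K * (w^2) ^ card (A 0) = (\<Prod>p\<in>{1..<N}. G p u) * w ^ card (A 1 \<union> A (- 1))"
      using K unfolding pw[OF sub] pw[OF Un_least[OF sub sub]] .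
    have u: "u = v u * w ^ e"
      by (simp add: v_def e_def w_def c_def)
    have "u * ?K * w ^ (2 * card (A 0)) = v u * w ^ e * (?K * (w^2) ^ card (A 0))"
      by (subst u) (simp add: power_mult)
    also have "\<dots> = v u * (\<Prod>p\<in>{1..<N}. G p u) * w ^ (card (A 1 \<union> A (- 1)) + e)"
      unfolding K by (simp add: power_add)
    also have "\<dots> = v u * (\<Prod>p\<in>{1..<N}. G p u) * w ^ Suc r * w ^ (2 * card (A 0))"
      unfolding r by (simp add: power_add)
    finally show ?case using w by (simp add: w_def)
  qed
  then show ?thesis
    using lim by (subst tendsto_cong) auto
qed

lemma finite_perm_fixing: "finite {g :: nat perm. \<forall>j. j \<notin> {1..n} \<longrightarrow> Perm.apply g j = j}"
proof (rule finite_imageD)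
  have "Perm.apply ` {g. \<forall>j. j \<notin> {1..n} \<longrightarrow> Perm.apply g j = j} \<subseteq> {f. f permutes {1..n}}"
  proof clarify
    fix g :: "nat perm" assume "\<forall>j. j \<notin> {1..n} \<longrightarrow> Perm.apply g j = j"
    then show "Perm.apply g permutes {1..n}"
      using bij_apply[of g, unfolded bij_iff] by (simp add: permutes_def)
  qed
  then show "finite (Perm.apply ` {g. \<forall>j. j \<notin> {1..n} \<longrightarrow> Perm.apply g j = j})"
    using finite_permutations[of "{1..n}"] finite_subset by auto
  show "inj_on Perm.apply {g. \<forall>j. j \<notin> {1..n} \<longrightarrow> Perm.apply g j = j}"
    by (rule inj_onI) (simp add: perm_eq_iff)
qed

text \<open>Let u tend to c (m+1) in \<open>jucys_col\<close>. By \<open>col_merge\<close> the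
  column can be replaced by its merged form, which is continuous there, while the scalar on the
  right tends to 0.\<close>

lemma weight_at_addable:
  fixes h :: "nat \<Rightarrow> nat \<times> nat" and G :: galg
  assumes "growth h n" "Suc m \<le> n"
  defines "c \<equiv> \<lambda>p. of_int (ct h p) :: complex"
  defines "S \<equiv> {p \<in> {1..m}. ct h p = ct h (Suc m)}"
  assumes w: "\<And>p. p \<in> {1..m} \<Longrightarrow> G * jm (p - 1) p = scl (c p) * G"
    and com: "G * jm m (Suc m) = jm m (Suc m) * G"
    and S: "\<And>p. p \<in> S \<Longrightarrow> 1 \<le> p \<and> Suc p \<notin> S \<and> (\<exists>\<delta>. \<delta> * \<delta> = 1 \<and> c p - c (Suc p) = \<delta> \<and>
      G * tr p (Suc p) = scl (- \<delta>) * G)"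
    and mS: "m \<notin> S"
  shows "jm m (Suc m) * (G * bcol c S m (Suc m) (c (Suc m))) =
    scl (c (Suc m)) * (G * bcol c S m (Suc m) (c (Suc m)))"
proof -
  let ?N = "Suc m"
  \<comment> \<open>The complement is finite, so U contains a punctured neighbourhood of the limit
    point.\<close>
  define U where "U = {u. u \<noteq> 0 \<and> (\<forall>p\<in>{1..m}. c p \<noteq> u)}"
  have ev: "\<forall>\<^sub>F u in at (c ?N). u \<in> U"
  proof -
    have "\<forall>\<^sub>F u in at (c ?N). \<forall>p\<in>insert 0 (c ` {1..m}). u \<noteq> p"
      by (intro eventually_ball_finite) (auto intro: eventually_neq_at_within)
    then show ?thesis by eventually_elim (auto simp: U_def)
  qed
  interpret regval U "\<lambda>\<phi> w. (\<phi> \<longlongrightarrow> w) (at (c ?N))"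
  proof
    fix f g k :: "complex \<Rightarrow> complex" and b d
    assume g: "(g \<longlongrightarrow> b) (at (c ?N))" and k: "(k \<longlongrightarrow> d) (at (c ?N))" and d: "d \<noteq> 0"
      and f: "\<And>z. z \<in> U \<Longrightarrow> f z * k z = g z"
    have "\<forall>\<^sub>F u in at (c ?N). g u / k u = f u"
      using ev tendsto_imp_eventually_ne[OF k d] by eventually_elim (simp flip: f)
    then show "(f \<longlongrightarrow> b / d) (at (c ?N))"
      using tendsto_divide[OF g k d] by (rule Lim_transform_eventually[rotated])
  qed (auto intro: tendsto_add tendsto_mult LIM_unique)
  let ?\<kappa> = "\<lambda>u. u * (\<Prod>p\<in>{1..m}. 1 - 1 / (u - c p)^2)"
  have "gv (\<lambda>u. bcol c S m ?N u) (bcol c S m ?N (c ?N))"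
    by (rule gv_bcol) (auto simp: S_def c_def U_def intro: tendsto_ident_at)
  then have 1: "gv (\<lambda>u. (scl u - jm m ?N) * G * bcol c S m ?N u)
      ((scl (c ?N) - jm m ?N) * G * bcol c S m ?N (c ?N))"
    by (intro gv_mult gv_diff gv_const gv_scl tendsto_ident_at)
  have "(?\<kappa> \<longlongrightarrow> 0) (at (c ?N))"
    using tendsto_kappa[OF assms(1), of ?N] assms(2) by (simp add: c_def atLeastLessThanSuc_atLeastAtMost)
  then have "gv (\<lambda>u. scl (?\<kappa> u) * G) (scl 0 * G)"
    by (intro gv_mult gv_const gv_scl)
  then have "gv (\<lambda>u. scl (?\<kappa> u) * G) 0" by simp
  then have 2: "gv (\<lambda>u. (scl u - jm m ?N) * G * bcol c S m ?N u) 0"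
  proof (rule gv_cong)
    fix u assume u: "u \<in> U"
    have "G * col c m ?N u = G * bcol c S m ?N u"
      using col_merge[of S c G m ?N u] S u mS by (simp add: U_def)
    then have "(scl u - jm m ?N) * G * bcol c S m ?N u = (scl u - jm m ?N) * G * col c m ?N u"
      by (simp add: mult.assoc)
    also have "\<dots> = scl (?\<kappa> u) * G"
      using u by (intro jucys_col w com) (auto simp: U_def)
    finally show "(scl u - jm m ?N) * G * bcol c S m ?N u = scl (?\<kappa> u) * G" .
  qed
  from gv_unique[OF 1 2] show ?thesis
    by (simp add: algebra_simps)
qed

section \<open>Regularity and value for hook-ordered tableaux\<close>

context regval
begin

text \<open>Induction on m, one column at a time. For p in S, p and p + 1 lie in one hook, so on U
  their parameters differ by exactly 1 or -1; by \<open>fus_eigen\<close> the preceding product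
  absorbs (p p+1), and the merged column has no pole.\<close>

lemma fus_value_hook_order:
  assumes g: "growth h n"
    and ord: "\<And>p N. 1 \<le> p \<Longrightarrow> p < N \<Longrightarrow> N \<le> n \<Longrightarrow> ct h p = ct h N \<Longrightarrow>
      Suc p < N \<and> \<bar>ct h (Suc p) - ct h p\<bar> = 1 \<and> hook (h (Suc p)) = hook (h p)"
    and x: "\<And>p. p \<in> {1..n} \<Longrightarrow> sv (\<lambda>z. x z p) (t + of_int (ct h p))"
    and inj: "\<And>z. z \<in> U \<Longrightarrow> inj_on (x z) {1..n}"
    and hk: "\<And>z p q. z \<in> U \<Longrightarrow> p \<in> {1..n} \<Longrightarrow> q \<in> {1..n} \<Longrightarrow> hook (h p) = hook (h q) \<Longrightarrow>
      x z p - x z q = of_int (ct h p - ct h q)"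
  shows "m \<le> n \<Longrightarrow> \<exists>E. gv (\<lambda>z. fus (x z) m) E \<and>
    (\<forall>p\<in>{1..m}. jm (p - 1) p * E = scl (of_int (ct h p)) * E)"
proof (induction m)
  case 0
  show ?case using gv_const[of 1] by (intro exI[of _ 1]) simp
next
  case (Suc m)
  let ?N = "Suc m"
  define c where "c p = (of_int (ct h p) :: complex)" for p
  from Suc obtain E where E: "gv (\<lambda>z. fus (x z) m) E"
    and w: "\<And>p. p \<in> {1..m} \<Longrightarrow> jm (p - 1) p * E = scl (c p) * E"
    by (auto simp: c_def)
  have inj': "inj_on (x z) {1..m}" if "z \<in> U" for z
    using inj[OF that] Suc.prems by (auto intro: inj_on_subset)
  have "gv (\<lambda>z. fus (x z) m) (star E)"
    using gv_cong[OF gv_star[OF E]] star_fus[OF inj'] by metis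
  then have star: "star E = E" using gv_unique E by blast
  have w': "E * jm (p - 1) p = scl (c p) * E" if "p \<in> {1..m}" for p
  proof -
    have "star (jm a b) = jm a b" for a b by (simp add: jm_def star_sum)
    then show ?thesis using arg_cong[OF w[OF that], of star] star by (simp add: star_mult scl_move)
  qed
  have "gv (\<lambda>z. fus (x z) m * jm m ?N) (jm m ?N * E)"
    using gv_mult[OF gv_const[of "jm m ?N"] E] by (simp add: jm_fus_commute)
  then have com: "E * jm m ?N = jm m ?N * E"
    using gv_unique gv_mult[OF E gv_const[of "jm m ?N"]] by blast
  define S where "S = {p \<in> {1..m}. ct h p = ct h ?N}"
  \<comment> \<open>p + 1 precedes N and its content differs from that of N, so the pairs do not
    overlap and none is left open at m.\<close>
  have Sp: "1 \<le> p \<and> Suc p \<le> m \<and> Suc p \<notin> S \<and> \<bar>ct h (Suc p) - ct h p\<bar> = 1 \<and> hook (h (Suc p)) = hook (h p)"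
    if "p \<in> S" for p
    using ord[of p ?N] that Suc.prems by (auto simp: S_def)
  have S: "1 \<le> p \<and> Suc p \<notin> S \<and> (\<exists>\<delta>. \<delta> * \<delta> = 1 \<and> c p - c (Suc p) = \<delta> \<and>
      (\<forall>z\<in>U. x z p - x z (Suc p) = \<delta>) \<and> E * tr p (Suc p) = scl (- \<delta>) * E \<and>
      (\<forall>z\<in>U. fus (x z) m * tr p (Suc p) = scl (- \<delta>) * fus (x z) m))" if p: "p \<in> S" for p
  proof -
    define \<delta> where "\<delta> = c p - c (Suc p)"
    have "ct h p - ct h (Suc p) = 1 \<or> ct h p - ct h (Suc p) = - 1" using Sp[OF p] by linarith
    then have \<delta>: "\<delta> * \<delta> = 1" unfolding \<delta>_def c_def by (auto simp flip: of_int_diff)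
    have d: "x z p - x z (Suc p) = \<delta>" if "z \<in> U" for z
      using hk[OF that, of p "Suc p"] Sp[OF p] Suc.prems by (simp add: \<delta>_def c_def)
    have f: "fus (x z) m * tr p (Suc p) = scl (- \<delta>) * fus (x z) m" if "z \<in> U" for z
      using fus_eigen(2)[OF inj'[OF that], of p \<delta>] Sp[OF p] d[OF that] \<delta> by simp
    have "gv (\<lambda>z. fus (x z) m * tr p (Suc p)) (scl (- \<delta>) * E)"
      by (rule gv_cong[OF gv_mult[OF gv_const[of "scl (- \<delta>)"] E]]) (simp add: f)
    then have "E * tr p (Suc p) = scl (- \<delta>) * E"
      using gv_unique gv_mult[OF E gv_const[of "tr p (Suc p)"]] by blast
    then show ?thesis using \<delta> d f Sp[OF p] \<delta>_def by blast
  qed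
  have mS: "m \<notin> S" using Sp[of m] by auto
  have ne: "x z p \<noteq> x z ?N" if "z \<in> U" "p \<in> {1..m}" for z p
    using inj_onD[OF inj[OF that(1)], of p ?N] that(2) Suc.prems by auto
  let ?B = "bcol c S m ?N (c ?N)"
  have "gv (\<lambda>z. bcol (x z) S m ?N (x z ?N)) (bcol (\<lambda>p. t + c p) S m ?N (t + c ?N))"
    using Suc.prems ne x by (intro gv_bcol) (auto simp: S_def c_def)
  then have B: "gv (\<lambda>z. bcol (x z) S m ?N (x z ?N)) ?B" by (simp add: bcol_shift)
  have "gv (\<lambda>z. fus (x z) ?N) (E * ?B)"
  proof (rule gv_cong[OF gv_mult[OF E B]])
    fix z assume z: "z \<in> U"
    have "fus (x z) m * col (x z) m ?N (x z ?N) = fus (x z) m * bcol (x z) S m ?N (x z ?N) *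
        (if m \<in> S then rmat m ?N (x z m) (x z ?N) else 1)"
      by (rule col_merge) (use S z ne in blast)+
    then show "fus (x z) ?N = fus (x z) m * bcol (x z) S m ?N (x z ?N)"
      using mS by simp
  qed
  moreover have "jm (p - 1) p * (E * ?B) = scl (c p) * (E * ?B)" if p: "p \<in> {1..?N}" for p
  proof (cases "p = ?N")
    case True
    have "jm m ?N * (E * ?B) = scl (c ?N) * (E * ?B)"
      using weight_at_addable[OF g Suc.prems, of E] w' com S mS
      unfolding S_def c_def[abs_def] by blast
    then show ?thesis using True by simp
  next
    case False
    then show ?thesis using w[of p] p by (simp flip: mult.assoc)
  qed
  ultimately show ?case unfolding c_def by blast
qed

end

section \<open>Jucys-Murphy eigenvectors in representations\<close>

locale sym_rep = vector_space scale
  for scale :: "complex \<Rightarrow> 'v::ab_group_add \<Rightarrow> 'v" +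
  fixes n :: nat and \<rho> :: "(nat \<Rightarrow> nat) \<Rightarrow> 'v \<Rightarrow> 'v"
  assumes rep: "Defs.representation n scale \<rho>"
begin

lemma rho_linear: "g \<in> Sym n \<Longrightarrow> Vector_Spaces.linear scale scale (\<rho> g)"
  using rep by (simp add: Defs.representation_def)

lemma rho_add: "g \<in> Sym n \<Longrightarrow> \<rho> g (x + y) = \<rho> g x + \<rho> g y"
  and rho_scale: "g \<in> Sym n \<Longrightarrow> \<rho> g (scale c x) = scale c (\<rho> g x)"
  using rho_linear by (simp_all add: Vector_Spaces.linear_iff)

lemma rho_0: "g \<in> Sym n \<Longrightarrow> \<rho> g 0 = 0"
  using rho_scale[of g 0 0] by simp

lemma rho_diff: "g \<in> Sym n \<Longrightarrow> \<rho> g (x - y) = \<rho> g x - \<rho> g y"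
  using rho_add[of g "x - y" y] by (simp add: algebra_simps)

lemma rho_sum: "g \<in> Sym n \<Longrightarrow> \<rho> g (\<Sum>i\<in>I. f i) = (\<Sum>i\<in>I. \<rho> g (f i))"
  by (induction I rule: infinite_finite_induct) (auto simp: rho_0 rho_add)

lemma rho_comp: "g \<in> Sym n \<Longrightarrow> h \<in> Sym n \<Longrightarrow> \<rho> g (\<rho> h x) = \<rho> (g \<circ> h) x"
  using rep by (simp add: Defs.representation_def)

lemma rho_id: "\<rho> id x = x"
  using rep by (simp add: Defs.representation_def)

abbreviation X :: "nat \<Rightarrow> 'v \<Rightarrow> 'v" where
  "X p x \<equiv> jucys_murphy \<rho> p x"

lemma transpose_Sym: "a \<in> {1..n} \<Longrightarrow> b \<in> {1..n} \<Longrightarrow> Transposition.transpose a b \<in> Sym n"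
  by (simp add: Sym_def permutes_swap_id)

lemma adj_Sym: "1 \<le> k \<Longrightarrow> k < n \<Longrightarrow> adj k \<in> Sym n"
  by (rule transpose_Sym) auto

lemma rho_adj_sq: "1 \<le> k \<Longrightarrow> k < n \<Longrightarrow> \<rho> (adj k) (\<rho> (adj k) x) = x"
  by (simp add: rho_comp adj_Sym rho_id)

lemma X_diff: "p \<in> {1..n} \<Longrightarrow> X p (x - y) = X p x - X p y"
  unfolding jucys_murphy_def by (simp add: rho_diff transpose_Sym sum_subtractf)

lemma X_scale: "p \<in> {1..n} \<Longrightarrow> X p (scale c x) = scale c (X p x)"
  unfolding jucys_murphy_def by (simp add: rho_scale transpose_Sym scale_sum_right)

lemma rho_transpose_adj:
  assumes "1 \<le> k" "k < n" "a \<in> {1..n}" "b \<in> {1..n}"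
  shows "\<rho> (Transposition.transpose a b) (\<rho> (adj k) x) = \<rho> (adj k) (\<rho> (Transposition.transpose (adj k a) (adj k b)) x)"
proof -
  have e: "Transposition.transpose a b \<circ> adj k = adj k \<circ> Transposition.transpose (adj k a) (adj k b)"
    by (auto simp: fun_eq_iff transpose_def)
  have "adj k a \<in> {1..n}" "adj k b \<in> {1..n}"
    using assms permutes_in_image[OF adj_permutes[OF assms(1,2)]] by blast+
  then show ?thesis
    using assms by (simp add: rho_comp adj_Sym transpose_Sym e)
qed

text \<open>Relations of the degenerate affine Hecke algebra, consequences of X (k+1) = s_k X k s_k
  + s_k.\<close>

lemma X_adj:
  assumes "1 \<le> k" "k < n" "p \<in> {1..n}"
  shows "p \<noteq> k \<Longrightarrow> p \<noteq> Suc k \<Longrightarrow> X p (\<rho> (adj k) x) = \<rho> (adj k) (X p x)"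
    and "X (Suc k) (\<rho> (adj k) x) = \<rho> (adj k) (X k x) + x"
    and "X k (\<rho> (adj k) x) = \<rho> (adj k) (X (Suc k) x) - x"
proof -
  note s = adj_Sym[OF assms(1,2)]
  { assume p: "p \<noteq> k" "p \<noteq> Suc k"
    have perm: "adj k permutes {1..<p}" if "k < p"
      using that p assms(1) by (intro permutes_swap_id) auto
    have "X p (\<rho> (adj k) x) = (\<Sum>q\<in>{1..<p}. \<rho> (adj k) (\<rho> (Transposition.transpose (adj k q) p) x))"
      unfolding jucys_murphy_def
      using assms p by (intro sum.cong refl) (subst rho_transpose_adj, auto)
    also have "\<dots> = (\<Sum>q\<in>{1..<p}. \<rho> (adj k) (\<rho> (Transposition.transpose q p) x))"
    proof (cases "k < p")
      case True
      show ?thesis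
        using sum.permute[OF perm[OF True], of "\<lambda>q. \<rho> (adj k) (\<rho> (Transposition.transpose q p) x)"]
        by (simp add: o_def)
    next
      case False
      then show ?thesis using p by (intro sum.cong) (auto simp: transpose_def)
    qed
    finally show "X p (\<rho> (adj k) x) = \<rho> (adj k) (X p x)"
      by (simp add: jucys_murphy_def rho_sum s) }
  have a: "(\<Sum>q\<in>{1..<k}. \<rho> (Transposition.transpose q (Suc k)) (\<rho> (adj k) x)) = \<rho> (adj k) (X k x)" for x
    unfolding jucys_murphy_def rho_sum[OF s] using assms
    by (intro sum.cong refl) (subst rho_transpose_adj, auto)
  have ins: "{1..<Suc k} = insert k {1..<k}" using assms by auto
  have b: "X (Suc k) x = \<rho> (adj k) x + (\<Sum>q\<in>{1..<k}. \<rho> (Transposition.transpose q (Suc k)) x)" for x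
    unfolding jucys_murphy_def ins by simp
  show c: "X (Suc k) (\<rho> (adj k) x) = \<rho> (adj k) (X k x) + x" for x
    unfolding b a using rho_adj_sq[OF assms(1,2)] by (simp add: add.commute)
  have "\<rho> (adj k) (X (Suc k) x) = X k (\<rho> (adj k) x) + x"
    using arg_cong[OF c[of "\<rho> (adj k) x"], of "\<rho> (adj k)"] rho_adj_sq[OF assms(1,2)]
    by (simp add: rho_add s)
  then show "X k (\<rho> (adj k) x) = \<rho> (adj k) (X (Suc k) x) - x" by simp
qed

definition weight :: "(nat \<Rightarrow> nat \<times> nat) \<Rightarrow> 'v \<Rightarrow> bool" where
  "weight b x \<longleftrightarrow> (\<forall>p\<in>{1..n}. X p x = scale (of_int (ct b p)) x)"

text \<open>Normalised to have coefficient 1 at the transposition, as in the seminormal form, so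
  that no square roots enter.\<close>

definition intertwine :: "nat \<Rightarrow> int \<Rightarrow> 'v \<Rightarrow> 'v" where
  "intertwine k d x = \<rho> (adj k) x - scale (1 / of_int d) x"

text \<open>Commuting X k or X (k+1) past the transposition leaves an extra x; subtracting x / d
  with d the content difference is what makes the multiples of x match.\<close>

lemma weight_intertwine:
  assumes "weight b x" "1 \<le> k" "k < n" "ct b (Suc k) - ct b k = d" "d \<noteq> 0"
  shows "weight (b \<circ> adj k) (intertwine k d x)"
  unfolding weight_def
proof
  fix p assume p: "p \<in> {1..n}"
  note s = adj_Sym[OF assms(2,3)]
  have kn: "k \<in> {1..n}" "Suc k \<in> {1..n}" using assms by auto
  define c where "c p = (of_int (ct b p) :: complex)" for p
  define e where "e = (of_int d :: complex)"
  have e: "e \<noteq> 0" "c (Suc k) = c k + e"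
    using assms(4,5) by (auto simp: e_def c_def simp flip: of_int_add)
  have w: "X q x = scale (c q) x" if "q \<in> {1..n}" for q
    using assms(1) that by (simp add: weight_def c_def)
  consider "p = k" | "p = Suc k" | "p \<noteq> k" "p \<noteq> Suc k" by blast
  then show "X p (intertwine k d x) = scale (of_int (ct (b \<circ> adj k) p)) (intertwine k d x)"
    unfolding ct_comp c_def[symmetric] intertwine_def e_def[symmetric]
  proof cases
    case 1
    have "X p (\<rho> (adj k) x - scale (1 / e) x) = scale (c (Suc k)) (\<rho> (adj k) x) - x - scale (1 / e * c k) x"
      using X_adj(3)[OF assms(2,3) p] w[OF kn(1)] w[OF kn(2)] p 1
      by (simp add: X_diff X_scale rho_scale s)
    also have "\<dots> = scale (c (Suc k)) (\<rho> (adj k) x) - scale (1 + 1 / e * c k) x"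
      by (simp add: scale_left_distrib)
    also have "1 + 1 / e * c k = c (Suc k) * (1 / e)"
      using e by (simp add: field_simps)
    finally show "X p (\<rho> (adj k) x - scale (1 / e) x) = scale (c (adj k p)) (\<rho> (adj k) x - scale (1 / e) x)"
      using 1 by (simp add: scale_right_diff_distrib)
  next
    case 2
    have "X p (\<rho> (adj k) x - scale (1 / e) x) = scale (c k) (\<rho> (adj k) x) + x - scale (1 / e * c (Suc k)) x"
      using X_adj(2)[OF assms(2,3) p] w[OF kn(1)] w[OF kn(2)] p 2
      by (simp add: X_diff X_scale rho_scale s)
    also have "\<dots> = scale (c k) (\<rho> (adj k) x) - scale (1 / e * c (Suc k) - 1) x"
      by (simp add: scale_left_diff_distrib)
    also have "1 / e * c (Suc k) - 1 = c k * (1 / e)"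
      using e by (simp add: field_simps)
    finally show "X p (\<rho> (adj k) x - scale (1 / e) x) = scale (c (adj k p)) (\<rho> (adj k) x - scale (1 / e) x)"
      using 2 by (simp add: scale_right_diff_distrib)
  next
    case 3
    then show "X p (\<rho> (adj k) x - scale (1 / e) x) = scale (c (adj k p)) (\<rho> (adj k) x - scale (1 / e) x)"
      using X_adj(1)[OF assms(2,3) p] w[OF p] p
      by (simp add: X_diff X_scale rho_scale s scale_right_diff_distrib mult.commute)
  qed
qed

end

section \<open>Left multiplication on the group algebra\<close>

lemma galg_representation: "representation n (\<lambda>c x. scl c * x) (\<lambda>g x. sg g * x)"
proof -
  have v: "vector_space (\<lambda>c (x :: galg). scl c * x)"
    by standard (simp_all add: distrib_left distrib_right scl_add)
  have "sg (g \<circ> h) = sg g * sg h" if "g \<in> Sym n" "h \<in> Sym n" for g h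
    using sg_comp[of g "{1..n}" h "{1..n}"] that by (simp add: Sym_def)
  then show ?thesis
    using v by (auto simp: Defs.representation_def Vector_Spaces.linear_iff distrib_left scl_move_left sg_id fun_eq_iff mult.assoc)
qed

lemma galg_jucys_murphy: "jucys_murphy (\<lambda>g x. sg g * x) p a = jm (p - 1) p * a"
proof -
  have "{1..p - 1} = {1..<p}" by auto
  then show ?thesis by (simp add: jucys_murphy_def jm_def sum_distrib_right)
qed

lemma sym_rep_galg: "sym_rep (\<lambda>c x. scl c * x) n (\<lambda>g x. sg g * x)"
  using galg_representation[of n] unfolding sym_rep_def sym_rep_axioms_def
  by (auto simp: Defs.representation_def)

interpretation galg: sym_rep "\<lambda>c x. scl c * x" n "\<lambda>g x. sg g * x" for n
  by (rule sym_rep_galg)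

lemma galg_weight: "galg.weight n b E \<longleftrightarrow> (\<forall>p\<in>{1..n}. jm (p - 1) p * E = scl (of_int (ct b p)) * E)"
  by (simp add: galg.weight_def galg_jucys_murphy)

section \<open>From the hook-ordered tableau to all tableaux of the shape\<close>

context regval
begin

text \<open>Multiplying \<open>fus_swap\<close> on the right by the factor with exchanged parameters
  gives a scalar times \<open>fus (x z) n\<close> on one side and a product of functions with known
  values on the other.\<close>

lemma fus_value_adj:
  assumes g: "growth b n" "growth (b \<circ> adj k) n" and k: "1 \<le> k" "k < n"
    and x: "\<And>p. p \<in> {1..n} \<Longrightarrow> sv (\<lambda>z. x z p) (t + of_int (ct b p))"
    and inj: "\<And>z. z \<in> U \<Longrightarrow> inj_on (x z) {1..n}"
    and E': "gv (\<lambda>z. fus (x z \<circ> adj k) n) E'" "galg.weight n (b \<circ> adj k) E'"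
  shows "\<exists>E. gv (\<lambda>z. fus (x z) n) E \<and> galg.weight n b E"
proof -
  let ?l = "Suc k" and ?s = "tr k (Suc k)"
  let ?a = "t + of_int (ct b k)" and ?b = "t + of_int (ct b ?l)"
  have kn: "k \<in> {1..n}" "?l \<in> {1..n}" using k by auto
  have ne: "x z k \<noteq> x z ?l" if "z \<in> U" for z
    using inj_onD[OF inj[OF that] _ kn] by auto
  have d2: "\<bar>ct b ?l - ct b k\<bar> \<ge> 2" by (rule growth_adj_far[OF g k])
  then have ab: "?a \<noteq> ?b" by auto
  let ?R = "rmat k ?l ?a ?b"
  let ?X = "?R * (?s * E' * ?s) * ?R"
  \<comment> \<open>The scalar of \<open>rmat_inverse\<close>. It may vanish on U, but its value
    does not, as the contents differ by at least 2.\<close>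
  define \<kappa> where "\<kappa> z = 1 - 1 / (x z ?l - x z k) * (1 / (x z ?l - x z k))" for z
  define \<kappa>0 where "\<kappa>0 = 1 - 1 / (?b - ?a) * (1 / (?b - ?a))"
  have sv\<kappa>: "sv \<kappa> \<kappa>0"
    unfolding \<kappa>_def[abs_def] \<kappa>0_def using x[OF kn(1)] x[OF kn(2)] ab ne
    by (intro sv_diff sv_const sv_mult sv_inverse_diff) fastforce+
  have "\<kappa>0 \<noteq> 0"
  proof
    assume "\<kappa>0 = 0"
    moreover have "?b - ?a \<noteq> 0" using ab by simp
    ultimately have "(?b - ?a) * (?b - ?a) = 1"
      unfolding \<kappa>0_def by (simp add: field_simps)
    then have "(of_int ((ct b ?l - ct b k) * (ct b ?l - ct b k)) :: complex) = of_int 1"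
      by simp
    then have "(ct b ?l - ct b k) * (ct b ?l - ct b k) = 1" by (simp only: of_int_eq_iff)
    then show False using d2 by (auto simp: zmult_eq_1_iff)
  qed
  have gX: "gv (\<lambda>z. rmat k ?l (x z k) (x z ?l) * (?s * fus (x z \<circ> adj k) n * ?s) * rmat k ?l (x z k) (x z ?l)) ?X"
    using x[OF kn(1)] x[OF kn(2)] ab ne by (intro gv_mult gv_const E'(1) gv_rmat) auto
  have "gv (\<lambda>z. fus (x z) n) (scl (1 / \<kappa>0) * ?X)"
  proof (rule gv_divide[OF gX sv\<kappa> \<open>\<kappa>0 \<noteq> 0\<close> _ finite_perm_fixing[of n]])
    fix z assume z: "z \<in> U"
    show "Poly_Mapping.keys (fus (x z) n) \<subseteq> {g. \<forall>j. j \<notin> {1..n} \<longrightarrow> Perm.apply g j = j}"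
      using keys_fus by blast
    have "scl (\<kappa> z) * fus (x z) n = fus (x z) n * (rmat k ?l (x z ?l) (x z k) * rmat k ?l (x z k) (x z ?l))"
      using rmat_inverse[of "x z ?l" "x z k" k ?l] ne[OF z]
      by (simp add: \<kappa>_def power2_eq_square scl_move)
    also have "\<dots> = rmat k ?l (x z k) (x z ?l) * (?s * fus (x z \<circ> adj k) n * ?s) * rmat k ?l (x z k) (x z ?l)"
      using fus_swap[OF inj[OF z] refl k(1)] k(2) by (simp flip: mult.assoc)
    finally show "scl (\<kappa> z) * fus (x z) n = \<dots>" .
  qed
  moreover have "galg.weight n b (scl (1 / \<kappa>0) * ?X)"
  proof -
    let ?y = "galg.intertwine k (ct b k - ct b ?l) E'"
    have "galg.weight n ((b \<circ> adj k) \<circ> adj k) ?y"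
      using d2 by (intro galg.weight_intertwine E'(2) k) (auto simp: ct_comp)
    moreover have "(b \<circ> adj k) \<circ> adj k = b" by (simp add: fun_eq_iff)
    ultimately have y: "galg.weight n b ?y" by simp
    \<comment> \<open>The factor times the transposition is the intertwiner, which changes the
      weight from b \<circ> adj k to b.\<close>
    have "?R * ?s * E' = ?y"
      unfolding galg.intertwine_def rmat_def by (simp add: galg_simps)
    then have e: "scl (1 / \<kappa>0) * ?X = scl (1 / \<kappa>0) * (?y * (?s * ?R))"
      by (simp flip: mult.assoc)
    show ?thesis
      using y unfolding galg_weight e
      by (simp add: scl_move_left) (simp flip: mult.assoc)
  qed
  ultimately show ?thesis by blast
qed

text \<open>Start at the hook-ordered rearrangement and undo descents until \<sigma> = id; every
  intermediate sequence is a growth sequence by \<open>growth_descent\<close>.\<close>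

lemma fus_value:
  assumes g: "growth b n"
    and x: "\<And>p. p \<in> {1..n} \<Longrightarrow> sv (\<lambda>z. x z p) (t + of_int (ct b p))"
    and inj: "\<And>z. z \<in> U \<Longrightarrow> inj_on (x z) {1..n}"
    and hk: "\<And>z p q. z \<in> U \<Longrightarrow> p \<in> {1..n} \<Longrightarrow> q \<in> {1..n} \<Longrightarrow> hook (b p) = hook (b q) \<Longrightarrow>
      x z p - x z q = of_int (ct b p - ct b q)"
  shows "\<exists>E. gv (\<lambda>z. fus (x z) n) E \<and> galg.weight n b E"
proof -
  let ?P = "\<lambda>\<sigma>. \<exists>E. gv (\<lambda>z. fus (x z \<circ> \<sigma>) n) E \<and> galg.weight n (b \<circ> \<sigma>) E"
  have x': "sv (\<lambda>z. (x z \<circ> \<sigma>) p) (t + of_int (ct (b \<circ> \<sigma>) p))"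
    if "\<sigma> permutes {1..n}" "p \<in> {1..n}" for \<sigma> p
    using x[of "\<sigma> p"] permutes_in_image[OF that(1)] that(2) by (simp add: ct_comp)
  have inj': "inj_on (x z \<circ> \<sigma>) {1..n}" if "\<sigma> permutes {1..n}" "z \<in> U" for \<sigma> z
    using inj[OF that(2)] permutes_image[OF that(1)] permutes_inj_on[OF that(1)]
    by (simp add: comp_inj_on)
  obtain \<sigma> where \<sigma>: "\<sigma> permutes {1..n}" "growth (b \<circ> \<sigma>) n"
    and ord: "\<And>p N. 1 \<le> p \<Longrightarrow> p < N \<Longrightarrow> N \<le> n \<Longrightarrow> ct (b \<circ> \<sigma>) p = ct (b \<circ> \<sigma>) N \<Longrightarrow>
      Suc p < N \<and> \<bar>ct (b \<circ> \<sigma>) (Suc p) - ct (b \<circ> \<sigma>) p\<bar> = 1 \<and> hook ((b \<circ> \<sigma>) (Suc p)) = hook ((b \<circ> \<sigma>) p)"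
    using hook_order[OF g] by blast
  have hk': "(x z \<circ> \<sigma>) p - (x z \<circ> \<sigma>) q = of_int (ct (b \<circ> \<sigma>) p - ct (b \<circ> \<sigma>) q)"
    if "z \<in> U" "p \<in> {1..n}" "q \<in> {1..n}" "hook ((b \<circ> \<sigma>) p) = hook ((b \<circ> \<sigma>) q)" for z p q
    using hk[of z "\<sigma> p" "\<sigma> q"] permutes_in_image[OF \<sigma>(1)] that by (simp add: ct_comp)
  have "?P \<sigma>"
    using fus_value_hook_order[where x = "\<lambda>z. x z \<circ> \<sigma>", OF \<sigma>(2) ord x'[OF \<sigma>(1)] inj'[OF \<sigma>(1)] hk' order_refl]
    unfolding galg_weight by blast
  then have "?P id"
    using \<sigma>
  proof (induction "disorder n \<sigma>" arbitrary: \<sigma> rule: less_induct)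
    case less
    show ?case
    proof (cases "\<sigma> = id")
      case True
      then show ?thesis using less.prems(1) by simp
    next
      case False
      then obtain k where k: "1 \<le> k" "k < n" "\<sigma> (Suc k) < \<sigma> k"
        using descent_exists[OF less.prems(2)] by blast
      let ?\<tau> = "\<sigma> \<circ> adj k"
      have e: "?\<tau> \<circ> adj k = \<sigma>" by (simp add: fun_eq_iff)
      have \<tau>: "?\<tau> permutes {1..n}" "growth (b \<circ> ?\<tau>) n"
        using permutes_compose[OF adj_permutes[OF k(1,2)] less.prems(2)]
          growth_descent[OF g less.prems(2,3) k] by auto
      have g2: "growth (b \<circ> ?\<tau> \<circ> adj k) n" using less.prems(3) e by (simp add: comp_assoc)
      obtain E' where E': "gv (\<lambda>z. fus (x z \<circ> ?\<tau> \<circ> adj k) n) E'" "galg.weight n (b \<circ> ?\<tau> \<circ> adj k) E'"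
        using less.prems(1) e by (auto simp: comp_assoc)
      have "?P ?\<tau>"
        by (rule fus_value_adj[OF \<tau>(2) g2 k(1,2) x'[OF \<tau>(1)] inj'[OF \<tau>(1)] E'])
      then show ?thesis
        by (rule less.hyps[OF disorder_descent[OF k] _ \<tau>])
    qed
  qed
  then show ?thesis by simp
qed

end

section \<open>Young's seminormal form\<close>

text \<open>The coefficient of w_\<sigma> in s_k w_\<sigma>, for the vectors called
  \<open>wvec\<close> below; \<open>beta\<close> is the coefficient of the vector at \<sigma>
  \<circ> adj k.\<close>

definition alpha :: "(nat \<Rightarrow> nat \<times> nat) \<Rightarrow> nat \<Rightarrow> (nat \<Rightarrow> nat) \<Rightarrow> real" where
  "alpha b k \<sigma> = 1 / of_int (ct b (\<sigma> (Suc k)) - ct b (\<sigma> k))"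

definition beta :: "(nat \<Rightarrow> nat \<times> nat) \<Rightarrow> nat \<Rightarrow> nat \<Rightarrow> (nat \<Rightarrow> nat) \<Rightarrow> real" where
  "beta b n k \<sigma> = (if growth (b \<circ> \<sigma>) n then if \<sigma> k < \<sigma> (Suc k) then 1 else 1 - (alpha b k \<sigma>)\<^sup>2 else 0)"

text \<open>The coefficient of w_\<sigma> after a word in the adjacent transpositions is applied to
  w. It depends on b, n and the word alone, which makes it possible to compare two
  representations.\<close>

fun word_coef :: "(nat \<Rightarrow> nat \<times> nat) \<Rightarrow> nat \<Rightarrow> nat list \<Rightarrow> (nat \<Rightarrow> nat) \<Rightarrow> real" where
  "word_coef b n [] \<sigma> = (if \<sigma> = id then 1 else 0)"
| "word_coef b n (k # ks) \<sigma> = alpha b k \<sigma> * word_coef b n ks \<sigma> +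
     beta b n k (\<sigma> \<circ> adj k) * word_coef b n ks (\<sigma> \<circ> adj k)"

fun word_perm :: "nat list \<Rightarrow> nat \<Rightarrow> nat" where
  "word_perm [] = id"
| "word_perm (k # ks) = adj k \<circ> word_perm ks"

lemma adj_adj: "\<sigma> \<circ> adj k \<circ> adj k = \<sigma>"
  by (simp add: fun_eq_iff)

lemma id_Sym: "id \<in> Sym n"
  unfolding Sym_def by (intro CollectI permutes_id)

lemma Sym_adj: "\<sigma> \<in> Sym n \<Longrightarrow> 1 \<le> k \<Longrightarrow> k < n \<Longrightarrow> \<sigma> \<circ> adj k \<in> Sym n"
  using permutes_compose[OF adj_permutes] by (simp add: Sym_def)

text \<open>Sorting multiplies \<sigma> on the right by adjacent transpositions, so the word that is
  found belongs to the inverse.\<close>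

lemma word_perm_exists:
  assumes "\<sigma> \<in> Sym n"
  shows "\<exists>ks. set ks \<subseteq> {1..<n} \<and> word_perm ks = inv \<sigma>"
  using assms
proof (induction "disorder n \<sigma>" arbitrary: \<sigma> rule: less_induct)
  case less
  show ?case
  proof (cases "\<sigma> = id")
    case True
    then show ?thesis by (intro exI[of _ "[]"]) simp
  next
    case False
    then obtain k where k: "1 \<le> k" "k < n" "\<sigma> (Suc k) < \<sigma> k"
      using descent_exists[of \<sigma> n] less.prems unfolding Sym_def by blast
    obtain ks where ks: "set ks \<subseteq> {1..<n}" "word_perm ks = inv (\<sigma> \<circ> adj k)"
      using less.hyps[OF disorder_descent[OF k] Sym_adj[OF less.prems k(1,2)]] by blast
    have "bij \<sigma>" using less.prems by (simp add: Sym_def permutes_bij)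
    then have "inv (\<sigma> \<circ> adj k) = adj k \<circ> inv \<sigma>" by (simp add: o_inv_distrib)
    then have "word_perm (k # ks) = inv \<sigma>" using ks(2) by (simp add: fun_eq_iff)
    then show ?thesis using ks(1) k by (intro exI[of _ "k # ks"]) auto
  qed
qed

lemma word_perm_Sym: "set ks \<subseteq> {1..<n} \<Longrightarrow> word_perm ks \<in> Sym n"
proof (induction ks)
  case (Cons k ks)
  then have "word_perm ks permutes {1..n}" "1 \<le> k" "k < n" by (auto simp: Sym_def)
  then show ?case
    unfolding word_perm.simps Sym_def by (intro CollectI permutes_compose adj_permutes)
qed (simp add: id_Sym)

context sym_rep
begin

lemma intertwine_commute:
  assumes "1 \<le> j" "j < n" "1 \<le> k" "k < n" "Suc j < k"
  shows "intertwine j d (intertwine k e x) = intertwine k e (intertwine j d x)"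
proof -
  have "adj j \<circ> adj k = adj k \<circ> adj j"
    using assms by (auto simp: fun_eq_iff transpose_def)
  then have c: "\<rho> (adj j) (\<rho> (adj k) x) = \<rho> (adj k) (\<rho> (adj j) x)"
    using assms by (simp add: rho_comp adj_Sym)
  show ?thesis
    unfolding intertwine_def using assms
    by (simp add: rho_diff rho_scale adj_Sym c scale_right_diff_distrib algebra_simps)
qed

text \<open>The Yang-Baxter equation for operators; it rests on the same partial fraction identity
  and on the braid relation.\<close>

lemma intertwine_braid:
  assumes "1 \<le> j" "Suc j < n" "d \<noteq> 0" "e \<noteq> 0" "d + e \<noteq> 0"
  shows "intertwine j d (intertwine (Suc j) (d + e) (intertwine j e x)) =
    intertwine (Suc j) e (intertwine j (d + e) (intertwine (Suc j) d x))"
proof -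
  define \<alpha> \<beta> \<gamma> where "\<alpha> = 1 / (of_int d :: complex)" and "\<beta> = 1 / (of_int (d + e) :: complex)"
    and "\<gamma> = 1 / (of_int e :: complex)"
  have nz: "(of_int d :: complex) \<noteq> 0" "(of_int e :: complex) \<noteq> 0" "(of_int d + of_int e :: complex) \<noteq> 0"
    using assms(3-5) by (auto simp flip: of_int_add)
  have "\<beta> * \<alpha> + \<beta> * \<gamma> = \<beta> * ((of_int d + of_int e) / (of_int d * of_int e))"
    using nz by (simp add: \<alpha>_def \<gamma>_def add_divide_distrib distrib_left)
  then have e: "\<alpha> * \<gamma> = \<beta> * \<alpha> + \<beta> * \<gamma>"
    using nz by (simp add: \<alpha>_def \<beta>_def \<gamma>_def)
  let ?S = "\<rho> (adj j)" and ?T = "\<rho> (adj (Suc j))"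
  have jn: "j < n" "1 \<le> Suc j" using assms(2) by auto
  note Sy = adj_Sym[OF assms(1) jn(1)] adj_Sym[OF jn(2) assms(2)]
  have "adj j \<circ> (adj (Suc j) \<circ> adj j) = adj (Suc j) \<circ> (adj j \<circ> adj (Suc j))"
    by (auto simp: fun_eq_iff transpose_def)
  moreover have "adj (Suc j) \<circ> adj j \<in> Sym n" "adj j \<circ> adj (Suc j) \<in> Sym n"
    using Sy assms(1,2) by (auto intro: Sym_adj)
  ultimately have br: "?S (?T (?S x)) = ?T (?S (?T x))"
    using Sy by (simp add: rho_comp)
  have sq: "?S (?S y) = y" "?T (?T y) = y" for y
    using rho_adj_sq[OF assms(1) jn(1)] rho_adj_sq[OF jn(2) assms(2)] by auto
  have l: "intertwine j d (intertwine (Suc j) (d + e) (intertwine j e x)) =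
    ?S (?T (?S x)) - scale \<gamma> (?S (?T x)) - scale \<beta> x + scale (\<beta> * \<gamma>) (?S x) - scale \<alpha> (?T (?S x))
    + scale (\<alpha> * \<gamma>) (?T x) + scale (\<beta> * \<alpha>) (?S x) - scale (\<alpha> * \<beta> * \<gamma>) x"
    unfolding intertwine_def \<alpha>_def[symmetric] \<beta>_def[symmetric] \<gamma>_def[symmetric]
    by (simp add: rho_diff rho_scale Sy sq scale_right_diff_distrib mult.assoc mult.commute mult.left_commute)
  have r: "intertwine (Suc j) e (intertwine j (d + e) (intertwine (Suc j) d x)) =
    ?T (?S (?T x)) - scale \<alpha> (?T (?S x)) - scale \<beta> x + scale (\<beta> * \<alpha>) (?T x) - scale \<gamma> (?S (?T x))
    + scale (\<alpha> * \<gamma>) (?S x) + scale (\<beta> * \<gamma>) (?T x) - scale (\<alpha> * \<beta> * \<gamma>) x"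
    unfolding intertwine_def \<alpha>_def[symmetric] \<beta>_def[symmetric] \<gamma>_def[symmetric]
    by (simp add: rho_diff rho_scale Sy sq scale_right_diff_distrib mult.assoc mult.commute mult.left_commute)
  show ?thesis
    unfolding l r br e scale_left_distrib by simp
qed

text \<open>\<open>reach b w \<sigma> y\<close> means that \<open>y\<close>, of weight \<open>b \<circ> \<sigma>\<close>, arises from \<open>w\<close>, of weight \<open>b\<close>, along an ascending
  path in the weak order. Uniqueness of \<open>y\<close> follows from the commutation and braid relations as in Newman's lemma.\<close>

inductive reach :: "(nat \<Rightarrow> nat \<times> nat) \<Rightarrow> 'v \<Rightarrow> (nat \<Rightarrow> nat) \<Rightarrow> 'v \<Rightarrow> bool" for b w where
  start: "reach b w id w"
| step: "reach b w \<sigma> y \<Longrightarrow> 1 \<le> k \<Longrightarrow> k < n \<Longrightarrow> \<sigma> k < \<sigma> (Suc k) \<Longrightarrow> growth (b \<circ> (\<sigma> \<circ> adj k)) n \<Longrightarrow>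
    reach b w (\<sigma> \<circ> adj k) (intertwine k (ct b (\<sigma> (Suc k)) - ct b (\<sigma> k)) y)"

context
  fixes b :: "nat \<Rightarrow> nat \<times> nat" and w :: 'v
  assumes g: "growth b n" and w: "weight b w"
begin

lemma reach_weight:
  assumes "reach b w \<sigma> y"
  shows "\<sigma> \<in> Sym n \<and> growth (b \<circ> \<sigma>) n \<and> weight (b \<circ> \<sigma>) y"
  using assms
proof induction
  case start
  then show ?case using g w by (simp only: id_Sym comp_id simp_thms)
next
  case (step \<sigma> y k)
  note b = step.IH[THEN conjunct2, THEN conjunct1] step.IH[THEN conjunct2, THEN conjunct2]
    step.IH[THEN conjunct1]
  have c: "growth (b \<circ> \<sigma> \<circ> adj k) n" using step.hyps(5) by (simp only: comp_assoc)
  have nz: "ct b (\<sigma> (Suc k)) - ct b (\<sigma> k) \<noteq> 0"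
    using growth_adj_far[OF b(1) c step.hyps(2,3)] by (auto simp: ct_comp)
  have "weight (b \<circ> \<sigma> \<circ> adj k) (intertwine k (ct b (\<sigma> (Suc k)) - ct b (\<sigma> k)) y)"
    by (rule weight_intertwine[OF b(2) step.hyps(2,3) _ nz]) (simp only: ct_comp)
  then show ?case
    using step.hyps(5) Sym_adj[OF b(3) step.hyps(2,3)] by (simp only: comp_assoc simp_thms)
qed

lemma descent_valid:
  assumes "\<sigma> \<in> Sym n" "growth (b \<circ> \<sigma>) n" "1 \<le> k" "k < n" "\<sigma> (Suc k) < \<sigma> k"
  shows "\<sigma> \<circ> adj k \<in> Sym n" "growth (b \<circ> (\<sigma> \<circ> adj k)) n"
  using growth_descent[OF g _ assms(2-5)] Sym_adj[OF assms(1,3,4)] assms(1) by (auto simp: Sym_def)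

lemma reach_up:
  assumes "growth (b \<circ> \<sigma>) n" "1 \<le> k" "k < n" "\<sigma> (Suc k) < \<sigma> k" "reach b w (\<sigma> \<circ> adj k) y"
  shows "reach b w \<sigma> (intertwine k (ct b (\<sigma> k) - ct b (\<sigma> (Suc k))) y)"
proof -
  have "reach b w (\<sigma> \<circ> adj k \<circ> adj k)
      (intertwine k (ct b ((\<sigma> \<circ> adj k) (Suc k)) - ct b ((\<sigma> \<circ> adj k) k)) y)"
    by (rule reach.step) (use assms in \<open>auto simp: comp_assoc\<close>)
  then show ?thesis by (simp add: adj_adj)
qed

lemma reach_last:
  assumes "reach b w \<sigma> y"
  shows "\<sigma> = id \<and> y = w \<or> (\<exists>k y'. 1 \<le> k \<and> k < n \<and> \<sigma> (Suc k) < \<sigma> k \<and> reach b w (\<sigma> \<circ> adj k) y' \<and>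
    y = intertwine k (ct b (\<sigma> k) - ct b (\<sigma> (Suc k))) y')"
  using assms
proof cases
  case (step \<tau> y' k)
  then show ?thesis
    by (intro disjI2 exI[of _ k] exI[of _ y']) (simp add: adj_adj)
qed simp

lemma reach_exists:
  assumes "\<sigma> \<in> Sym n" "growth (b \<circ> \<sigma>) n"
  shows "\<exists>y. reach b w \<sigma> y"
  using assms
proof (induction "disorder n \<sigma>" arbitrary: \<sigma> rule: less_induct)
  case less
  show ?case
  proof (cases "\<sigma> = id")
    case True
    then show ?thesis using start by blast
  next
    case False
    then obtain k where k: "1 \<le> k" "k < n" "\<sigma> (Suc k) < \<sigma> k"
      using descent_exists[of \<sigma> n] less.prems unfolding Sym_def by blast
    show ?thesis
      using less.hyps[OF disorder_descent[OF k] descent_valid[OF less.prems k]]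
        reach_up[OF less.prems(2) k] by blast
  qed
qed

lemma descent_gap:
  assumes "\<sigma> \<in> Sym n" "growth (b \<circ> \<sigma>) n" "1 \<le> k" "k < n" "\<sigma> (Suc k) < \<sigma> k"
  shows "\<bar>ct b (\<sigma> (Suc k)) - ct b (\<sigma> k)\<bar> \<ge> 2"
  using growth_adj_far[OF assms(2) _ assms(3,4)] descent_valid(2)[OF assms] by (simp add: comp_assoc ct_comp)

text \<open>Sort both descents, or all three positions if they overlap, and take a vector u reached
  there. The two ways up from u agree because distant intertwiners commute and neighbouring ones
  satisfy the braid relation.\<close>

lemma reach_diamond:
  assumes v: "\<sigma> \<in> Sym n" "growth (b \<circ> \<sigma>) n" and "j < k"
    and j: "1 \<le> j" "j < n" "\<sigma> (Suc j) < \<sigma> j" and k: "1 \<le> k" "k < n" "\<sigma> (Suc k) < \<sigma> k"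
  shows "\<exists>y1 y2. reach b w (\<sigma> \<circ> adj j) y1 \<and> reach b w (\<sigma> \<circ> adj k) y2 \<and>
    intertwine j (ct b (\<sigma> j) - ct b (\<sigma> (Suc j))) y1 = intertwine k (ct b (\<sigma> k) - ct b (\<sigma> (Suc k))) y2"
proof (cases "k = Suc j")
  case False
  with \<open>j < k\<close> have jk: "Suc j < k" by simp
  let ?j = "\<sigma> \<circ> adj j" and ?k = "\<sigma> \<circ> adj k"
  note vj = descent_valid[OF v j] and vk = descent_valid[OF v k]
  have jv: "?j k = \<sigma> k" "?j (Suc k) = \<sigma> (Suc k)" and kv: "?k j = \<sigma> j" "?k (Suc j) = \<sigma> (Suc j)"
    using jk by (auto simp: transpose_def)
  have c: "?k \<circ> adj j = ?j \<circ> adj k"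
    using jk by (auto simp: fun_eq_iff transpose_def)
  have dj: "?j (Suc k) < ?j k" and dk: "?k (Suc j) < ?k j" using j k jv kv by auto
  obtain u where u: "reach b w (?j \<circ> adj k) u"
    using reach_exists[OF descent_valid[OF vj k(1,2) dj]] by blast
  have 1: "reach b w ?j (intertwine k (ct b (\<sigma> k) - ct b (\<sigma> (Suc k))) u)"
    using reach_up[OF vj(2) k(1,2) dj u] unfolding jv .
  have 2: "reach b w ?k (intertwine j (ct b (\<sigma> j) - ct b (\<sigma> (Suc j))) u)"
    using reach_up[OF vk(2) j(1,2) dk] u unfolding kv c by blast
  show ?thesis
    using 1 2 intertwine_commute[OF j(1,2) k(1,2) jk] by blast
next
  case True
  let ?A = "ct b (\<sigma> j)" and ?B = "ct b (\<sigma> k)" and ?C = "ct b (\<sigma> (Suc k))"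
  let ?j = "\<sigma> \<circ> adj j" and ?k = "\<sigma> \<circ> adj k"
  let ?jk = "\<sigma> \<circ> adj j \<circ> adj k" and ?kj = "\<sigma> \<circ> adj k \<circ> adj j"
  note vj = descent_valid[OF v j] and vk = descent_valid[OF v k]
  have jv: "?j j = \<sigma> k" "?j k = \<sigma> j" "?j (Suc k) = \<sigma> (Suc k)"
    and kv: "?k j = \<sigma> j" "?k k = \<sigma> (Suc k)" "?k (Suc k) = \<sigma> k"
    and jkv: "?jk j = \<sigma> k" "?jk k = \<sigma> (Suc k)" "?jk (Suc k) = \<sigma> j"
    and kjv: "?kj j = \<sigma> (Suc k)" "?kj k = \<sigma> j" "?kj (Suc k) = \<sigma> k"
    by (auto simp: True transpose_def)
  have sj: "\<sigma> (Suc j) = \<sigma> k" "?k (Suc j) = \<sigma> (Suc k)" "?jk (Suc j) = \<sigma> (Suc k)"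
    by (auto simp: True transpose_def)
  have lt: "\<sigma> (Suc k) < \<sigma> k" "\<sigma> k < \<sigma> j" using j k sj by auto
  have d1: "?j (Suc k) < ?j k" and d2: "?k (Suc j) < ?k j"
    and d3: "?jk (Suc j) < ?jk j" and d4: "?kj (Suc k) < ?kj k"
    unfolding sj jv kv jkv kjv using lt by auto
  note vjk = descent_valid[OF vj k(1,2) d1] and vkj = descent_valid[OF vk j(1,2) d2]
  have c: "?kj \<circ> adj k = ?jk \<circ> adj j"
    unfolding True by (auto simp: fun_eq_iff transpose_def)
  obtain u where u: "reach b w (?jk \<circ> adj j) u"
    using reach_exists[OF descent_valid[OF vjk j(1,2) d3]] by blast
  have "reach b w ?jk (intertwine j (?B - ?C) u)"
    using reach_up[OF vjk(2) j(1,2) d3 u] unfolding sj jkv .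
  from reach_up[OF vj(2) k(1,2) d1 this]
  have 1: "reach b w ?j (intertwine k (?A - ?C) (intertwine j (?B - ?C) u))"
    unfolding jv .
  have "reach b w ?kj (intertwine k (?A - ?B) u)"
    using reach_up[OF vkj(2) k(1,2) d4] u unfolding c kjv by blast
  from reach_up[OF vk(2) j(1,2) d2 this]
  have 2: "reach b w ?k (intertwine j (?A - ?C) (intertwine k (?A - ?B) u))"
    unfolding sj kv .
  \<comment> \<open>Each of the three differences occurs at a descent of \<sigma> or of \<sigma>
    \<circ> adj j.\<close>
  have ne: "?A - ?B \<noteq> 0" "?B - ?C \<noteq> 0" "?A - ?B + (?B - ?C) \<noteq> 0"
    using descent_gap[OF v j] descent_gap[OF v k] descent_gap[OF vj k(1,2) d1]
    unfolding sj jv by auto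
  have "intertwine j (?A - ?B) (intertwine k (?A - ?C) (intertwine j (?B - ?C) u)) =
    intertwine k (?B - ?C) (intertwine j (?A - ?C) (intertwine k (?A - ?B) u))"
    using intertwine_braid[of j "?A - ?B" "?B - ?C" u] ne j k by (simp add: True)
  then show ?thesis
    unfolding sj using 1 2 by blast
qed

lemma reach_unique:
  assumes "reach b w \<sigma> y" "reach b w \<sigma> y'"
  shows "y = y'"
  using assms
proof (induction "disorder n \<sigma>" arbitrary: \<sigma> y y' rule: less_induct)
  case less
  note v = reach_weight[OF less.prems(1)]
  show ?case
  proof (cases "\<sigma> = id")
    case True
    then show ?thesis using reach_last[OF less.prems(1)] reach_last[OF less.prems(2)] by auto
  next
    case False
    have key: "intertwine j (ct b (\<sigma> j) - ct b (\<sigma> (Suc j))) y1 = intertwine k (ct b (\<sigma> k) - ct b (\<sigma> (Suc k))) y2"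
      if jk: "j < k" and j: "1 \<le> j" "j < n" "\<sigma> (Suc j) < \<sigma> j" "reach b w (\<sigma> \<circ> adj j) y1"
        and k: "1 \<le> k" "k < n" "\<sigma> (Suc k) < \<sigma> k" "reach b w (\<sigma> \<circ> adj k) y2" for j k y1 y2
    proof -
      obtain z1 z2 where z: "reach b w (\<sigma> \<circ> adj j) z1" "reach b w (\<sigma> \<circ> adj k) z2"
        "intertwine j (ct b (\<sigma> j) - ct b (\<sigma> (Suc j))) z1 = intertwine k (ct b (\<sigma> k) - ct b (\<sigma> (Suc k))) z2"
        using reach_diamond[OF _ _ jk j(1-3) k(1-3)] v by blast
      have "y1 = z1" "y2 = z2"
        using less.hyps[OF disorder_descent[OF j(1-3)] j(4) z(1)]
          less.hyps[OF disorder_descent[OF k(1-3)] k(4) z(2)] by auto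
      then show ?thesis using z(3) by simp
    qed
    obtain j y1 where j: "1 \<le> j" "j < n" "\<sigma> (Suc j) < \<sigma> j" "reach b w (\<sigma> \<circ> adj j) y1"
      "y = intertwine j (ct b (\<sigma> j) - ct b (\<sigma> (Suc j))) y1"
      using reach_last[OF less.prems(1)] False by blast
    obtain k y2 where k: "1 \<le> k" "k < n" "\<sigma> (Suc k) < \<sigma> k" "reach b w (\<sigma> \<circ> adj k) y2"
      "y' = intertwine k (ct b (\<sigma> k) - ct b (\<sigma> (Suc k))) y2"
      using reach_last[OF less.prems(2)] False by blast
    consider "j < k" | "k < j" | "j = k" by linarith
    then show ?thesis
    proof cases
      case 1
      then show ?thesis unfolding j(5) k(5) by (rule key[OF _ j(1-4) k(1-4)])
    next
      case 2
      then show ?thesis unfolding j(5) k(5) by (rule key[OF _ k(1-4) j(1-4), symmetric])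
    next
      case 3
      then show ?thesis
        using less.hyps[OF disorder_descent[OF j(1-3)] j(4)] k(4,5) j(5) by blast
    qed
  qed
qed

text \<open>The value 0 where no standard tableau arises lets expansions run over all of
  \<open>Sym n\<close>.\<close>

definition wvec :: "(nat \<Rightarrow> nat) \<Rightarrow> 'v" where
  "wvec \<sigma> = (if \<sigma> \<in> Sym n \<and> growth (b \<circ> \<sigma>) n then THE y. reach b w \<sigma> y else 0)"

lemma wvec_eq:
  assumes "reach b w \<sigma> y"
  shows "wvec \<sigma> = y"
proof -
  have c: "\<sigma> \<in> Sym n \<and> growth (b \<circ> \<sigma>) n"
    using reach_weight[OF assms] by (elim conjE) (rule conjI)
  have "(THE y. reach b w \<sigma> y) = y"
    using assms by (rule the_equality) (rule reach_unique[OF _ assms])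
  then show ?thesis unfolding wvec_def if_P[OF c] .
qed

lemma reach_wvec:
  assumes "\<sigma> \<in> Sym n" "growth (b \<circ> \<sigma>) n"
  shows "reach b w \<sigma> (wvec \<sigma>)"
proof -
  obtain y where "reach b w \<sigma> y" using reach_exists[OF assms] by (elim exE)
  then show ?thesis using wvec_eq[of \<sigma> y] by simp
qed

lemma reach_submodule:
  assumes "reach b w \<sigma> y" and "w \<in> M" "\<And>g x. g \<in> Sym n \<Longrightarrow> x \<in> M \<Longrightarrow> \<rho> g x \<in> M" "subspace M"
  shows "y \<in> M"
  using assms(1)
proof induction
  case (step \<sigma> y k)
  then show ?case
    unfolding intertwine_def using assms(3,4) adj_Sym[of k] by (intro subspace_diff subspace_scale) auto
qed (rule assms)

text \<open>Distinct tableaux have distinct content sequences, so for some p the eigenvalue of X p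
  on the vector differs from that of L. Restricting to an invariant M admits functionals that are
  eigenfunctionals only on a left ideal.\<close>

lemma weight_functional_wvec:
  fixes L :: "'v \<Rightarrow> complex"
  assumes M: "w \<in> M" "\<And>g x. g \<in> Sym n \<Longrightarrow> x \<in> M \<Longrightarrow> \<rho> g x \<in> M" "subspace M"
    and L: "\<And>c x. L (scale c x) = c * L x"
      "\<And>p x. p \<in> {1..n} \<Longrightarrow> x \<in> M \<Longrightarrow> L (X p x) = of_int (ct b p) * L x"
    and "\<sigma> \<in> Sym n" "\<sigma> \<noteq> id"
  shows "L (wvec \<sigma>) = 0"
proof (cases "growth (b \<circ> \<sigma>) n")
  case False
  then show ?thesis using L(1)[of 0 0] by (simp add: wvec_def)
next
  case True
  obtain p where p: "p \<in> {1..n}" "ct b (\<sigma> p) \<noteq> ct b p"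
  proof (rule ccontr)
    assume "\<not> thesis"
    then have "ct (b \<circ> \<sigma>) p = ct b p" if "p \<in> {1..n}" for p
      using that \<open>\<And>p. \<lbrakk>p \<in> {1..n}; ct b (\<sigma> p) \<noteq> ct b p\<rbrakk> \<Longrightarrow> thesis\<close> by (auto simp: ct_comp)
    then have eq: "(b \<circ> \<sigma>) p = b p" if "p \<in> {1..n}" for p
      using growth_content_unique[OF True g] that by blast
    have "\<sigma> p = p" for p
    proof (cases "p \<in> {1..n}")
      case True
      then show ?thesis
        using growth_inj[OF g, of "\<sigma> p" p] eq[OF True] permutes_in_image[of \<sigma> "{1..n}" p] assms(6)
        by (simp add: Sym_def)
    next
      case False
      then show ?thesis using assms(6) by (simp add: Sym_def permutes_def)
    qed
    then show False using assms(7) by auto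
  qed
  have xw: "X p (wvec \<sigma>) = scale (of_int (ct b (\<sigma> p))) (wvec \<sigma>)"
    using reach_weight[OF reach_wvec[OF assms(6) True]] p(1) by (simp add: weight_def ct_comp)
  have "of_int (ct b p) * L (wvec \<sigma>) = of_int (ct b (\<sigma> p)) * L (wvec \<sigma>)"
    using L(2)[OF p(1) reach_submodule[OF reach_wvec[OF assms(6) True] M]] unfolding xw L(1) by (rule sym)
  then have "(of_int (ct b (\<sigma> p)) - of_int (ct b p)) * L (wvec \<sigma>) = 0"
    unfolding left_diff_distrib right_minus_eq by (rule sym)
  then show ?thesis using p(2) by simp
qed

end

end

section \<open>Unitary representations\<close>

locale unitary_rep = sym_rep scale n \<rho>
  for scale :: "complex \<Rightarrow> 'v::ab_group_add \<Rightarrow> 'v" and n \<rho> +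
  fixes ip :: "'v \<Rightarrow> 'v \<Rightarrow> complex"
  assumes ip: "invariant_inner_product n scale \<rho> ip"
begin

lemma ip_add: "ip x (y + z) = ip x y + ip x z"
  and ip_scale: "ip x (scale c y) = c * ip x y"
  and ip_cnj: "ip y x = cnj (ip x y)"
  and ip_pos: "x \<noteq> 0 \<Longrightarrow> Re (ip x x) > 0"
  and ip_rho: "g \<in> Sym n \<Longrightarrow> ip (\<rho> g x) (\<rho> g y) = ip x y"
  using ip unfolding invariant_inner_product_def by blast+

lemma ip_0: "ip x 0 = 0"
  using ip_scale[of x 0 0] by simp

lemma ip_sum: "ip x (\<Sum>i\<in>I. f i) = (\<Sum>i\<in>I. ip x (f i))"
  by (induction I rule: infinite_finite_induct) (auto simp: ip_0 ip_add)

lemma ip_scale_left: "ip (scale c x) y = cnj c * ip x y"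
  by (metis complex_cnj_mult ip_cnj ip_scale)

lemma ip_add_left: "ip (x + y) z = ip x z + ip y z"
  by (metis complex_cnj_add ip_cnj ip_add)

lemma ip_transpose:
  assumes "a \<in> {1..n}" "c \<in> {1..n}"
  shows "ip (\<rho> (Transposition.transpose a c) x) y = ip x (\<rho> (Transposition.transpose a c) y)"
proof -
  have t: "Transposition.transpose a c \<in> Sym n" using assms by (rule transpose_Sym)
  have "\<rho> (Transposition.transpose a c) (\<rho> (Transposition.transpose a c) x) = x"
    using t by (simp add: rho_comp rho_id)
  then show ?thesis using ip_rho[OF t, of "\<rho> (Transposition.transpose a c) x" y] by simp
qed

lemma ip_X:
  assumes "p \<in> {1..n}"
  shows "ip (X p x) y = ip x (X p y)"
proof -
  have "ip (X p x) y = cnj (\<Sum>q\<in>{1..<p}. ip y (\<rho> (Transposition.transpose q p) x))"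
    unfolding jucys_murphy_def by (subst ip_cnj) (simp add: ip_sum)
  also have "\<dots> = (\<Sum>q\<in>{1..<p}. ip (\<rho> (Transposition.transpose q p) x) y)"
    by (simp add: ip_cnj[symmetric])
  also have "\<dots> = (\<Sum>q\<in>{1..<p}. ip x (\<rho> (Transposition.transpose q p) y))"
    using assms by (intro sum.cong ip_transpose) auto
  finally show ?thesis by (simp add: jucys_murphy_def ip_sum)
qed

lemma ip_eigen:
  assumes "p \<in> {1..n}" "X p x = scale (of_int c) x" "X p y = scale (of_int d) y" "c \<noteq> d"
  shows "ip x y = 0"
proof -
  have "of_int c * ip x y = of_int d * ip x y"
    using ip_X[OF assms(1), of x y] unfolding assms(2,3) by (simp add: ip_scale ip_scale_left)
  then show ?thesis using assms(4) by simp
qed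

text \<open>Orthogonality of the weight spaces forces the component of weight \<open>b \<circ> adj k\<close> to vanish.\<close>

lemma rho_adjacent_boxes:
  assumes "weight b x" "1 \<le> k" "k < n" "ct b (Suc k) - ct b k = d" "\<bar>d\<bar> = 1"
  shows "\<rho> (adj k) x = scale (1 / of_int d) x"
proof -
  let ?y = "intertwine k d x" and ?e = "1 / of_int d :: complex"
  have kn: "k \<in> {1..n}" "Suc k \<in> {1..n}" using assms by auto
  have d: "d \<noteq> 0" and ee: "?e * ?e = 1" using assms(5) by (auto simp: abs_if split: if_splits)
  have "weight (b \<circ> adj k) ?y" by (rule weight_intertwine[OF assms(1-4) d])
  then have y: "X k ?y = scale (of_int (ct b (Suc k))) ?y" using kn by (simp add: weight_def ct_comp)
  have x: "X k x = scale (of_int (ct b k)) x" using assms(1) kn by (simp add: weight_def)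
  have xy: "ip x ?y = 0" using ip_eigen[OF kn(1) x y] assms(4) d by auto
  have "\<rho> (adj k) ?y = x - scale ?e (\<rho> (adj k) x)"
    unfolding intertwine_def using assms(2,3) by (simp add: rho_diff rho_scale adj_Sym rho_adj_sq)
  also have "\<dots> = scale (- ?e) ?y"
    unfolding intertwine_def using ee by (simp add: scale_right_diff_distrib algebra_simps)
  finally have sy: "\<rho> (adj k) ?y = scale (- ?e) ?y" .
  have "ip (\<rho> (adj k) x) ?y = ip x (\<rho> (adj k) ?y)" by (rule ip_transpose[OF kn])
  also have "\<dots> = 0" unfolding sy by (simp only: ip_scale xy mult_zero_right)
  finally have "ip (\<rho> (adj k) x) ?y = 0" .
  moreover have "\<rho> (adj k) x = ?y + scale ?e x" by (simp add: intertwine_def)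
  ultimately have "ip ?y ?y = 0" by (simp add: ip_add_left ip_scale_left xy)
  then have "?y = 0" using ip_pos[of ?y] by auto
  then show ?thesis by (simp add: intertwine_def)
qed

context
  fixes b :: "nat \<Rightarrow> nat \<times> nat" and w :: 'v
  assumes g: "growth b n" and w: "weight b w"
begin

abbreviation wv :: "(nat \<Rightarrow> nat) \<Rightarrow> 'v" where "wv \<equiv> wvec b w"

text \<open>At a descent w_\<sigma> is an intertwiner applied to the lower vector, and s_k^2 = 1
  gives 1 - alpha^2. At an ascent to a tableau the formula is the construction of the higher vector.
  Otherwise the boxes are neighbours, and unitarity enters through
  \<open>rho_adjacent_boxes\<close>.\<close>

lemma rho_wvec:
  assumes "\<sigma> \<in> Sym n" "1 \<le> k" "k < n"
  shows "\<rho> (adj k) (wv \<sigma>) = scale (of_real (alpha b k \<sigma>)) (wv \<sigma>) + scale (of_real (beta b n k \<sigma>)) (wv (\<sigma> \<circ> adj k))"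
proof (cases "growth (b \<circ> \<sigma>) n")
  case False
  then have "wv \<sigma> = 0" by (simp add: wvec_def[OF g w])
  then show ?thesis using False by (simp add: beta_def rho_0[OF adj_Sym[OF assms(2,3)]])
next
  case True
  let ?d = "ct b (\<sigma> (Suc k)) - ct b (\<sigma> k)"
  have a: "(of_real (alpha b k \<sigma>) :: complex) = 1 / of_int ?d" by (simp add: alpha_def)
  have r: "reach b w \<sigma> (wv \<sigma>)" by (rule reach_wvec[OF g w assms(1) True])
  have ne: "\<sigma> k \<noteq> \<sigma> (Suc k)"
  proof -
    have "inj \<sigma>" using assms(1) permutes_inj unfolding Sym_def by blast
    then show ?thesis using injD[of \<sigma> k "Suc k"] by auto
  qed
  consider "\<sigma> (Suc k) < \<sigma> k" | "\<sigma> k < \<sigma> (Suc k)" "growth (b \<circ> (\<sigma> \<circ> adj k)) n"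
    | "\<sigma> k < \<sigma> (Suc k)" "\<not> growth (b \<circ> (\<sigma> \<circ> adj k)) n"
    using ne by (cases "\<sigma> k < \<sigma> (Suc k)") auto
  then show ?thesis
  proof cases
    case 1
    let ?t = "wv (\<sigma> \<circ> adj k)"
    let ?e = "1 / of_int ?d :: complex"
    note v = descent_valid[OF g w assms(1) True assms(2,3) 1]
    have "wv \<sigma> = intertwine k (ct b (\<sigma> k) - ct b (\<sigma> (Suc k))) ?t"
      using reach_up[OF g w True assms(2,3) 1 reach_wvec[OF g w v]] by (rule wvec_eq[OF g w])
    also have "\<dots> = \<rho> (adj k) ?t - scale (- ?e) ?t"
    proof -
      have "1 / of_int (ct b (\<sigma> k) - ct b (\<sigma> (Suc k))) = - ?e"
        by (simp only: minus_divide_right flip: of_int_minus) simp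
      then show ?thesis unfolding intertwine_def by simp
    qed
    finally have t: "wv \<sigma> = \<rho> (adj k) ?t + scale ?e ?t" by simp
    have "\<rho> (adj k) (wv \<sigma>) = ?t + scale ?e (\<rho> (adj k) ?t)"
      unfolding t using assms(2,3) by (simp add: rho_add rho_scale adj_Sym rho_adj_sq)
    also have "\<dots> = scale ?e (wv \<sigma>) + scale (1 - ?e^2) ?t"
      unfolding t by (simp add: scale_right_distrib scale_left_diff_distrib power2_eq_square)
    finally show ?thesis using 1 True by (simp add: a beta_def)
  next
    case 2
    have "wv (\<sigma> \<circ> adj k) = intertwine k ?d (wv \<sigma>)"
      using reach.step[OF r assms(2,3) 2] by (rule wvec_eq[OF g w])
    then show ?thesis using 2 True by (simp add: a beta_def intertwine_def)
  next
    case 3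
    then have "wv (\<sigma> \<circ> adj k) = 0" by (simp add: wvec_def[OF g w])
    moreover have "\<bar>?d\<bar> = 1"
      using growth_adj_or[OF True assms(2,3)] 3 by (simp add: comp_assoc ct_comp)
    then have "\<rho> (adj k) (wv \<sigma>) = scale (1 / of_int ?d) (wv \<sigma>)"
      using reach_weight[OF g w r] assms(2,3) by (intro rho_adjacent_boxes[of "b \<circ> \<sigma>"]) (auto simp: ct_comp)
    ultimately show ?thesis by (simp add: a)
  qed
qed

lemma rho_word:
  assumes "set ks \<subseteq> {1..<n}"
  shows "\<rho> (word_perm ks) w = (\<Sum>\<sigma>\<in>Sym n. scale (of_real (word_coef b n ks \<sigma>)) (wv \<sigma>))"
  using assms
proof (induction ks)
  case Nil
  have fin: "finite (Sym n)" by (simp add: Sym_def finite_permutations)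
  have "(\<Sum>\<sigma>\<in>Sym n. scale (of_real (word_coef b n [] \<sigma>)) (wv \<sigma>)) = (\<Sum>\<sigma>\<in>Sym n. if \<sigma> = id then wv \<sigma> else 0)"
    by (intro sum.cong) auto
  also have "\<dots> = wv id" using id_Sym fin by simp
  also have "\<dots> = w" using reach.start by (rule wvec_eq[OF g w])
  finally show ?case unfolding word_perm.simps rho_id by (rule sym)
next
  case (Cons k ks)
  have k: "1 \<le> k" "k < n" and ks: "set ks \<subseteq> {1..<n}" using Cons.prems by auto
  let ?m = "\<lambda>\<sigma>. of_real (word_coef b n ks \<sigma>) :: complex"
  let ?\<beta> = "\<lambda>\<sigma>. of_real (beta b n k \<sigma>) :: complex" and ?\<alpha> = "\<lambda>\<sigma>. of_real (alpha b k \<sigma>) :: complex"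
  have "\<rho> (word_perm (k # ks)) w = \<rho> (adj k) (\<rho> (word_perm ks) w)"
    using word_perm_Sym[OF ks] k by (simp add: rho_comp adj_Sym)
  also have "\<dots> = (\<Sum>\<sigma>\<in>Sym n. scale (?m \<sigma>) (scale (?\<alpha> \<sigma>) (wv \<sigma>) + scale (?\<beta> \<sigma>) (wv (\<sigma> \<circ> adj k))))"
    unfolding Cons.IH[OF ks] using k by (simp add: rho_sum rho_scale adj_Sym rho_wvec)
  also have "\<dots> = (\<Sum>\<sigma>\<in>Sym n. scale (?\<alpha> \<sigma> * ?m \<sigma>) (wv \<sigma>)) + (\<Sum>\<sigma>\<in>Sym n. scale (?\<beta> \<sigma> * ?m \<sigma>) (wv (\<sigma> \<circ> adj k)))"
    by (simp add: scale_right_distrib sum.distrib mult.commute)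
  \<comment> \<open>Reindexing by the involution \<sigma> to \<sigma> \<circ> adj k matches the
    recursion of \<open>word_coef\<close>.\<close>
  also have "(\<Sum>\<sigma>\<in>Sym n. scale (?\<beta> \<sigma> * ?m \<sigma>) (wv (\<sigma> \<circ> adj k)))
    = (\<Sum>\<sigma>\<in>Sym n. scale (?\<beta> (\<sigma> \<circ> adj k) * ?m (\<sigma> \<circ> adj k)) (wv \<sigma>))"
    by (rule sum.reindex_bij_witness[of _ "\<lambda>\<sigma>. \<sigma> \<circ> adj k" "\<lambda>\<sigma>. \<sigma> \<circ> adj k"])
      (use k in \<open>simp_all add: adj_adj Sym_adj\<close>)
  finally show ?case
    by (simp add: scale_left_distrib sum.distrib)
qed

text \<open>Only the term of \<sigma> = id survives L. It is applied to the inner product with a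
  Young basis vector and to the coefficient at the identity of the group algebra.\<close>

lemma weight_functional_rho:
  fixes L :: "'v \<Rightarrow> complex"
  assumes M: "w \<in> M" "\<And>g x. g \<in> Sym n \<Longrightarrow> x \<in> M \<Longrightarrow> \<rho> g x \<in> M" "subspace M"
    and L: "\<And>x y. L (x + y) = L x + L y" "\<And>c x. L (scale c x) = c * L x"
    and LX: "\<And>p x. p \<in> {1..n} \<Longrightarrow> x \<in> M \<Longrightarrow> L (X p x) = of_int (ct b p) * L x"
    and ks: "set ks \<subseteq> {1..<n}"
  shows "L (\<rho> (word_perm ks) w) = of_real (word_coef b n ks id) * L w"
proof -
  have L0: "L 0 = 0" using L(2)[of 0 0] by simp
  have Ls: "L (\<Sum>i\<in>I. f i) = (\<Sum>i\<in>I. L (f i))" for I :: "(nat \<Rightarrow> nat) set" and f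
    by (induction I rule: infinite_finite_induct) (auto simp: L0 L(1))
  have fin: "finite (Sym n)" by (simp add: Sym_def finite_permutations)
  have id: "wv id = w" using reach.start by (rule wvec_eq[OF g w])
  have "L (\<rho> (word_perm ks) w) = (\<Sum>\<sigma>\<in>Sym n. of_real (word_coef b n ks \<sigma>) * L (wv \<sigma>))"
    unfolding rho_word[OF ks] by (simp add: Ls L(2))
  also have "\<dots> = (\<Sum>\<sigma>\<in>Sym n. if \<sigma> = id then of_real (word_coef b n ks id) * L w else 0)"
    using weight_functional_wvec[OF g w M L(2) LX] id by (intro sum.cong) auto
  finally show ?thesis using id_Sym fin by simp
qed

end

end

section \<open>The fusion product in the group ring\<close>

text \<open>The inner product for which the permutations are orthonormal.\<close>

definition galg_ip :: "galg \<Rightarrow> galg \<Rightarrow> complex" where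
  "galg_ip x y = (\<Sum>g\<in>Poly_Mapping.keys x. cnj (lookup x g) * lookup y g)"

lemma galg_ip_superset:
  assumes "Poly_Mapping.keys x \<subseteq> K" "finite K"
  shows "galg_ip x y = (\<Sum>g\<in>K. cnj (lookup x g) * lookup y g)"
  unfolding galg_ip_def using assms by (intro sum.mono_neutral_left) (auto simp: in_keys_iff)

lemma galg_ip_invariant: "invariant_inner_product n (\<lambda>c x. scl c * x) (\<lambda>g x. sg g * x) galg_ip"
  unfolding invariant_inner_product_def
proof (intro conjI allI impI ballI)
  fix x y z :: galg and c
  show "galg_ip x (y + z) = galg_ip x y + galg_ip x z"
    by (simp add: galg_ip_def lookup_add distrib_left sum.distrib)
  show "galg_ip x (scl c * y) = c * galg_ip x y"
    by (simp add: galg_ip_def sum_distrib_left mult.left_commute)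
  show "galg_ip y x = cnj (galg_ip x y)"
    using galg_ip_superset[of x "Poly_Mapping.keys x \<union> Poly_Mapping.keys y" y]
      galg_ip_superset[of y "Poly_Mapping.keys x \<union> Poly_Mapping.keys y" x]
    by (simp add: mult.commute)
next
  fix x :: galg assume "x \<noteq> 0"
  then have "0 < (\<Sum>g\<in>Poly_Mapping.keys x. (cmod (lookup x g))\<^sup>2)"
    by (intro sum_pos) (auto simp: in_keys_iff)
  moreover have "Re (galg_ip x x) = (\<Sum>g\<in>Poly_Mapping.keys x. (cmod (lookup x g))\<^sup>2)"
    by (simp add: galg_ip_def cmod_power2) (simp add: power2_eq_square)
  ultimately show "Re (galg_ip x x) > 0" by simp
next
  fix g :: "nat \<Rightarrow> nat" and x y :: galg
  let ?g = "Perm g"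
  have "inj_on ((+) ?g) (Poly_Mapping.keys x)" by simp
  moreover have "Poly_Mapping.keys (sg g * x) \<subseteq> (+) ?g ` Poly_Mapping.keys x"
  proof
    fix h assume "h \<in> Poly_Mapping.keys (sg g * x)"
    then have "- ?g + h \<in> Poly_Mapping.keys x"
      by (simp add: in_keys_iff sg_def lookup_single_mult)
    then show "h \<in> (+) ?g ` Poly_Mapping.keys x"
      by (intro image_eqI[of _ _ "- ?g + h"]) (simp_all flip: add.assoc)
  qed
  ultimately show "galg_ip (sg g * x) (sg g * y) = galg_ip x y"
    unfolding galg_ip_def[of x y]
    by (subst galg_ip_superset[of _ "(+) ?g ` Poly_Mapping.keys x"])
      (simp_all add: sum.reindex sg_def lookup_single_mult flip: add.assoc)
qed

lemma unitary_rep_galg: "unitary_rep (\<lambda>c x. scl c * x) n (\<lambda>g x. sg g * x) galg_ip"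
  unfolding unitary_rep_def unitary_rep_axioms_def
  using sym_rep_galg galg_ip_invariant by blast

text \<open>The coefficient at the identity is a trace, so X p acting on a E from the left can be
  moved to the right of E, where \<open>star E = E\<close> makes E an eigenvector as well.\<close>

lemma lookup_weight_galg:
  assumes g: "growth b n" and w: "galg.weight n b E" and sE: "star E = E"
    and ks: "set ks \<subseteq> {1..<n}"
  shows "lookup (sg (word_perm ks) * E) 0 = of_real (word_coef b n ks id) * lookup E 0"
proof -
  interpret unitary_rep "\<lambda>c x. scl c * x" n "\<lambda>g x. sg g * x" galg_ip
    by (rule unitary_rep_galg)
  \<comment> \<open>The left ideal generated by E.\<close>
  let ?M = "range (\<lambda>a. a * E)"
  have sub: "galg.subspace ?M"
    unfolding galg.subspace_def
  proof (intro conjI ballI allI)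
    show "0 \<in> ?M" by (rule range_eqI[of _ _ 0]) simp
    fix x assume "x \<in> ?M"
    then obtain a where a: "x = a * E" by blast
    show "scl c * x \<in> ?M" for c by (rule range_eqI[of _ _ "scl c * a"]) (simp add: a mult.assoc)
    fix y assume "y \<in> ?M"
    then obtain c where c: "y = c * E" by blast
    show "x + y \<in> ?M" by (rule range_eqI[of _ _ "a + c"]) (simp add: a c distrib_right)
  qed
  have right: "E * jm (p - 1) p = scl (of_int (ct b p)) * E" if "p \<in> {1..n}" for p
  proof -
    have "star (jm q r) = jm q r" for q r by (simp add: jm_def star_sum)
    moreover have "jm (p - 1) p * E = scl (of_int (ct b p)) * E"
      using w that unfolding galg_weight by blast
    ultimately show ?thesis using sE by (metis scl_central star_mult star_scl)
  qed
  have trace: "lookup (x * y) 0 = lookup (y * x) 0" for x y :: galg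
  proof -
    have 1: "lookup (Poly_Mapping.single h c * y) 0 = lookup (y * Poly_Mapping.single h c) 0" for h c
      by (simp add: lookup_single_mult lookup_mult_single mult.commute)
    show ?thesis
      by (subst (1 2) galg_decomp[of x]) (simp only: sum_distrib_right sum_distrib_left lookup_sum 1)
  qed
  have X: "lookup (jm (p - 1) p * x) 0 = of_int (ct b p) * lookup x 0" if p: "p \<in> {1..n}" and x: "x \<in> ?M" for p x
  proof -
    obtain a where a: "x = a * E" using x by blast
    have "lookup (jm (p - 1) p * x) 0 = lookup (a * (E * jm (p - 1) p)) 0"
      unfolding a by (subst trace) (simp only: mult.assoc)
    also have "\<dots> = of_int (ct b p) * lookup x 0"
      unfolding right[OF p] a by (simp add: scl_move_left)
    finally show ?thesis .
  qed
  show ?thesis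
  proof (rule weight_functional_rho[OF g w _ _ sub _ _ _ ks, where L = "\<lambda>x. lookup x 0"])
    show "E \<in> ?M" by (rule range_eqI[of _ _ 1]) simp
    show "sg g * x \<in> ?M" if "x \<in> ?M" for g x
      using that by (auto simp flip: mult.assoc)
  qed (use X in \<open>simp_all add: lookup_add galg_jucys_murphy\<close>)
qed

section \<open>Comparison of the two models of the group ring\<close>

definition emb :: "nat \<Rightarrow> gring \<Rightarrow> galg" where
  "emb n a = (\<Sum>g\<in>Sym n. Poly_Mapping.single (Perm g) (a g))"

lemma finite_Sym: "finite (Sym n)"
  by (simp add: Sym_def finite_permutations)

lemma apply_Perm_Sym: "g \<in> Sym n \<Longrightarrow> Perm.apply (Perm g) = g"
  using apply_Perm[of g "{1..n}"] by (simp add: Sym_def)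

lemma Perm_eq_iff: "g \<in> Sym n \<Longrightarrow> h \<in> Sym n \<Longrightarrow> Perm g = Perm h \<longleftrightarrow> g = h"
  using apply_Perm_Sym by metis

lemma Perm_comp: "g \<in> Sym n \<Longrightarrow> h \<in> Sym n \<Longrightarrow> Perm (g \<circ> h) = Perm g + Perm h"
  by (intro perm_eqI) (simp add: apply_plus apply_Perm[of _ "{1..n}"] Sym_def permutes_compose)

lemma lookup_emb:
  assumes "g \<in> Sym n"
  shows "lookup (emb n a) (Perm g) = a g"
proof -
  have "lookup (emb n a) (Perm g) = (\<Sum>h\<in>Sym n. if h = g then a h else 0)"
    unfolding emb_def lookup_sum lookup_single using assms
    by (intro sum.cong) (auto simp: when_def Perm_eq_iff)
  then show ?thesis using assms finite_Sym by simp
qed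

lemma emb_gmult: "emb n (gmult n a b) = emb n a * emb n b"
proof -
  have "emb n (gmult n a b) = (\<Sum>g\<in>Sym n. \<Sum>h\<in>Sym n. Poly_Mapping.single (Perm g) (a h * b (inv h \<circ> g)))"
    unfolding emb_def gmult_def
    by (intro sum.cong refl, rule poly_mapping_eqI) (simp add: lookup_single lookup_sum when_def)
  also have "\<dots> = (\<Sum>h\<in>Sym n. \<Sum>g\<in>Sym n. Poly_Mapping.single (Perm g) (a h * b (inv h \<circ> g)))"
    by (rule sum.swap)
  also have "\<dots> = (\<Sum>h\<in>Sym n. \<Sum>g\<in>Sym n. Poly_Mapping.single (Perm h) (a h) * Poly_Mapping.single (Perm g) (b g))"
  proof (rule sum.cong[OF refl])
    fix h assume h: "h \<in> Sym n"
    then have hp: "h permutes {1..n}" by (simp add: Sym_def)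
    show "(\<Sum>g\<in>Sym n. Poly_Mapping.single (Perm g) (a h * b (inv h \<circ> g))) =
      (\<Sum>g\<in>Sym n. Poly_Mapping.single (Perm h) (a h) * Poly_Mapping.single (Perm g) (b g))"
    proof (rule sum.reindex_bij_witness[of _ "\<lambda>g. h \<circ> g" "\<lambda>g. inv h \<circ> g"])
      fix g assume g: "g \<in> Sym n"
      show "h \<circ> (inv h \<circ> g) = g" "inv h \<circ> (h \<circ> g) = g"
        using permutes_inv_o[OF hp] by (simp_all add: o_assoc)
      show ig: "inv h \<circ> g \<in> Sym n" and "h \<circ> g \<in> Sym n"
        using g h permutes_inv[OF hp] by (simp_all add: Sym_def permutes_compose)
      have "Perm g = Perm h + Perm (inv h \<circ> g)"
        using Perm_comp[OF h ig] permutes_inv_o[OF hp] by (simp add: o_assoc)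
      then show "Poly_Mapping.single (Perm h) (a h) * Poly_Mapping.single (Perm (inv h \<circ> g)) (b (inv h \<circ> g)) =
          Poly_Mapping.single (Perm g) (a h * b (inv h \<circ> g))"
        by (simp add: mult_single)
    qed
  qed
  finally show ?thesis
    by (simp add: emb_def sum_product)
qed

lemma emb_gsingle:
  assumes "h \<in> Sym n"
  shows "emb n (gsingle h) = sg h"
proof -
  have "emb n (gsingle h) = (\<Sum>g\<in>Sym n. if g = h then sg h else 0)"
    unfolding emb_def gsingle_def sg_def by (intro sum.cong) auto
  then show ?thesis using assms finite_Sym by simp
qed

lemma emb_fusion_factor:
  assumes "p \<in> {1..n}" "q \<in> {1..n}"
  shows "emb n (fusion_factor p q u v) = rmat p q u v"
proof -
  have "emb n (fusion_factor p q u v) = emb n (gsingle id) - scl (1 / (u - v)) * emb n (gsingle (Transposition.transpose p q))"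
    unfolding emb_def fusion_factor_def sum_distrib_left
    by (simp add: single_diff sum_subtractf scl_def mult_single)
  moreover have "Transposition.transpose p q \<in> Sym n"
    using assms by (simp add: Sym_def permutes_swap_id)
  ultimately show ?thesis
    by (simp add: emb_gsingle id_Sym sg_id rmat_def)
qed

text \<open>Induction on n: the last factor of each row is moved to the end. It only has to pass
  later rows stripped of their own last factors, whose indices are disjoint from its own.\<close>

lemma prod_lex_pairs:
  "prod_list (map (\<lambda>(p, q). rmat p q (x p) (x q)) (lex_pairs n)) = fus x n"
proof -
  define row where "row p m = prod_list (map (\<lambda>q. rmat p q (x p) (x q)) [Suc p..<Suc m])" for p m
  have lex: "prod_list (map (\<lambda>(p, q). rmat p q (x p) (x q)) (lex_pairs m)) = prod_list (map (\<lambda>p. row p m) [1..<Suc m])" for m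
  proof -
    have "prod_list (concat xss) = prod_list (map prod_list xss)" for xss :: "galg list list"
      by (induction xss) simp_all
    then show ?thesis
      unfolding lex_pairs_def row_def map_concat by (simp add: o_def)
  qed
  have row_commute: "col x k N u * row (Suc k) m = row (Suc k) m * col x k N u" if "m < N" for k m N u
  proof -
    have *: "col x k N u * prod_list (map (\<lambda>q. rmat (Suc k) q (x (Suc k)) (x q)) qs) =
        prod_list (map (\<lambda>q. rmat (Suc k) q (x (Suc k)) (x q)) qs) * col x k N u"
      if "\<forall>q\<in>set qs. k < q \<and> q < N" "Suc k < N" for qs
      using that(1)
    proof (induction qs)
      case (Cons q qs)
      have "col x k N u * rmat (Suc k) q (x (Suc k)) (x q) = rmat (Suc k) q (x (Suc k)) (x q) * col x k N u"
        using Cons.prems that(2) by (intro rmat_commuteI col_tr_commute) auto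
      then show ?case
        using Cons by (simp flip: mult.assoc) (simp add: mult.assoc)
    qed simp
    show ?thesis
    proof (cases "Suc k < N")
      case True
      show ?thesis unfolding row_def by (rule *[OF _ True]) (use \<open>m < N\<close> in auto)
    next
      case False
      then show ?thesis using \<open>m < N\<close> by (simp add: row_def)
    qed
  qed
  have step: "prod_list (map (\<lambda>p. row p (Suc m)) [1..<Suc k]) =
      prod_list (map (\<lambda>p. row p m) [1..<Suc k]) * col x k (Suc m) (x (Suc m))" if "k \<le> m" for k m
    using that
  proof (induction k)
    case (Suc k)
    have "row (Suc k) (Suc m) = row (Suc k) m * rmat (Suc k) (Suc m) (x (Suc k)) (x (Suc m))"
      unfolding row_def using Suc.prems by simp
    then show ?case
      using Suc row_commute[of m "Suc m" k "x (Suc m)"] by (simp add: mult.assoc) (simp flip: mult.assoc)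
  qed simp
  show ?thesis
    unfolding lex
  proof (induction n)
    case (Suc m)
    have "row (Suc m) (Suc m) = 1" by (simp add: row_def)
    then have "prod_list (map (\<lambda>p. row p (Suc m)) [1..<Suc (Suc m)]) = prod_list (map (\<lambda>p. row p (Suc m)) [1..<Suc m])"
      by simp
    then show ?case using step[of m m] Suc by simp
  qed simp
qed

lemma emb_fusion_product:
  assumes "n = sum_list lam"
  shows "emb n (fusion_product lam T z) = fus (\<lambda>p. z p + of_int (content lam T p)) n"
proof -
  let ?x = "\<lambda>p. z p + of_int (content lam T p)"
  have "emb n (foldr (gmult n) (map (\<lambda>(p, q). fusion_factor p q (?x p) (?x q)) L) (gsingle id)) =
      prod_list (map (\<lambda>(p, q). rmat p q (?x p) (?x q)) L)" if "set L \<subseteq> {1..n} \<times> {1..n}" for L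
    using that
    by (induction L) (auto simp: emb_gsingle id_Sym sg_id emb_gmult emb_fusion_factor)
  moreover have "set (lex_pairs n) \<subseteq> {1..n} \<times> {1..n}"
    by (auto simp: lex_pairs_def)
  ultimately show ?thesis
    unfolding fusion_product_def Let_def assms[symmetric] using prod_lex_pairs[of ?x n] by simp
qed

lemma fusion_product_eq:
  assumes "n = sum_list lam"
  shows "fusion_product lam T z g =
    (if g \<in> Sym n then lookup (fus (\<lambda>p. z p + of_int (content lam T p)) n) (Perm g) else 0)"
proof (cases "g \<in> Sym n")
  case True
  then show ?thesis
    using lookup_emb[OF True, of "fusion_product lam T z"] unfolding emb_fusion_product[OF assms] by simp
next
  case False
  have "foldr (gmult n) L (gsingle id) g = 0" for L
    using False id_Sym[of n] by (cases L) (auto simp: gmult_def gsingle_def)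
  then show ?thesis
    using False unfolding fusion_product_def Let_def assms[symmetric] by simp
qed

lemma ct_box_of: "ct (box_of lam T) p = content lam T p"
  by (simp add: ct_def content_def)

lemma hook_principal_hook:
  assumes "\<beta> \<in> diagram lam"
  shows "\<beta> \<in> principal_hook lam i \<longleftrightarrow> hook \<beta> = i"
  using assms by (cases \<beta>) (auto simp: principal_hook_def hook_def min_def)

text \<open>Boxes of one hook are separated by their contents, and different hooks by parameters
  that are far apart.\<close>

lemma fusion_domain_nonempty:
  assumes "partition_of n lam" "standard_tableau lam T"
  shows "fusion_domain lam T \<noteq> {}"
proof -
  let ?b = "box_of lam T"
  have n: "n = sum_list lam" using assms(1) by (simp add: partition_of_def)
  have g: "growth ?b n" by (rule growth_box_of[OF assms])
  have inD: "?b p \<in> diagram lam" if "p \<in> {1..n}" for p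
    using bij_betwE[OF box_of_bij[OF assms(2)]] that n by blast
  \<comment> \<open>Exceeds the difference of any two contents.\<close>
  define M where "M = 2 * (\<Sum>p\<in>{1..n}. \<bar>ct ?b p\<bar>) + 1"
  define z where "z p = (if p \<in> {1..n} then of_int (int (hook (?b p)) * M) else 0 :: complex)" for p
  have "z p + of_int (content lam T p) \<noteq> z q + of_int (content lam T q)" if pq: "1 \<le> p" "p < q" "q \<le> n" for p q
  proof
    have pn: "p \<in> {1..n}" "q \<in> {1..n}" using pq by auto
    assume "z p + of_int (content lam T p) = z q + of_int (content lam T q)"
    then have "(of_int (int (hook (?b p)) * M + ct ?b p) :: complex) = of_int (int (hook (?b q)) * M + ct ?b q)"
      using pn by (simp add: z_def ct_box_of)
    then have "int (hook (?b p)) * M + ct ?b p = int (hook (?b q)) * M + ct ?b q"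
      by (simp only: of_int_eq_iff)
    then have e: "(int (hook (?b p)) - int (hook (?b q))) * M = ct ?b q - ct ?b p"
      by (simp add: left_diff_distrib)
    have "\<bar>ct ?b r\<bar> \<le> (\<Sum>p\<in>{1..n}. \<bar>ct ?b p\<bar>)" if "r \<in> {1..n}" for r
      using member_le_sum[OF that, of "\<lambda>p. \<bar>ct ?b p\<bar>"] by simp
    from this[OF pn(1)] this[OF pn(2)] have lt: "\<bar>ct ?b q - ct ?b p\<bar> < M"
      by (simp add: M_def)
    have "int (hook (?b p)) - int (hook (?b q)) = 0"
    proof (rule ccontr)
      assume "\<not> ?thesis"
      then have "1 \<le> \<bar>int (hook (?b p)) - int (hook (?b q))\<bar>" by linarith
      moreover have "0 < M" using lt by linarith
      ultimately have "M \<le> \<bar>int (hook (?b p)) - int (hook (?b q))\<bar> * \<bar>M\<bar>"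
        using mult_right_mono[of 1 _ M] by simp
      then show False using lt e by (simp add: abs_mult[symmetric])
    qed
    then have "hook (?b p) = hook (?b q)" "ct ?b p = ct ?b q" using e by auto
    then have "?b p = ?b q"
      by (cases "?b p"; cases "?b q") (auto simp: hook_def ct_def min_def split: if_splits)
    then show False using growth_inj[OF g _ pn] pq by simp
  qed
  moreover have "z \<in> hook_subspace lam T"
    unfolding hook_subspace_def Cspace_def n[symmetric]
    using inD hook_principal_hook by (auto simp: z_def)
  ultimately show ?thesis
    unfolding fusion_domain_def n[symmetric] by blast
qed

lemma has_rational_valueI:
  assumes "U \<noteq> {}" "P \<in> poly_fun n" "Q \<in> poly_fun n" "Q a \<noteq> 0" "\<And>z. z \<in> U \<Longrightarrow> f z * Q z = P z" "w = P a / Q a"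
  shows "has_rational_value n U f a w"
  unfolding has_rational_value_def using assms by blast

lemma regval_rational:
  assumes "partition_of n lam" "standard_tableau lam T"
  shows "regval (fusion_domain lam T) (\<lambda>f. has_rational_value n (fusion_domain lam T) f (diag_point n t))"
proof -
  let ?U = "fusion_domain lam T" and ?a = "diag_point n t"
  have n: "n = sum_list lam" using assms(1) by (simp add: partition_of_def)
  have U: "?U \<noteq> {}" by (rule fusion_domain_nonempty[OF assms])
  show ?thesis
  proof
    fix c
    show "has_rational_value n ?U (\<lambda>z. c) ?a c"
      by (rule has_rational_valueI[OF U poly_fun.const[of c] poly_fun.const[of 1]]) simp_all
  next
    fix f g v w
    assume f: "has_rational_value n ?U f ?a v" and g: "has_rational_value n ?U g ?a w"
    then obtain P Q P' Q' where P: "P \<in> poly_fun n" "Q \<in> poly_fun n" "Q ?a \<noteq> 0" "\<And>z. z \<in> ?U \<Longrightarrow> f z * Q z = P z"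
      "v = P ?a / Q ?a" and P': "P' \<in> poly_fun n" "Q' \<in> poly_fun n" "Q' ?a \<noteq> 0"
      "\<And>z. z \<in> ?U \<Longrightarrow> g z * Q' z = P' z" "w = P' ?a / Q' ?a"
      unfolding has_rational_value_def by blast
    show "has_rational_value n ?U (\<lambda>z. f z + g z) ?a (v + w)"
      by (rule has_rational_valueI[OF U poly_fun.add[OF poly_fun.mult[OF P(1) P'(2)] poly_fun.mult[OF P'(1) P(2)]]
          poly_fun.mult[OF P(2) P'(2)]])
        (simp_all add: P(3,5) P'(3,5) P(4)[symmetric] P'(4)[symmetric] add_frac_eq algebra_simps)
    show "has_rational_value n ?U (\<lambda>z. f z * g z) ?a (v * w)"
      by (rule has_rational_valueI[OF U poly_fun.mult[OF P(1) P'(1)] poly_fun.mult[OF P(2) P'(2)]])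
        (simp_all add: P(3,5) P'(3,5) P(4)[symmetric] P'(4)[symmetric] algebra_simps)
    fix h
    assume w: "w \<noteq> 0" and h: "\<And>z. z \<in> ?U \<Longrightarrow> h z * g z = f z"
    show "has_rational_value n ?U h ?a (v / w)"
    proof (rule has_rational_valueI[OF U poly_fun.mult[OF P(1) P'(2)] poly_fun.mult[OF P(2) P'(1)]])
      show "Q ?a * P' ?a \<noteq> 0" using w P(3) P'(5) by auto
      show "h z * (Q z * P' z) = P z * Q' z" if "z \<in> ?U" for z
        using that by (simp add: P(4)[symmetric] P'(4)[symmetric] h[symmetric] algebra_simps)
      show "v / w = P ?a * Q' ?a / (Q ?a * P' ?a)"
        using P(5) P'(5) by simp
    qed
  next
    fix f v w
    assume "has_rational_value n ?U f ?a v" "has_rational_value n ?U f ?a w"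
    then show "v = w" unfolding n by (rule fusion_value_unique)
  qed
qed

theorem theorem1p2:
  fixes n :: nat and lam :: "nat list" and \<Lambda> :: tableau
    and scale :: "complex \<Rightarrow> 'v::ab_group_add \<Rightarrow> 'v"
    and \<rho> :: "(nat \<Rightarrow> nat) \<Rightarrow> 'v \<Rightarrow> 'v"
    and ip :: "'v \<Rightarrow> 'v \<Rightarrow> complex"
    and v :: "tableau \<Rightarrow> 'v"
  assumes "n \<ge> 1" and "partition_of n lam" and "standard_tableau lam \<Lambda>"
  shows "(\<forall>t. gring_regular_at n (fusion_domain lam \<Lambda>) (fusion_product lam \<Lambda>) (diag_point n t)) \<and>
    (irreducible_module_of lam scale \<rho> \<and>
     invariant_inner_product n scale \<rho> ip \<and>
     young_basis lam scale \<rho> ip v \<longrightarrow>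
       (\<forall>t. gring_value_at n (fusion_domain lam \<Lambda>) (fusion_product lam \<Lambda>) (diag_point n t)
              = matrix_element n \<rho> ip (v \<Lambda>)))"
proof -
  let ?U = "fusion_domain lam \<Lambda>" and ?b = "box_of lam \<Lambda>"
  have n: "n = sum_list lam" using assms(2) by (simp add: partition_of_def)
  have g: "growth ?b n" by (rule growth_box_of[OF assms(2,3)])
  have inD: "?b p \<in> diagram lam" if "p \<in> {1..n}" for p
    using bij_betwE[OF box_of_bij[OF assms(3)]] that n by blast
  define x where "x z p = z p + of_int (content lam \<Lambda> p)" for z :: "nat \<Rightarrow> complex" and p
  have main: "\<exists>E. (\<forall>g\<in>Sym n. has_rational_value n ?U (\<lambda>z. fusion_product lam \<Lambda> z g) (diag_point n t) (lookup E (Perm g)))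
      \<and> galg.weight n ?b E \<and> star E = E \<and> lookup E 0 = 1" for t
  proof -
    interpret regval ?U "\<lambda>f. has_rational_value n ?U f (diag_point n t)"
      by (rule regval_rational[OF assms(2,3)])
    have inj: "inj_on (x z) {1..n}" if "z \<in> ?U" for z
      using that unfolding fusion_domain_def x_def n[symmetric]
      by (intro linorder_inj_onI) auto
    have sx: "has_rational_value n ?U (\<lambda>z. x z p) (diag_point n t) (t + of_int (ct ?b p))" if "p \<in> {1..n}" for p
    proof -
      have "has_rational_value n ?U (\<lambda>z. z p) (diag_point n t) t"
        using that by (intro has_rational_valueI[OF fusion_domain_nonempty[OF assms(2,3)]
          poly_fun.coord[of p] poly_fun.const[of 1]]) (auto simp: diag_point_def)
      then show ?thesis
        unfolding x_def ct_box_of by (intro sv_add sv_const)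
    qed
    have hk: "x z p - x z q = of_int (ct ?b p - ct ?b q)"
      if "z \<in> ?U" "p \<in> {1..n}" "q \<in> {1..n}" "hook (?b p) = hook (?b q)" for z p q
    proof -
      have "?b p \<in> principal_hook lam (hook (?b p))" "?b q \<in> principal_hook lam (hook (?b p))"
        using hook_principal_hook inD that by auto
      then have "z p = z q"
        using that(1-3) unfolding fusion_domain_def hook_subspace_def n[symmetric] by blast
      then show ?thesis by (simp add: x_def ct_box_of)
    qed
    obtain E where E: "gv (\<lambda>z. fus (x z) n) E" "galg.weight n ?b E"
      using fus_value[where x = x, OF g sx inj hk] by blast
    have "gv (\<lambda>z. fus (x z) n) (star E)"
      by (rule gv_cong[OF gv_star[OF E(1)]]) (rule star_fus[OF inj, symmetric])
    then have sE: "star E = E" by (rule gv_unique[OF _ E(1)])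
    have L: "has_rational_value n ?U (\<lambda>z. lookup (fus (x z) n) h) (diag_point n t) (lookup E h)" for h
      using E(1) unfolding gv_def by blast
    have "lookup E 0 = 1"
      using L[of 0] unfolding lookup_fus_0 by (rule sv_unique[OF _ sv_const])
    moreover have "has_rational_value n ?U (\<lambda>z. fusion_product lam \<Lambda> z g) (diag_point n t) (lookup E (Perm g))"
      if "g \<in> Sym n" for g
      using L[of "Perm g"] that unfolding fusion_product_eq[OF n] x_def by simp
    ultimately show ?thesis using E(2) sE by blast
  qed
  have zero: "has_rational_value n ?U (\<lambda>z. fusion_product lam \<Lambda> z g) (diag_point n t) 0" if "g \<notin> Sym n" for g t
  proof -
    interpret regval ?U "\<lambda>f. has_rational_value n ?U f (diag_point n t)"
      by (rule regval_rational[OF assms(2,3)])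
    show ?thesis using that sv_const[of 0] unfolding fusion_product_eq[OF n] by simp
  qed
  have the: "(THE w. has_rational_value n ?U f (diag_point n t) w) = w"
    if "has_rational_value n ?U f (diag_point n t) w" for f t w
    using that fusion_value_unique unfolding n by blast
  have "gring_regular_at n ?U (fusion_product lam \<Lambda>) (diag_point n t)" for t
    unfolding gring_regular_at_def using main[of t] zero by blast
  moreover have "gring_value_at n ?U (fusion_product lam \<Lambda>) (diag_point n t) = matrix_element n \<rho> ip (v \<Lambda>)"
    if irr: "irreducible_module_of lam scale \<rho>" and inv: "invariant_inner_product n scale \<rho> ip"
      and yb: "young_basis lam scale \<rho> ip v" for t
  proof
    fix h
    show "gring_value_at n ?U (fusion_product lam \<Lambda>) (diag_point n t) h = matrix_element n \<rho> ip (v \<Lambda>) h"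
    proof (cases "h \<in> Sym n")
      case False
      then show ?thesis using the[OF zero[OF False]] by (simp add: gring_value_at_def matrix_element_def)
    next
      case True
      obtain E where E: "has_rational_value n ?U (\<lambda>z. fusion_product lam \<Lambda> z h) (diag_point n t) (lookup E (Perm h))"
        and w: "galg.weight n ?b E" and sE: "star E = E" and E0: "lookup E 0 = 1"
        using main[of t] True by blast
      have rep: "Defs.representation n scale \<rho>"
        using irr unfolding irreducible_module_of_def irreducible_representation_def n by blast
      then have "sym_rep scale n \<rho>"
        unfolding sym_rep_def sym_rep_axioms_def by (simp add: Defs.representation_def)
      then interpret V: unitary_rep scale n \<rho> ip
        unfolding unitary_rep_def unitary_rep_axioms_def using inv by blast
      have wv: "V.weight ?b (v \<Lambda>)"
        using yb assms(3) unfolding young_basis_def V.weight_def ct_box_of n[symmetric] by blast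
      have norm: "ip (v \<Lambda>) (v \<Lambda>) = 1"
        using yb assms(3) unfolding young_basis_def by simp
      \<comment> \<open>The inverse is used because the coefficient of E at h is the coefficient at
        the identity of h^-1 E.\<close>
      obtain ks where ks: "set ks \<subseteq> {1..<n}" "word_perm ks = inv h"
        using word_perm_exists[OF True] by blast
      let ?c = "of_real (word_coef ?b n ks id) :: complex"
      have "ip (v \<Lambda>) (\<rho> (word_perm ks) (v \<Lambda>)) = ?c * ip (v \<Lambda>) (v \<Lambda>)"
      proof (rule V.weight_functional_rho[OF g wv _ _ _ _ _ _ ks(1), where M = UNIV])
        show "ip (v \<Lambda>) (V.X p y) = of_int (ct ?b p) * ip (v \<Lambda>) y" if "p \<in> {1..n}" for p y
          using V.ip_X[OF that, of "v \<Lambda>" y] wv that by (simp add: V.weight_def V.ip_scale_left)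
      qed (simp_all add: V.ip_add V.ip_scale)
      then have 1: "ip (v \<Lambda>) (\<rho> (inv h) (v \<Lambda>)) = ?c" using ks norm by simp
      have hp: "h permutes {1..n}" using True by (simp add: Sym_def)
      then have ih: "inv h \<in> Sym n" using permutes_inv by (simp add: Sym_def)
      have "\<rho> h (\<rho> (inv h) (v \<Lambda>)) = v \<Lambda>"
        using True ih permutes_inv_o(1)[OF hp] by (simp add: V.rho_comp V.rho_id)
      then have sw: "ip (v \<Lambda>) (\<rho> (inv h) (v \<Lambda>)) = ip (\<rho> h (v \<Lambda>)) (v \<Lambda>)"
        using V.ip_rho[OF True, of "v \<Lambda>" "\<rho> (inv h) (v \<Lambda>)"] by simp
      have "cnj (ip (v \<Lambda>) (\<rho> h (v \<Lambda>))) = ?c"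
        using 1 unfolding sw V.ip_cnj[of "\<rho> h (v \<Lambda>)" "v \<Lambda>"] .
      \<comment> \<open>\<open>word_coef\<close> is real, so the conjugation coming from the
        exchange of arguments disappears.\<close>
      then have 2: "ip (v \<Lambda>) (\<rho> h (v \<Lambda>)) = ?c"
        by (metis complex_cnj_cnj complex_cnj_complex_of_real)
      have "lookup (sg (inv h) * E) 0 = ?c"
        using lookup_weight_galg[OF g w sE ks(1)] ks(2) E0 by simp
      moreover have "- Perm (inv h) = Perm h"
        using hp ih True by (intro perm_eqI) (simp add: apply_uminus apply_Perm_Sym permutes_inv_inv)
      ultimately have "lookup E (Perm h) = ?c"
        by (simp add: sg_def lookup_single_mult)
      then show ?thesis
        using the[OF E] 2 True by (simp add: gring_value_at_def matrix_element_def)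
    qed
  qed
  ultimately show ?thesis by blast
qed

end
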